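(* Let $q,r$ be distinct primes and suppose either (i) $r\in\{3,5\}$, $q$ is odd, and $R\cong \mathrm{C}_q\times\mathrm{D}_{2r}$; or (ii) $R$ is a nonabelian group isomorphic to $\mathrm{C}_q\rtimes\mathrm{C}_r$. Let $S\subseteq R$, assume $S=S^{-1}$ in case (i), and let $G$ be a group with $\hat R<G\leq \mathrm{Aut}(\mathrm{Cay}(R,S))$ such that $\hat R$ is a maximal subgroup of $G$. Then one of the following occurs: (1) $\mathrm{Aut}(R)_S>1$; (2) $\hat R$ is core-free in $G$ and $G$ is almost simple; or (3) $R\cong\mathrm{C}_q\times\mathrm{D}_{2r}$, the core of $\hat R$ in $G$ is the (right regular image of the) subgroup $\mathrm{C}_q$ of $R$, and $G/\mathrm{C}_q$ is almost simple.
   Context: $\mathrm{C}_n$ is the cyclic group of order $n$, $\mathrm{D}_{2n}$ the dihedral group of order $2n$. For a group $R$ and $S\subseteq R$, the Cayley digraph $\mathrm{Cay}(R,S)$ has vertex set $R$ and an arc from $r$ to $sr$ whenever $s\in S$; $\hat R$ denotes the right regular representation of $R$, a subgroup of $\mathrm{Aut}(\mathrm{Cay}(R,S))$. $\mathrm{Aut}(R)_S$ is the group of automorphisms of $R$ fixing $S$ setwise. The core of a subgroup $X$ in $G$ is the largest normal subgroup of $G$ contained in $X$; $X$ is core-free if its core is trivial. *)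

theory Defs
  imports "HOL-Algebra.Algebra"
begin

abbreviation cyclic_group :: "nat \<Rightarrow> int monoid" where
  "cyclic_group n \<equiv> integer_mod_group n"

text \<open>Dihedral group of order 2n: pairs (a, e) standing for x^a y^e with
  x of order n, y an involution, y x y = x^-1.\<close>
definition dihedral_group :: "nat \<Rightarrow> (int \<times> bool) monoid" where
  "dihedral_group n =
     \<lparr>carrier = {0..<int n} \<times> UNIV,
      monoid.mult = (\<lambda>(a, e) (b, f). ((a + (if e then - b else b)) mod int n, e \<noteq> f)),
      one = (0, False)\<rparr>"

text \<open>Semidirect product C_q \<rtimes> C_r, the generator of C_r acting on C_q by
  multiplication by k (k^r = 1 mod q). Every semidirect product C_q \<rtimes> C_r
  is of this shape since Aut(C_q) is the unit group of Z/qZ.\<close>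
definition semidirect_cyclic :: "nat \<Rightarrow> nat \<Rightarrow> int \<Rightarrow> (int \<times> int) monoid" where
  "semidirect_cyclic q r k =
     \<lparr>carrier = {0..<int q} \<times> {0..<int r},
      monoid.mult = (\<lambda>(a, b) (c, d). ((a + k ^ nat b * c) mod int q, (b + d) mod int r)),
      one = (0, 0)\<rparr>"

definition right_reg :: "('a, 'b) monoid_scheme \<Rightarrow> 'a \<Rightarrow> ('a \<Rightarrow> 'a)" where
  "right_reg R g = (\<lambda>x \<in> carrier R. x \<otimes>\<^bsub>R\<^esub> g)"

definition right_reg_image :: "('a, 'b) monoid_scheme \<Rightarrow> ('a \<Rightarrow> 'a) set" where
  "right_reg_image R = right_reg R ` carrier R"

definition cay_arc :: "('a, 'b) monoid_scheme \<Rightarrow> 'a set \<Rightarrow> 'a \<Rightarrow> 'a \<Rightarrow> bool" where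
  "cay_arc R S x y \<longleftrightarrow> x \<in> carrier R \<and> y \<in> carrier R \<and> y \<otimes>\<^bsub>R\<^esub> inv\<^bsub>R\<^esub> x \<in> S"

definition cay_aut :: "('a, 'b) monoid_scheme \<Rightarrow> 'a set \<Rightarrow> ('a \<Rightarrow> 'a) set" where
  "cay_aut R S = {\<sigma> \<in> Bij (carrier R).
      \<forall>x \<in> carrier R. \<forall>y \<in> carrier R. cay_arc R S x y \<longleftrightarrow> cay_arc R S (\<sigma> x) (\<sigma> y)}"

definition nontrivial_aut_fixing :: "('a, 'b) monoid_scheme \<Rightarrow> 'a set \<Rightarrow> bool" where
  "nontrivial_aut_fixing R S \<longleftrightarrow>
     (\<exists>\<alpha> \<in> iso R R. \<alpha> ` S = S \<and> (\<exists>x \<in> carrier R. \<alpha> x \<noteq> x))"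

definition maximal_subgroup :: "'a set \<Rightarrow> ('a, 'b) monoid_scheme \<Rightarrow> bool" where
  "maximal_subgroup H G \<longleftrightarrow> subgroup H G \<and> H \<noteq> carrier G \<and>
     (\<forall>K. subgroup K G \<longrightarrow> H \<subseteq> K \<longrightarrow> K = H \<or> K = carrier G)"

definition core :: "'a set \<Rightarrow> ('a, 'b) monoid_scheme \<Rightarrow> 'a set" where
  "core H G = carrier G \<inter> (\<Inter>g \<in> carrier G. (\<lambda>h. g \<otimes>\<^bsub>G\<^esub> h \<otimes>\<^bsub>G\<^esub> inv\<^bsub>G\<^esub> g) ` H)"

text \<open>Almost simple: G has a nonabelian simple normal subgroup T with trivial
  centralizer in G (equivalently T \<le> G \<le> Aut(T) after identification).\<close>
definition almost_simple :: "('a, 'b) monoid_scheme \<Rightarrow> bool" where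
  "almost_simple G \<longleftrightarrow> group G \<and> (\<exists>T. T \<lhd> G \<and>
     simple_group (G\<lparr>carrier := T\<rparr>) \<and> \<not> comm_group (G\<lparr>carrier := T\<rparr>) \<and>
     {g \<in> carrier G. \<forall>t \<in> T. g \<otimes>\<^bsub>G\<^esub> t = t \<otimes>\<^bsub>G\<^esub> g} = {\<one>\<^bsub>G\<^esub>})"

end

theory Submission
  imports Defs
begin

text \<open>The proof is elementary: no classification of permutation groups of small degree is used.
  Let N be the core. If N = R, a point stabiliser acts on R by automorphisms fixing S. Otherwise one looks for
  an abelian normal subgroup V of G. If N = 1, or if R/N is dihedral, compare a minimal normal subgroup of
  G (or of G/N) with the normal subgroups of prime order of R, whose normaliser is R by maximality: the
  minimal normal subgroup is either nonabelian simple with trivial centraliser, or abelian. If R/N is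
  abelian, it is a Frobenius complement in G/N, and V is found in the preimage of the Frobenius kernel.

  In the abelian case V can be chosen such that its orbits are the cosets Hx of a subgroup H of R of prime
  order. Let W be the set of points having the same stabiliser in V as the identity. Two different point
  stabilisers generate V, so each is transitive on the orbits whose points are fixed by the other, and
  S - W is a union of double cosets of H. Hence conjugation by an element of H, or another automorphism that
  moves points outside W only within such double cosets and preserves S inside W, fixes S.\<close>

subsection \<open>Conjugation and p-subgroups\<close>

text \<open>Two questions shape the abelian cases: how large \<open>W\<close> can be, and which
  automorphism is compatible with the little that is known about S inside \<open>W\<close>. A normal
  subgroup of R of prime order s contained in \<open>W\<close> acts on the quotient of V by a point
  stabiliser, a group of prime order p. If s does not divide p - 1, the action is trivial; this
  forces the subgroup to centralise V, to be normal in G = VR and so to lie in the core. Hence the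
  recurring conditions such as q not dividing r - 1. Inside \<open>W\<close> the symmetry S = S^-1
  makes an automorphism harmless wherever it agrees with inversion, and reflections of the dihedral
  factor are handled by the fact that every subset of Z/r with r = 3 or 5 is invariant under some j
  -> 2c - j. That an abelian R/N is a Frobenius complement is again maximality: R and a conjugate of
  R both normalise their intersection. The existence theorem for Frobenius kernels is avoided,
  because the stabiliser of the identity is a complement of the regular subgroup and the kernel is N
  times that stabiliser.\<close>

text \<open>E splits into orbits whose lengths divide a power of p, so the nontrivial orbits
  contribute a multiple of p. The action is a bare function \<open>f\<close>, so that translation of
  cosets and conjugation can be inserted directly.\<close>

lemma p_group_fixed_points:
  fixes P (structure) and E :: "'b set" and f :: "'a \<Rightarrow> 'b \<Rightarrow> 'b" and p n :: nat
  assumes P: "group P" "card (carrier P) = p ^ n" and p: "Factorial_Ring.prime p" and E: "finite E"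
    and closed: "\<And>g x. g \<in> carrier P \<Longrightarrow> x \<in> E \<Longrightarrow> f g x \<in> E"
    and one: "\<And>x. x \<in> E \<Longrightarrow> f \<one> x = x"
    and mult: "\<And>g h x. g \<in> carrier P \<Longrightarrow> h \<in> carrier P \<Longrightarrow> x \<in> E \<Longrightarrow> f (g \<otimes> h) x = f g (f h x)"
  shows "card E mod p = card {x \<in> E. \<forall>g\<in>carrier P. f g x = x} mod p"
proof -
  interpret group P by fact
  \<comment> \<open>Elements of \<open>BijGroup\<close> are extensional functions, hence the
    restriction to E.\<close>
  define \<phi> where "\<phi> = (\<lambda>g. restrict (f g) E)"
  have inv1: "f (inv g) (f g x) = x" "f g (f (inv g) x) = x" if "g \<in> carrier P" "x \<in> E" for g x
    using that by (simp_all flip: mult add: one)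
  have bij: "\<phi> g \<in> Bij E" if "g \<in> carrier P" for g
  proof -
    have "bij_betw (f g) E E"
      by (rule bij_betwI[of _ _ _ "f (inv g)"]) (use that closed inv1 in auto)
    then show ?thesis unfolding Bij_def \<phi>_def by (auto simp: bij_betw_def inj_on_def)
  qed
  have "\<phi> \<in> hom P (BijGroup E)"
  proof (rule homI)
    fix x y assume xy: "x \<in> carrier P" "y \<in> carrier P"
    show "\<phi> (x \<otimes> y) = \<phi> x \<otimes>\<^bsub>BijGroup E\<^esub> \<phi> y"
      using xy bij[OF xy(1)] bij[OF xy(2)]
      by (auto simp: BijGroup_def compose_def \<phi>_def mult closed intro!: restrict_ext)
  qed (use bij in \<open>auto simp: BijGroup_def\<close>)
  then interpret act: group_action P E \<phi>
    by (simp add: group_action_def group_hom_def group_hom_axioms_def group_BijGroup)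
  let ?F = "{x \<in> E. \<forall>g\<in>carrier P. f g x = x}"
  let ?C = "{B \<in> orbits P E \<phi>. card B \<noteq> 1}"
  have orb: "orbit P \<phi> x = {f g x |g. g \<in> carrier P}" if "x \<in> E" for x
    using that by (auto simp: orbit_def \<phi>_def)
  have single: "card (orbit P \<phi> x) = 1 \<longleftrightarrow> x \<in> ?F" if x: "x \<in> E" for x
  proof
    assume "card (orbit P \<phi> x) = 1"
    then obtain y where "orbit P \<phi> x = {y}" by (auto simp: card_Suc_eq)
    then show "x \<in> ?F" using act.orbit_refl[OF x] orb[OF x] x by auto
  next
    assume F: "x \<in> ?F"
    then have "orbit P \<phi> x \<subseteq> {x}" using orb[OF x] by auto
    then have "orbit P \<phi> x = {x}" using act.orbit_refl[OF x] by auto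
    then show "card (orbit P \<phi> x) = 1" by simp
  qed
  have un: "\<Union>?C = E - ?F"
  proof
    show "\<Union>?C \<subseteq> E - ?F"
    proof
      fix y assume "y \<in> \<Union>?C"
      then obtain x where x: "x \<in> E" "y \<in> orbit P \<phi> x" "card (orbit P \<phi> x) \<noteq> 1"
        by (auto simp: orbits_def)
      then have yE: "y \<in> E" using orb closed by auto
      have "orbit P \<phi> y = orbit P \<phi> x"
        using act.disjoint_union[of "orbit P \<phi> y" "orbit P \<phi> x"] x yE act.orbit_refl[OF yE]
        by (auto simp: orbits_def)
      then show "y \<in> E - ?F" using single[OF yE] x yE by auto
    qed
    show "E - ?F \<subseteq> \<Union>?C"
      using single act.orbit_refl by (fastforce simp: orbits_def)
  qed
  have "p dvd card (\<Union>?C)"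
  proof (rule dvd_partition)
    show "finite (\<Union>?C)" using un E by auto
    show "\<forall>c\<in>?C. p dvd card c"
    proof
      fix c assume "c \<in> ?C"
      then obtain x where x: "x \<in> E" "c = orbit P \<phi> x" "card c \<noteq> 1"
        by (auto simp: orbits_def)
      have "card c dvd p ^ n"
        using act.orbit_stabilizer_theorem[OF x(1)] P(2) x(2) unfolding order_def
        by (metis dvd_triv_left)
      then obtain i where "card c = p ^ i" using divides_primepow_nat[OF p] by blast
      then show "p dvd card c" using x(3) by (cases i) auto
    qed
    show "\<forall>c1\<in>?C. \<forall>c2\<in>?C. c1 \<noteq> c2 \<longrightarrow> c1 \<inter> c2 = {}"
      using act.disjoint_union by auto
  qed
  then obtain k where "card (E - ?F) = p * k" unfolding un by (rule dvdE)
  moreover have "card E = card ?F + card (E - ?F)"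
    using E card_Diff_subset[of ?F E] card_mono[of E ?F] by simp
  ultimately show ?thesis by simp
qed

section \<open>Conjugation, normalisers and centralisers\<close>

definition conjg :: "('a, 'b) monoid_scheme \<Rightarrow> 'a \<Rightarrow> 'a \<Rightarrow> 'a"
  where "conjg G g x = g \<otimes>\<^bsub>G\<^esub> x \<otimes>\<^bsub>G\<^esub> inv\<^bsub>G\<^esub> g"

definition set_normalizer :: "('a, 'b) monoid_scheme \<Rightarrow> 'a set \<Rightarrow> 'a set"
  where "set_normalizer G U = {g \<in> carrier G. conjg G g ` U = U}"

definition set_centralizer :: "('a, 'b) monoid_scheme \<Rightarrow> 'a set \<Rightarrow> 'a set"
  where "set_centralizer G U = {g \<in> carrier G. \<forall>x\<in>U. g \<otimes>\<^bsub>G\<^esub> x = x \<otimes>\<^bsub>G\<^esub> g}"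

context group
begin

lemma inv_cancel [simp]:
  assumes "x \<in> carrier G" "y \<in> carrier G"
  shows "inv x \<otimes> (x \<otimes> y) = y" "x \<otimes> (inv x \<otimes> y) = y"
  using assms by (simp_all flip: m_assoc)

lemma conjg_closed [simp]: "g \<in> carrier G \<Longrightarrow> x \<in> carrier G \<Longrightarrow> conjg G g x \<in> carrier G"
  by (simp add: conjg_def)

lemma conjg_mult: "g \<in> carrier G \<Longrightarrow> h \<in> carrier G \<Longrightarrow> x \<in> carrier G \<Longrightarrow>
    conjg G (g \<otimes> h) x = conjg G g (conjg G h x)"
  by (simp add: conjg_def m_assoc inv_mult_group)

lemma conjg_of_mult: "g \<in> carrier G \<Longrightarrow> x \<in> carrier G \<Longrightarrow> y \<in> carrier G \<Longrightarrow>
    conjg G g (x \<otimes> y) = conjg G g x \<otimes> conjg G g y"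
  by (simp add: conjg_def m_assoc)

lemma conjg_of_inv: "g \<in> carrier G \<Longrightarrow> x \<in> carrier G \<Longrightarrow> conjg G g (inv x) = inv (conjg G g x)"
  by (simp add: conjg_def m_assoc inv_mult_group)

lemma conjg_of_one [simp]: "g \<in> carrier G \<Longrightarrow> conjg G g \<one> = \<one>"
  by (simp add: conjg_def)

lemma one_conjg [simp]: "x \<in> carrier G \<Longrightarrow> conjg G \<one> x = x"
  by (simp add: conjg_def)

lemma conjg_inv_cancel [simp]:
  assumes "g \<in> carrier G" "x \<in> carrier G"
  shows "conjg G (inv g) (conjg G g x) = x" "conjg G g (conjg G (inv g) x) = x"
  using assms by (simp_all flip: conjg_mult)

lemma conjg_eq_iff: "g \<in> carrier G \<Longrightarrow> x \<in> carrier G \<Longrightarrow> conjg G g x = x \<longleftrightarrow> g \<otimes> x = x \<otimes> g"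
  by (simp add: conjg_def inv_solve_right')

lemma conjg_inj_on: "g \<in> carrier G \<Longrightarrow> U \<subseteq> carrier G \<Longrightarrow> inj_on (conjg G g) U"
  by (rule inj_on_inverseI[where g = "conjg G (inv g)"]) auto

lemma conjg_of_pow: "g \<in> carrier G \<Longrightarrow> x \<in> carrier G \<Longrightarrow> conjg G g (x [^] (n::nat)) = conjg G g x [^] n"
  by (induction n) (simp_all add: conjg_of_mult)

lemma subgroup_conjg:
  assumes H: "subgroup H G" and g: "g \<in> carrier G"
  shows "subgroup (conjg G g ` H) G"
proof (rule subgroupI)
  have c: "h \<in> carrier G" if "h \<in> H" for h using H that by (rule subgroup.mem_carrier)
  show "conjg G g ` H \<subseteq> carrier G" using c g by auto
  show "conjg G g ` H \<noteq> {}" using H subgroup_nonempty by auto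
  show "inv a \<in> conjg G g ` H" if "a \<in> conjg G g ` H" for a
  proof -
    obtain h where h: "h \<in> H" "a = conjg G g h" using \<open>a \<in> conjg G g ` H\<close> by auto
    then show ?thesis using c[of h] g subgroup.m_inv_closed[OF H, of h]
      by (auto intro!: image_eqI[where x = "inv h"] simp: conjg_of_inv)
  qed
  show "a \<otimes> b \<in> conjg G g ` H" if a: "a \<in> conjg G g ` H" and b: "b \<in> conjg G g ` H" for a b
  proof -
    obtain h k where h: "h \<in> H" "a = conjg G g h" "k \<in> H" "b = conjg G g k" using a b by auto
    then show ?thesis using c[of h] c[of k] g subgroup.m_closed[OF H, of h k]
      by (auto intro!: image_eqI[where x = "h \<otimes> k"] simp: conjg_of_mult)
  qed
qed

lemma normal_iff_conjg: "H \<lhd> G \<longleftrightarrow> subgroup H G \<and> (\<forall>g\<in>carrier G. \<forall>h\<in>H. conjg G g h \<in> H)"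
  by (simp add: normal_inv_iff conjg_def)

lemma normal_conjg_image:
  assumes "H \<lhd> G" "g \<in> carrier G"
  shows "conjg G g ` H = H"
proof
  show "conjg G g ` H \<subseteq> H" using assms by (auto simp: normal_iff_conjg)
  show "H \<subseteq> conjg G g ` H"
  proof
    fix h assume h: "h \<in> H"
    then have "h \<in> carrier G" using assms(1) normal_imp_subgroup subgroup.mem_carrier by metis
    moreover have "conjg G (inv g) h \<in> H" using assms h by (simp add: normal_iff_conjg)
    ultimately show "h \<in> conjg G g ` H"
      using assms(2) by (auto intro!: image_eqI[where x = "conjg G (inv g) h"])
  qed
qed

lemma set_normalizer_subgroup:
  assumes "U \<subseteq> carrier G"
  shows "subgroup (set_normalizer G U) G"
proof (rule subgroupI)
  have one: "conjg G \<one> ` U = U" using assms by (force simp: image_iff)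
  then show "set_normalizer G U \<noteq> {}" by (auto simp: set_normalizer_def)
  have comp: "conjg G (g \<otimes> h) ` U = conjg G g ` conjg G h ` U" if "g \<in> carrier G" "h \<in> carrier G" for g h
    using that assms by (force simp: image_image conjg_mult intro!: image_cong)
  show "a \<otimes> b \<in> set_normalizer G U" if "a \<in> set_normalizer G U" "b \<in> set_normalizer G U" for a b
    using that comp by (auto simp: set_normalizer_def)
  show "inv a \<in> set_normalizer G U" if "a \<in> set_normalizer G U" for a
    using that comp[of "inv a" a] one by (auto simp: set_normalizer_def)
qed (auto simp: set_normalizer_def)

text \<open>Conjugation is injective, so on a finite set mapping into U already means mapping onto
  U.\<close>

lemma set_normalizerI:
  assumes "finite U" "U \<subseteq> carrier G" "g \<in> carrier G" "\<And>x. x \<in> U \<Longrightarrow> conjg G g x \<in> U"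
  shows "g \<in> set_normalizer G U"
proof -
  have "conjg G g ` U = U"
    by (rule card_subset_eq) (use assms conjg_inj_on in \<open>auto simp: card_image\<close>)
  then show ?thesis using assms by (simp add: set_normalizer_def)
qed

lemma set_centralizer_subgroup:
  assumes "U \<subseteq> carrier G"
  shows "subgroup (set_centralizer G U) G"
proof (rule subgroupI)
  show "a \<otimes> b \<in> set_centralizer G U"
    if "a \<in> set_centralizer G U" "b \<in> set_centralizer G U" for a b
    using that assms unfolding set_centralizer_def
    by (auto simp: subset_eq) (metis m_assoc)
  show "inv a \<in> set_centralizer G U" if a: "a \<in> set_centralizer G U" for a
  proof -
    have "inv a \<otimes> x = x \<otimes> inv a" if x: "x \<in> U" for x
    proof -
      have c: "a \<in> carrier G" "x \<in> carrier G" "a \<otimes> x = x \<otimes> a"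
        using a x assms by (auto simp: set_centralizer_def)
      have "inv a \<otimes> x = inv a \<otimes> (x \<otimes> a) \<otimes> inv a" using c(1,2) by (simp add: m_assoc)
      also have "\<dots> = x \<otimes> inv a" using c by (simp add: c(3)[symmetric] m_assoc)
      finally show ?thesis .
    qed
    then show ?thesis using a by (auto simp: set_centralizer_def)
  qed
next
  have "\<one> \<in> set_centralizer G U" using assms by (auto simp: set_centralizer_def)
  then show "set_centralizer G U \<noteq> {}" by auto
qed (auto simp: set_centralizer_def)

lemma set_centralizer_normal:
  assumes "N \<lhd> G"
  shows "set_centralizer G N \<lhd> G"
  unfolding normal_iff_conjg
proof (intro conjI ballI)
  have N: "N \<subseteq> carrier G" using assms normal_imp_subgroup subgroup.subset by blast
  show "subgroup (set_centralizer G N) G" by (rule set_centralizer_subgroup[OF N])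
  fix g c assume g: "g \<in> carrier G" and c: "c \<in> set_centralizer G N"
  have cc: "c \<in> carrier G" using c by (simp add: set_centralizer_def)
  have "conjg G (conjg G g c) n = n" if n: "n \<in> N" for n
  proof -
    have n': "conjg G (inv g) n \<in> N" using assms g n by (simp add: normal_iff_conjg)
    have "conjg G c (conjg G (inv g) n) = conjg G (inv g) n"
      using c n' N by (subst conjg_eq_iff) (auto simp: set_centralizer_def)
    then have "conjg G g (conjg G c (conjg G (inv g) n)) = n" using g n N by auto
    moreover have "conjg G (conjg G g c) n = conjg G g (conjg G c (conjg G (inv g) n))"
      using g cc n N unfolding conjg_def[of G g c]
      by (simp add: conjg_mult subset_eq)
    ultimately show ?thesis by simp
  qed
  then show "conjg G g c \<in> set_centralizer G N"
    using g cc N by (auto simp: set_centralizer_def conjg_eq_iff[symmetric] subset_eq)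
qed

section \<open>Cosets and products of subgroups\<close>

text \<open>Lagrange relative to a subgroup J, with the cosets written as an image of J; in this
  form it also counts V/U and the images of subgroups in a quotient by N.\<close>

lemma lagrange_sub:
  assumes "subgroup H G" "subgroup J G" "H \<subseteq> J"
  shows "card ((\<lambda>g. H #> g) ` J) * card H = card J"
proof -
  interpret J: group "G\<lparr>carrier := J\<rparr>" using assms(2) subgroup_imp_group by blast
  have "subgroup H (G\<lparr>carrier := J\<rparr>)" using assms subgroup_incl by blast
  from J.lagrange[OF this] have "card (rcosets\<^bsub>G\<lparr>carrier := J\<rparr>\<^esub> H) * card H = card J"
    by (simp add: order_def)
  moreover have "rcosets\<^bsub>G\<lparr>carrier := J\<rparr>\<^esub> H = (\<lambda>g. H #> g) ` J"
    by (auto simp: RCOSETS_def)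
  ultimately show ?thesis by simp
qed

lemma card_subgroup_dvd:
  assumes "subgroup H G" "subgroup J G" "H \<subseteq> J"
  shows "card H dvd card J"
  using dvdI[OF lagrange_sub[OF assms, symmetric, unfolded mult.commute[of _ "card H"]]] .

lemma rcos_eq_iff:
  assumes "subgroup H G" "x \<in> carrier G" "y \<in> carrier G"
  shows "H #> x = H #> y \<longleftrightarrow> x \<otimes> inv y \<in> H"
proof
  assume "H #> x = H #> y"
  then have "x \<in> H #> y" using rcos_self[OF assms(2,1)] by simp
  then show "x \<otimes> inv y \<in> H"
    using assms subgroup.rcos_module_imp[OF assms(1) group_axioms assms(3)] by blast
next
  assume "x \<otimes> inv y \<in> H"
  then have "x \<in> H #> y"
    using assms subgroup.rcos_module_rev[OF assms(1) group_axioms assms(3,2)] by blast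
  then show "H #> x = H #> y" using assms repr_independence by metis
qed

text \<open>All fibres of multiplication on H \<times> K have the size of H \<inter> K: the pairs
  over h k are (h d, d^-1 k) with d in the intersection.\<close>

lemma card_set_mult:
  assumes fin: "finite (carrier G)" and H: "subgroup H G" and K: "subgroup K G"
  shows "card (H <#> K) * card (H \<inter> K) = card H * card K"
proof -
  have HK: "subgroup (H \<inter> K) G" using H K subgroups_Inter_pair by blast
  have sub: "H \<subseteq> carrier G" "K \<subseteq> carrier G" using H K subgroup.subset by auto
  have "finite H" "finite K" using sub fin finite_subset by auto
  then have fins: "finite H" "finite K" "finite (H <#> K)" by (auto simp: set_mult_def)
  let ?f = "\<lambda>(h, k). h \<otimes> k"
  have fib: "card {x \<in> H \<times> K. ?f x = y} = card (H \<inter> K)" if y: "y \<in> H <#> K" for y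
  proof -
    obtain h k where hk: "h \<in> H" "k \<in> K" "y = h \<otimes> k" using y by (auto simp: set_mult_def)
    have bij: "bij_betw (\<lambda>d. (h \<otimes> d, inv d \<otimes> k)) (H \<inter> K) {x \<in> H \<times> K. ?f x = y}"
    proof (rule bij_betwI[where g = "\<lambda>x. inv h \<otimes> fst x"])
      show "(\<lambda>d. (h \<otimes> d, inv d \<otimes> k)) \<in> H \<inter> K \<rightarrow> {x \<in> H \<times> K. ?f x = y}"
        using hk sub H K
        by (auto simp: subgroup.m_closed subgroup.m_inv_closed m_assoc subset_eq)
      show "(\<lambda>x. inv h \<otimes> fst x) \<in> {x \<in> H \<times> K. ?f x = y} \<rightarrow> H \<inter> K"
      proof
        fix x assume "x \<in> {x \<in> H \<times> K. ?f x = y}"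
        then obtain h' k' where x: "x = (h', k')" "h' \<in> H" "k' \<in> K" "h' \<otimes> k' = h \<otimes> k"
          using hk by auto
        have c: "h \<in> carrier G" "h' \<in> carrier G" "k \<in> carrier G" "k' \<in> carrier G"
          using x hk sub by auto
        have "inv h \<otimes> h' = inv h \<otimes> (h' \<otimes> k') \<otimes> inv k'" using c by (simp add: m_assoc)
        also have "\<dots> = k \<otimes> inv k'" using c by (simp add: x(4) m_assoc)
        finally have "inv h \<otimes> h' \<in> K" using K x hk by (simp add: subgroup.m_closed subgroup.m_inv_closed)
        then show "inv h \<otimes> fst x \<in> H \<inter> K"
          using H x hk by (simp add: subgroup.m_closed subgroup.m_inv_closed)
      qed
      show "inv h \<otimes> fst (h \<otimes> d, inv d \<otimes> k) = d" if "d \<in> H \<inter> K" for d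
        using that hk sub by (simp add: subset_eq)
      show "(h \<otimes> (inv h \<otimes> fst x), inv (inv h \<otimes> fst x) \<otimes> k) = x"
        if x0: "x \<in> {x \<in> H \<times> K. ?f x = y}" for x
      proof -
        obtain h' k' where x: "x = (h', k')" "h' \<in> H" "k' \<in> K" "h' \<otimes> k' = h \<otimes> k"
          using x0 hk by auto
        have c: "h \<in> carrier G" "h' \<in> carrier G" "k \<in> carrier G" "k' \<in> carrier G"
          using x hk sub by auto
        show ?thesis using c by (simp add: x(1) inv_mult_group m_assoc x(4)[symmetric])
      qed
    qed
    show ?thesis using bij_betw_same_card[OF bij] by (rule sym)
  qed
  have "card H * card K = card (H \<times> K)" by (simp add: card_cartesian_product)
  also have "H \<times> K = (\<Union>y \<in> H <#> K. {x \<in> H \<times> K. ?f x = y})"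
    by (auto simp: set_mult_def)
  also have "card \<dots> = (\<Sum>y \<in> H <#> K. card {x \<in> H \<times> K. ?f x = y})"
    by (rule card_UN_disjoint) (use fins in auto)
  also have "\<dots> = card (H <#> K) * card (H \<inter> K)" by (simp add: fib)
  finally show ?thesis by simp
qed

lemma set_mult_subgroup:
  assumes H: "subgroup H G" and K: "subgroup K G" and n: "\<And>h k. h \<in> H \<Longrightarrow> k \<in> K \<Longrightarrow> conjg G h k \<in> K"
  shows "subgroup (K <#> H) G"
proof (rule subgroupI)
  have c: "h \<in> H \<Longrightarrow> h \<in> carrier G" "k \<in> K \<Longrightarrow> k \<in> carrier G" for h k
    using H K by (blast intro: subgroup.mem_carrier)+
  show "K <#> H \<subseteq> carrier G" using c by (auto simp: set_mult_def)
  show "K <#> H \<noteq> {}"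
    using subgroup.one_closed[OF H] subgroup.one_closed[OF K] by (auto simp: set_mult_def)
  show "inv a \<in> K <#> H" if a0: "a \<in> K <#> H" for a
  proof -
    obtain k h where a: "k \<in> K" "h \<in> H" "a = k \<otimes> h" using a0 by (auto simp: set_mult_def)
    have "inv a = conjg G (inv h) (inv k) \<otimes> inv h"
      using a c by (simp add: conjg_def m_assoc inv_mult_group)
    then show ?thesis using a n[of "inv h" "inv k"] H K subgroup.m_inv_closed by (fastforce simp: set_mult_def)
  qed
  show "a \<otimes> b \<in> K <#> H" if "a \<in> K <#> H" "b \<in> K <#> H" for a b
  proof -
    obtain k h k' h' where a: "k \<in> K" "h \<in> H" "a = k \<otimes> h" "k' \<in> K" "h' \<in> H" "b = k' \<otimes> h'"
      using \<open>a \<in> K <#> H\<close> \<open>b \<in> K <#> H\<close> by (auto simp: set_mult_def)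
    have "a \<otimes> b = (k \<otimes> conjg G h k') \<otimes> (h \<otimes> h')"
      using a c by (simp add: conjg_def m_assoc)
    then show ?thesis
      using a n[of h k'] subgroup.m_closed[OF K, of k "conjg G h k'"] subgroup.m_closed[OF H, of h h']
      by (fastforce simp: set_mult_def)
  qed
qed

section \<open>Sylow-type arguments by counting fixed cosets\<close>

text \<open>P acts on the cosets of Q in J. Their number k is prime to p, so some coset Qg is fixed,
  which says that g conjugates P into Q. Here Q may be any subgroup of index prime to p, in
  particular a normaliser, as in the Frattini argument below.\<close>

lemma p_subgroup_conj_into:
  assumes fin: "finite (carrier G)" and J: "subgroup J G"
    and P: "subgroup P G" "P \<subseteq> J" "card P = p ^ n" and p: "Factorial_Ring.prime p"
    and Q: "subgroup Q G" "Q \<subseteq> J" and idx: "card J = card Q * k" "\<not> p dvd k"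
  shows "\<exists>g\<in>J. conjg G g ` P \<subseteq> Q"
proof -
  let ?E = "(\<lambda>g. Q #> g) ` J"
  have c: "j \<in> J \<Longrightarrow> j \<in> carrier G" "x \<in> P \<Longrightarrow> x \<in> carrier G" "x \<in> Q \<Longrightarrow> x \<in> carrier G" for j x
    using J P(1) Q(1) by (blast intro: subgroup.mem_carrier)+
  have Qc: "Q \<subseteq> carrier G" using c by auto
  have PJ: "x \<in> P \<Longrightarrow> x \<in> J" for x using P by auto
  \<comment> \<open>Right cosets are moved by the inverse, so that the rule is a left
    action.\<close>
  have act: "(Q #> g) #> inv x = Q #> (g \<otimes> inv x)" if "g \<in> J" "x \<in> P" for g x
    using that c Qc by (simp add: coset_mult_assoc)
  have fJ: "finite J" using J fin finite_subset subgroup.subset by metis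
  have cQ: "card Q > 0" using fin Q(1) subgroup.finite_imp_card_positive by blast
  have cE: "card ?E = k"
    using lagrange_sub[OF Q(1) J Q(2)] idx(1) cQ by auto
  have "card ?E mod p = card {C \<in> ?E. \<forall>x\<in>carrier (G\<lparr>carrier := P\<rparr>). C #> inv x = C} mod p"
  proof (rule p_group_fixed_points[where f = "\<lambda>x C. C #> inv x"])
    show "group (G\<lparr>carrier := P\<rparr>)" using P(1) subgroup_imp_group by blast
    show "card (carrier (G\<lparr>carrier := P\<rparr>)) = p ^ n" using P by simp
    show "finite ?E" using fJ by simp
    show "C #> inv x \<in> ?E" if "x \<in> carrier (G\<lparr>carrier := P\<rparr>)" "C \<in> ?E" for x C
      using that act PJ J by (auto simp: subgroup.m_closed subgroup.m_inv_closed)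
    show "C #> inv \<one>\<^bsub>G\<lparr>carrier := P\<rparr>\<^esub> = C" if "C \<in> ?E" for C
      using that c Qc by (auto simp: coset_mult_assoc)
    show "C #> inv (x \<otimes>\<^bsub>G\<lparr>carrier := P\<rparr>\<^esub> y) = C #> inv y #> inv x"
      if "x \<in> carrier (G\<lparr>carrier := P\<rparr>)" "y \<in> carrier (G\<lparr>carrier := P\<rparr>)" "C \<in> ?E" for x y C
      using that c Qc by (auto simp: coset_mult_assoc m_assoc inv_mult_group)
  qed (use p in auto)
  then have "k mod p = card {C \<in> ?E. \<forall>x\<in>P. C #> inv x = C} mod p"
    unfolding cE by simp
  then have "card {C \<in> ?E. \<forall>x\<in>P. C #> inv x = C} \<noteq> 0"
    using idx(2) by (metis dvd_eq_mod_eq_0 mod_0)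
  then have "{C \<in> ?E. \<forall>x\<in>P. C #> inv x = C} \<noteq> {}" by (metis card.empty)
  then obtain C where "C \<in> ?E" "\<forall>x\<in>P. C #> inv x = C" by blast
  then obtain g where g: "g \<in> J" "\<And>x. x \<in> P \<Longrightarrow> Q #> (g \<otimes> inv x) = Q #> g" using act by auto
  have "conjg G g x \<in> Q" if x: "x \<in> P" for x
  proof -
    have "g \<otimes> inv (inv x) \<otimes> inv g \<in> Q"
      using g(2)[of "inv x"] x c g(1) Q(1) P(1) by (simp add: rcos_eq_iff subgroup.m_inv_closed)
    then show ?thesis using x c by (simp add: conjg_def)
  qed
  then show ?thesis using g(1) by auto
qed

text \<open>The cosets fixed by A are those inside its normaliser, so |G:A| and |N(A):A| agree
  modulo s. Read contrapositively, it bounds the s-part of |G| once the normaliser is known.\<close>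

lemma prime_subgroup_normalizer_grows:
  assumes fin: "finite (carrier G)" and A: "subgroup A G" "card A = s" and s: "Factorial_Ring.prime s"
    and dvd: "s * s dvd card (carrier G)"
  shows "s * s dvd card (set_normalizer G A)"
proof -
  let ?E = "(\<lambda>g. A #> g) ` carrier G" and ?N = "set_normalizer G A"
  have c: "x \<in> A \<Longrightarrow> x \<in> carrier G" for x using A(1) by (blast intro: subgroup.mem_carrier)
  have Ac: "A \<subseteq> carrier G" using c by auto
  have N: "subgroup ?N G" by (rule set_normalizer_subgroup[OF Ac])
  have fA: "finite A" using Ac fin finite_subset by blast
  have act: "(A #> g) #> inv x = A #> (g \<otimes> inv x)" if "g \<in> carrier G" "x \<in> A" for g x
    using that c Ac by (simp add: coset_mult_assoc)
  have "card ?E mod s = card {C \<in> ?E. \<forall>x\<in>carrier (G\<lparr>carrier := A\<rparr>). C #> inv x = C} mod s"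
  proof (rule p_group_fixed_points[where f = "\<lambda>x C. C #> inv x" and n = 1])
    show "group (G\<lparr>carrier := A\<rparr>)" using A(1) subgroup_imp_group by blast
    show "C #> inv x \<in> ?E" if "x \<in> carrier (G\<lparr>carrier := A\<rparr>)" "C \<in> ?E" for x C
      using that act c by auto
    show "C #> inv \<one>\<^bsub>G\<lparr>carrier := A\<rparr>\<^esub> = C" if "C \<in> ?E" for C
      using that c Ac by (auto simp: coset_mult_assoc)
    show "C #> inv (x \<otimes>\<^bsub>G\<lparr>carrier := A\<rparr>\<^esub> y) = C #> inv y #> inv x"
      if "x \<in> carrier (G\<lparr>carrier := A\<rparr>)" "y \<in> carrier (G\<lparr>carrier := A\<rparr>)" "C \<in> ?E" for x y C
      using that c Ac by (auto simp: coset_mult_assoc m_assoc inv_mult_group)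
  qed (use s fin A in auto)
  moreover have "{C \<in> ?E. \<forall>x\<in>A. C #> inv x = C} = (\<lambda>g. A #> g) ` ?N"
  proof (rule Set.set_eqI, rule iffI)
    fix C assume "C \<in> {C \<in> ?E. \<forall>x\<in>A. C #> inv x = C}"
    then obtain g where g: "g \<in> carrier G" "C = A #> g" "\<And>x. x \<in> A \<Longrightarrow> A #> (g \<otimes> inv x) = A #> g"
      using act by auto
    have "conjg G g x \<in> A" if x: "x \<in> A" for x
    proof -
      have "g \<otimes> inv (inv x) \<otimes> inv g \<in> A"
        using g(3)[of "inv x"] x c g(1) A(1) by (simp add: rcos_eq_iff subgroup.m_inv_closed)
      then show ?thesis using x c by (simp add: conjg_def)
    qed
    then have "g \<in> ?N" using set_normalizerI[OF fA Ac g(1)] by auto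
    then show "C \<in> (\<lambda>g. A #> g) ` ?N" using g by auto
  next
    fix C assume "C \<in> (\<lambda>g. A #> g) ` ?N"
    then obtain g where g: "g \<in> carrier G" "conjg G g ` A = A" "C = A #> g"
      by (auto simp: set_normalizer_def)
    have "A #> (g \<otimes> inv x) = A #> g" if x: "x \<in> A" for x
    proof -
      have "conjg G g (inv x) \<in> A" using g(2) imageI[OF subgroup.m_inv_closed[OF A(1) x], of "conjg G g"] by simp
      then show ?thesis using x c g(1) A(1) by (simp add: rcos_eq_iff conjg_def)
    qed
    then show "C \<in> {C \<in> ?E. \<forall>x\<in>A. C #> inv x = C}" using g act by auto
  qed
  ultimately have m: "card ?E mod s = card ((\<lambda>g. A #> g) ` ?N) mod s" by simp
  have s0: "s > 0" using s prime_gt_0_nat by blast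
  have "s dvd card ?E"
    using lagrange_sub[OF A(1) subgroup_self Ac] dvd A(2) s0 by (metis mult_dvd_mono nat_mult_dvd_cancel1 mult.commute)
  then have "s dvd card ((\<lambda>g. A #> g) ` ?N)" using m by (metis dvd_eq_mod_eq_0)
  moreover have "A \<subseteq> ?N"
  proof
    fix x assume x: "x \<in> A"
    show "x \<in> ?N" by (rule set_normalizerI[OF fA Ac])
      (use x c A(1) in \<open>auto simp: conjg_def subgroup.m_closed subgroup.m_inv_closed\<close>)
  qed
  ultimately show ?thesis using lagrange_sub[OF A(1) N] A(2) by (metis mult_dvd_mono dvd_refl)
qed

text \<open>The class equation: the elements fixed under conjugation by V are counted modulo p, and
  \<open>\<one>\<close> is one of them.\<close>

lemma p_group_center:
  assumes V: "subgroup V G" "card V = p ^ n" "n > 0" and p: "Factorial_Ring.prime p" and fin: "finite V"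
  shows "\<exists>z\<in>V. z \<noteq> \<one> \<and> (\<forall>v\<in>V. v \<otimes> z = z \<otimes> v)"
proof -
  have c: "x \<in> V \<Longrightarrow> x \<in> carrier G" for x using V(1) by (blast intro: subgroup.mem_carrier)
  have "card V mod p = card {x \<in> V. \<forall>v\<in>carrier (G\<lparr>carrier := V\<rparr>). conjg G v x = x} mod p"
  proof (rule p_group_fixed_points)
    show "group (G\<lparr>carrier := V\<rparr>)" using V(1) subgroup_imp_group by blast
    show "conjg G v x \<in> V" if "v \<in> carrier (G\<lparr>carrier := V\<rparr>)" "x \<in> V" for v x
      using that V(1) by (simp add: conjg_def subgroup.m_closed subgroup.m_inv_closed)
  qed (use V p fin c in \<open>auto simp: conjg_mult\<close>)
  then have d: "p dvd card {x \<in> V. \<forall>v\<in>V. conjg G v x = x}" (is "_ dvd card ?Z")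
    using V(2,3) by (simp add: mod_eq_0_iff_dvd)
  have "\<one> \<in> ?Z" using V(1) c by (auto simp: subgroup.one_closed)
  then have "?Z \<noteq> {\<one>}" using d p by (metis card.empty card.insert empty_iff finite.emptyI nat_dvd_1_iff_1 not_prime_1 One_nat_def)
  then obtain z where z: "z \<in> ?Z" "z \<noteq> \<one>" using \<open>\<one> \<in> ?Z\<close> by blast
  then show ?thesis using c conjg_eq_iff by (intro bexI[of _ z]) auto
qed

lemma prime_subgroup_exists:
  assumes fin: "finite (carrier G)" and H: "subgroup H G" and p: "Factorial_Ring.prime p" and d: "p dvd card H"
  shows "\<exists>P. subgroup P G \<and> P \<subseteq> H \<and> card P = p"
proof -
  obtain m where m: "card H = p * m" using d by blast
  interpret H: group "G\<lparr>carrier := H\<rparr>" using H subgroup_imp_group by blast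
  have "finite H" using fin H finite_subset subgroup.subset by metis
  then obtain P where P: "subgroup P (G\<lparr>carrier := H\<rparr>)" "card P = p ^ 1"
    using sylow_thm[OF p H.group_axioms, of 1 m] m by (auto simp: order_def)
  then show ?thesis using incl_subgroup[OF H P(1)] subgroup.subset[OF P(1)] by auto
qed

lemma sylow_subgroup_exists:
  assumes fin: "finite (carrier G)" and H: "subgroup H G" and p: "Factorial_Ring.prime p"
  shows "\<exists>P n k. subgroup P G \<and> P \<subseteq> H \<and> card P = p ^ n \<and> card H = card P * k \<and> \<not> p dvd k"
proof -
  interpret H: group "G\<lparr>carrier := H\<rparr>" using H subgroup_imp_group by blast
  have fH: "finite H" using fin H finite_subset subgroup.subset by metis
  have "card H \<noteq> 0" using H fH subgroup_nonempty by auto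
  then obtain n k where nk: "\<not> p dvd k" "card H = p ^ n * k"
    using p by (metis multiplicity_decompose' not_prime_unit)
  obtain P where P: "subgroup P (G\<lparr>carrier := H\<rparr>)" "card P = p ^ n"
    using sylow_thm[OF p H.group_axioms, of n k] nk fH by (auto simp: order_def)
  moreover have "subgroup P G" "P \<subseteq> H"
    using incl_subgroup[OF H P(1)] subgroup.subset[OF P(1)] by auto
  ultimately show ?thesis using nk by metis
qed

subsection \<open>Prime actions, cyclic centralisers and Frobenius kernels\<close>

text \<open>The indices |K:U| and |V:K| multiply to a prime, so nothing lies strictly between U and
  V.\<close>

lemma prime_index_subgroup:
  assumes fin: "finite (carrier G)" and U: "subgroup U G" and K: "subgroup K G" and V: "subgroup V G"
    and sub: "U \<subseteq> K" "K \<subseteq> V" and idx: "card V = p * card U" and p: "Factorial_Ring.prime p" and ne: "K \<noteq> U"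
  shows "K = V"
proof -
  have fV: "finite V" using V fin finite_subset subgroup.subset by metis
  have fK: "finite K" using fV sub(2) finite_subset by blast
  have pos: "card U > 0" using U fin subgroup.finite_imp_card_positive by blast
  obtain i where i: "card K = card U * i" using card_subgroup_dvd[OF U K sub(1)] by (rule dvdE)
  obtain j where j: "card V = card K * j" using card_subgroup_dvd[OF K V sub(2)] by (rule dvdE)
  have "card U * p = card U * (i * j)" using i j idx by (simp add: mult.assoc mult.commute)
  then have "i * j = p" using pos by simp
  then have "i = 1 \<or> j = 1" using p by (metis prime_product)
  moreover have "i \<noteq> 1"
    using i ne card_subset_eq[OF fK sub(1)] by auto
  ultimately have "card K = card V" using j by simp
  then show ?thesis using card_subset_eq[OF fV sub(2)] by simp
qed

text \<open>A permutes the p cosets of U in V and fixes U itself. If it fixed no other coset, p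
  would be 1 modulo s, which is excluded.\<close>

lemma prime_action_trivial_on_quotient:
  assumes fin: "finite (carrier G)" and A: "subgroup A G" "card A = s" and s: "Factorial_Ring.prime s"
    and V: "subgroup V G" and comm: "\<And>v w. v \<in> V \<Longrightarrow> w \<in> V \<Longrightarrow> v \<otimes> w = w \<otimes> v"
    and U: "subgroup U G" "U \<subseteq> V" and idx: "card V = p * card U" and p: "Factorial_Ring.prime p" "\<not> s dvd p - 1"
    and AV: "\<And>a v. a \<in> A \<Longrightarrow> v \<in> V \<Longrightarrow> conjg G a v \<in> V"
    and AU: "\<And>a v. a \<in> A \<Longrightarrow> v \<in> U \<Longrightarrow> conjg G a v \<in> U"
    and aA: "a \<in> A" and vV: "v \<in> V"
  shows "conjg G a v \<otimes> inv v \<in> U"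
proof -
  let ?E = "(\<lambda>v. U #> v) ` V"
  have c: "x \<in> A \<Longrightarrow> x \<in> carrier G" "x \<in> V \<Longrightarrow> x \<in> carrier G" "x \<in> U \<Longrightarrow> x \<in> carrier G" for x
    using A(1) V U(1) by (blast intro: subgroup.mem_carrier)+
  have Uc: "U \<subseteq> carrier G" using c by auto
  have fV: "finite V" using V fin finite_subset subgroup.subset by metis
  have fU: "finite U" using fV U(2) finite_subset by blast
  have pos: "card U > 0" using U(1) fin subgroup.finite_imp_card_positive by blast
  have cE: "card ?E = p" using lagrange_sub[OF U(1) V U(2)] idx pos by auto
  have imU: "conjg G a ` U = U" if "a \<in> A" for a
    by (rule card_subset_eq[OF fU]) (use that AU c conjg_inj_on Uc in \<open>auto simp: card_image\<close>)
  have act: "conjg G a ` (U #> v) = U #> conjg G a v" if "a \<in> A" "v \<in> V" for a v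
  proof -
    have "conjg G a ` (U #> v) = (\<lambda>u. conjg G a u \<otimes> conjg G a v) ` U"
      using that c by (auto simp: r_coset_def conjg_of_mult image_iff)
    also have "\<dots> = (\<lambda>u. u \<otimes> conjg G a v) ` (conjg G a ` U)" by (simp add: image_image)
    also have "\<dots> = U #> conjg G a v" using imU[OF that(1)] by (auto simp: r_coset_def)
    finally show ?thesis .
  qed
  have "card ?E mod s = card {C \<in> ?E. \<forall>x\<in>carrier (G\<lparr>carrier := A\<rparr>). conjg G x ` C = C} mod s"
  proof (rule p_group_fixed_points[where f = "\<lambda>x C. conjg G x ` C" and n = 1])
    show "group (G\<lparr>carrier := A\<rparr>)" using A(1) subgroup_imp_group by blast
    show "conjg G x ` C \<in> ?E" if "x \<in> carrier (G\<lparr>carrier := A\<rparr>)" "C \<in> ?E" for x C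
      using that act AV by auto
    show "conjg G \<one>\<^bsub>G\<lparr>carrier := A\<rparr>\<^esub> ` C = C" if "C \<in> ?E" for C
      using that act[of \<one>] c subgroup.one_closed[OF A(1)] by auto
    show "conjg G (x \<otimes>\<^bsub>G\<lparr>carrier := A\<rparr>\<^esub> y) ` C = conjg G x ` conjg G y ` C"
      if "x \<in> carrier (G\<lparr>carrier := A\<rparr>)" "y \<in> carrier (G\<lparr>carrier := A\<rparr>)" and C: "C \<in> ?E" for x y C
    proof -
      have xy: "x \<in> A" "y \<in> A" using that by auto
      obtain v where "v \<in> V" "C = U #> v" using C by auto
      then show ?thesis using act xy AV c subgroup.m_closed[OF A(1) xy] by (simp add: conjg_mult)
    qed
  qed (use s fV A in auto)
  then have m: "p mod s = card {C \<in> ?E. \<forall>x\<in>A. conjg G x ` C = C} mod s" (is "_ = card ?F mod s")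
    unfolding cE by simp
  have UF: "U \<in> ?F"
  proof -
    have "U = U #> \<one>" using Uc by simp
    then have "U \<in> ?E" using subgroup.one_closed[OF V] by blast
    then show ?thesis using imU by auto
  qed
  have "?F \<noteq> {U}"
  proof
    assume "?F = {U}"
    then have "p mod s = 1 mod s" using m by simp
    moreover have "p \<ge> 1" using p(1) prime_gt_0_nat by (simp add: Suc_le_eq)
    ultimately have "s dvd p - 1" by (metis mod_eq_dvd_iff_nat)
    then show False using p(2) by blast
  qed
  then obtain C where C: "C \<in> ?F" "C \<noteq> U" using UF by blast
  then obtain v0 where v0: "v0 \<in> V" "C = U #> v0" by auto
  \<comment> \<open>The second fixed coset gives one element outside U on which A acts trivially
    modulo U. Since V is abelian, such elements form a subgroup, and the prime index of U makes it
    all of V.\<close>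
  let ?K = "{v \<in> V. \<forall>a\<in>A. conjg G a v \<otimes> inv v \<in> U}"
  have v0K: "v0 \<in> ?K"
  proof -
    have "conjg G a v0 \<otimes> inv v0 \<in> U" if a: "a \<in> A" for a
    proof -
      have "U #> conjg G a v0 = U #> v0" using C(1) a act v0 by auto
      then show ?thesis using rcos_eq_iff[OF U(1)] a v0 c by auto
    qed
    then show ?thesis using v0 by auto
  qed
  have K: "subgroup ?K G"
  proof (rule subgroupI)
    show "?K \<subseteq> carrier G" using c by auto
    show "?K \<noteq> {}" using v0K by blast
    show "inv x \<in> ?K" if "x \<in> ?K" for x
    proof -
      have x: "x \<in> V" and xa: "\<And>a. a \<in> A \<Longrightarrow> conjg G a x \<otimes> inv x \<in> U" using that by auto
      have "conjg G a (inv x) \<otimes> inv (inv x) \<in> U" if a: "a \<in> A" for a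
      proof -
        have "conjg G a (inv x) \<otimes> inv (inv x) = inv (conjg G a x) \<otimes> x"
          using a x c by (simp add: conjg_of_inv)
        also have "\<dots> = x \<otimes> inv (conjg G a x)"
          using comm x AV[OF a x] V subgroup.m_inv_closed by metis
        also have "\<dots> = inv (conjg G a x \<otimes> inv x)" using a x c by (simp add: inv_mult_group)
        finally show ?thesis using xa[OF a] subgroup.m_inv_closed[OF U(1)] by simp
      qed
      then show ?thesis using x V by (auto simp: subgroup.m_inv_closed)
    qed
    show "x \<otimes> y \<in> ?K" if "x \<in> ?K" "y \<in> ?K" for x y
    proof -
      have x: "x \<in> V" "y \<in> V" and xa: "\<And>a. a \<in> A \<Longrightarrow> conjg G a x \<otimes> inv x \<in> U"
        "\<And>a. a \<in> A \<Longrightarrow> conjg G a y \<otimes> inv y \<in> U" using that by auto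
      have "conjg G a (x \<otimes> y) \<otimes> inv (x \<otimes> y) \<in> U" if a: "a \<in> A" for a
      proof -
        have cc: "x \<in> carrier G" "y \<in> carrier G" "conjg G a x \<in> carrier G" "conjg G a y \<in> carrier G" "a \<in> carrier G"
          using x a c by auto
        have "conjg G a (x \<otimes> y) \<otimes> inv (x \<otimes> y) = conjg G a x \<otimes> ((conjg G a y \<otimes> inv y) \<otimes> inv x)"
          using cc by (simp add: conjg_of_mult inv_mult_group m_assoc)
        also have "(conjg G a y \<otimes> inv y) \<otimes> inv x = inv x \<otimes> (conjg G a y \<otimes> inv y)"
          by (rule comm) (use xa(2)[OF a] U(2) V x(1) in \<open>auto simp: subgroup.m_inv_closed\<close>)
        also have "conjg G a x \<otimes> (inv x \<otimes> (conjg G a y \<otimes> inv y)) = (conjg G a x \<otimes> inv x) \<otimes> (conjg G a y \<otimes> inv y)"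
          using cc by (simp add: m_assoc)
        finally show ?thesis using xa[OF a] subgroup.m_closed[OF U(1)] by simp
      qed
      then show ?thesis using x V by (auto simp: subgroup.m_closed)
    qed
  qed
  have "?K = V"
  proof (rule prime_index_subgroup[OF fin U(1) K V _ _ idx p(1)])
    show "U \<subseteq> ?K"
      using U AU by (auto simp: subgroup.m_closed subgroup.m_inv_closed)
    have "v0 \<notin> U"
    proof
      assume "v0 \<in> U"
      then have "U #> v0 = U #> \<one>" using rcos_eq_iff[OF U(1), of v0 \<one>] c by auto
      then show False using C(2) v0(2) Uc by simp
    qed
    then show "?K \<noteq> U" using v0K by blast
  qed auto
  then show ?thesis using aA vV by blast
qed

text \<open>One exponent i serves all of N because N consists of powers of c; so any two
  conjugations commute on N.\<close>

lemma conjg_power_gen: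
  assumes "N \<lhd> G" "c \<in> N" "N = range (\<lambda>k::nat. c [^] k)" "g \<in> carrier G"
  shows "\<exists>i::nat. \<forall>n\<in>N. conjg G g n = n [^] i"
proof -
  have cc: "c \<in> carrier G" using assms(1,2) normal_imp_subgroup subgroup.mem_carrier by metis
  have "conjg G g c \<in> N" using assms(1,2,4) by (simp add: normal_iff_conjg)
  then obtain i :: nat where i: "conjg G g c = c [^] i" using assms(3) by auto
  have "conjg G g n = n [^] i" if n: "n \<in> N" for n
  proof -
    obtain k :: nat where k: "n = c [^] k" using n assms(3) by auto
    show ?thesis using cc assms(4) by (simp add: k conjg_of_pow i nat_pow_pow mult.commute)
  qed
  then show ?thesis by blast
qed

text \<open>The automorphism group of a cyclic group is abelian.\<close>

lemma cyclic_centralizer_commutator: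
  assumes N: "N \<lhd> G" "c \<in> N" "N = range (\<lambda>k::nat. c [^] k)" and g: "g \<in> carrier G" "h \<in> carrier G"
  shows "conjg G g h \<otimes> inv h \<in> set_centralizer G N"
proof -
  have Nc: "n \<in> carrier G" if "n \<in> N" for n using that N(1) normal_imp_subgroup subgroup.mem_carrier by metis
  obtain i j :: nat where ij: "\<And>n. n \<in> N \<Longrightarrow> conjg G g n = n [^] i" "\<And>n. n \<in> N \<Longrightarrow> conjg G h n = n [^] j"
    using conjg_power_gen[OF N] g by metis
  have cl: "conjg G x n \<in> N" if "x \<in> carrier G" "n \<in> N" for x n using that N(1) by (simp add: normal_iff_conjg)
  have comm: "conjg G g (conjg G h n) = conjg G h (conjg G g n)" if n: "n \<in> N" for n
  proof -
    have "conjg G g (conjg G h n) = (n [^] j) [^] i" using ij n cl g by metis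
    also have "\<dots> = (n [^] i) [^] j" using Nc[OF n] by (simp add: nat_pow_pow mult.commute)
    also have "\<dots> = conjg G h (conjg G g n)" using ij n cl g by metis
    finally show ?thesis .
  qed
  have "conjg G (conjg G g h \<otimes> inv h) n = n" if n: "n \<in> N" for n
  proof -
    \<comment> \<open>The commutator g h g^-1 h^-1 acts on n by first undoing h and then g; naming
      the point so reached lets the commuting power maps be applied to it.\<close>
    let ?n = "conjg G (inv g) (conjg G (inv h) n)"
    have n': "?n \<in> N" using cl g n by simp
    have "conjg G (conjg G g h \<otimes> inv h) n = conjg G g (conjg G h ?n)"
      unfolding conjg_def[of G g h] using g Nc[OF n] by (simp add: conjg_mult)
    also have "\<dots> = n" using comm[OF n'] g Nc[OF n] by simp
    finally show ?thesis .
  qed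
  then show ?thesis using g Nc by (auto simp: set_centralizer_def conjg_eq_iff[symmetric])
qed

text \<open>The hypotheses say that the quotient of the group by N is a Frobenius group with complement
  R; the elements outside the conjugates of the complement are counted with a
  transversal that is a subgroup.\<close>

lemma frobenius_kernel_unique:
  assumes fin: "finite (carrier G)" and R: "subgroup R G" and N: "N \<lhd> G" "N \<subseteq> R"
    and frob: "\<And>g x. g \<in> carrier G \<Longrightarrow> g \<notin> R \<Longrightarrow> x \<in> R \<Longrightarrow> conjg G g x \<in> R \<Longrightarrow> x \<in> N"
    and Y: "subgroup Y G" "Y \<inter> R = {\<one>}" "Y <#> R = carrier G"
  shows "\<exists>Z. (\<forall>g\<in>carrier G. \<forall>z\<in>Z. conjg G g z \<in> Z) \<and>
    (\<forall>D. subgroup D G \<longrightarrow> D \<inter> R = N \<longrightarrow> D <#> R = carrier G \<longrightarrow> D = Z)"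
proof -
  \<comment> \<open>The union of the conjugates of R - N. Conjugators from Y suffice because G = YR
    and R normalises R - N.\<close>
  define U where "U = (\<lambda>(y, x). conjg G y x) ` (Y \<times> (R - N))"
  have c: "x \<in> R \<Longrightarrow> x \<in> carrier G" "x \<in> Y \<Longrightarrow> x \<in> carrier G" for x
    using R Y(1) by (blast intro: subgroup.mem_carrier)+
  have Nsub: "subgroup N G" using N(1) normal_imp_subgroup by blast
  have NG: "conjg G g n \<in> N" if "g \<in> carrier G" "n \<in> N" for g n
    using that N(1) by (simp add: normal_iff_conjg)
  have NG': "conjg G g n \<in> N \<longleftrightarrow> n \<in> N" if "g \<in> carrier G" "n \<in> carrier G" for g n
    using that NG[of g n] NG[of "inv g" "conjg G g n"] by auto
  have fins: "finite R" "finite Y" "finite N" using c N(2) fin by (auto intro: finite_subset)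
  have Uc: "U \<subseteq> carrier G" using c by (auto simp: U_def)
  have cU: "card U = card Y * (card R - card N)"
  proof -
    \<comment> \<open>If two of these conjugates coincide, y'^-1 y takes an element of R - N into R,
      so \<open>frob\<close> puts it into Y \<inter> R = 1. Hence U has exactly |Y| (|R| - |N|)
      elements.\<close>
    have "inj_on (\<lambda>(y, x). conjg G y x) (Y \<times> (R - N))"
    proof (rule inj_onI, clarify)
      fix y x y' x' assume a: "y \<in> Y" "x \<in> R" "x \<notin> N" "y' \<in> Y" "x' \<in> R" "x' \<notin> N"
        "conjg G y x = conjg G y' x'"
      have e: "conjg G (inv y' \<otimes> y) x = x'" using a c by (simp add: conjg_mult)
      have w: "inv y' \<otimes> y \<in> Y" using a Y(1) by (simp add: subgroup.m_closed subgroup.m_inv_closed)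
      have "inv y' \<otimes> y \<in> R" using frob[of "inv y' \<otimes> y" x] a c e by auto
      then have "inv y' \<otimes> y = \<one>" using w Y(2) by blast
      then show "y = y' \<and> x = x'" using e a c inv_equality[of "inv y'" y] by auto
    qed
    then have "card U = card (Y \<times> (R - N))" unfolding U_def by (rule card_image)
    then show ?thesis using N(2) fins by (simp add: card_cartesian_product card_Diff_subset)
  qed
  have cG: "card (carrier G) = card Y * card R" using card_set_mult[OF fin Y(1) R] Y(2,3) by simp
  have Uinv: "conjg G g u \<in> U" if g: "g \<in> carrier G" and u: "u \<in> U" for g u
  proof -
    obtain y x where yx: "y \<in> Y" "x \<in> R" "x \<notin> N" "u = conjg G y x" using u by (auto simp: U_def)
    have "g \<otimes> y \<in> Y <#> R" using g yx(1) c Y(3) by simp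
    then obtain y' r where y': "y' \<in> Y" "r \<in> R" "g \<otimes> y = y' \<otimes> r" by (auto simp: set_mult_def)
    have "conjg G g u = conjg G (g \<otimes> y) x" using g yx c by (simp add: conjg_mult)
    also have "\<dots> = conjg G y' (conjg G r x)" using y' yx c by (simp add: conjg_mult)
    finally have "conjg G g u = conjg G y' (conjg G r x)" .
    moreover have "conjg G r x \<in> R"
      using R y'(2) yx(2) by (simp add: conjg_def subgroup.m_closed subgroup.m_inv_closed)
    moreover have "conjg G r x \<notin> N" using NG' y'(2) yx c by simp
    ultimately show ?thesis using y'(1) by (auto simp: U_def)
  qed
  have Zinv: "conjg G g z \<in> carrier G - U" if g: "g \<in> carrier G" and z: "z \<in> carrier G - U" for g z
    using g z Uinv[of "inv g" "conjg G g z"] by auto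
  \<comment> \<open>D avoids U because D \<inter> R = N, and |D| |R| = |G| |N| gives D exactly the
    size of the complement of U.\<close>
  have "D = carrier G - U" if D: "subgroup D G" "D \<inter> R = N" "D <#> R = carrier G" for D
  proof (rule card_subset_eq)
    have Dc: "D \<subseteq> carrier G" using D(1) subgroup.subset by blast
    have "u \<notin> D" if u: "u \<in> U" for u
    proof
      assume uD: "u \<in> D"
      obtain y x where yx: "y \<in> Y" "x \<in> R" "x \<notin> N" "u = conjg G y x" using u by (auto simp: U_def)
      have "y \<in> D <#> R" using yx(1) c D(3) by simp
      then obtain d r where d: "d \<in> D" "r \<in> R" "y = d \<otimes> r" by (auto simp: set_mult_def)
      have dc: "d \<in> carrier G" using d Dc by auto
      have "conjg G r x = conjg G (inv d) u" using d dc yx c by (simp add: conjg_mult)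
      also have "\<dots> \<in> D" using d uD D(1) by (simp add: conjg_def subgroup.m_closed subgroup.m_inv_closed)
      finally have "conjg G r x \<in> D \<inter> R"
        using R d(2) yx(2) by (simp add: conjg_def subgroup.m_closed subgroup.m_inv_closed)
      then show False using D(2) NG' d(2) yx c by simp
    qed
    then show "D \<subseteq> carrier G - U" using Dc by blast
    have e: "card D * card R = card (carrier G) * card N"
      using card_set_mult[OF fin D(1) R] D(2,3) by simp
    have Rpos: "card R > 0" using R fin subgroup.finite_imp_card_positive by blast
    have "card D * card R = card Y * card N * card R" using e cG by (simp add: mult.assoc mult.commute)
    then have "card D = card Y * card N" using Rpos by simp
    moreover have "card (carrier G - U) = card Y * card R - card Y * (card R - card N)"
      using Uc fin cG cU by (simp add: card_Diff_subset finite_subset)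
    moreover have "card N \<le> card R" using N(2) fins card_mono by blast
    ultimately show "card D = card (carrier G - U)" by (simp add: diff_mult_distrib2)
  qed (use fin in auto)
  then show ?thesis using Zinv by (intro exI[of _ "carrier G - U"]) auto
qed

end

subsection \<open>Core-free maximal subgroups\<close>

locale maximal_subgroup_of = group +
  fixes R
  assumes fin: "finite (carrier G)" and maximal: "maximal_subgroup R G"
begin

lemma R_sub: "subgroup R G" and R_ne: "R \<noteq> carrier G"
  using maximal by (auto simp: maximal_subgroup_def)

lemma R_carrier: "x \<in> R \<Longrightarrow> x \<in> carrier G"
  using R_sub by (rule subgroup.mem_carrier)

lemma conjg_R: "x \<in> R \<Longrightarrow> y \<in> R \<Longrightarrow> conjg G x y \<in> R"
  using R_sub by (simp add: conjg_def subgroup.m_closed subgroup.m_inv_closed)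

lemma over_R: "subgroup K G \<Longrightarrow> R \<subseteq> K \<Longrightarrow> K = R \<or> K = carrier G"
  using maximal by (auto simp: maximal_subgroup_def)

text \<open>R normalises K, so KR is a subgroup above R; it exceeds R, and maximality makes it
  everything.\<close>

lemma set_mult_R:
  assumes K: "subgroup K G" "\<And>x k. x \<in> R \<Longrightarrow> k \<in> K \<Longrightarrow> conjg G x k \<in> K" "\<not> K \<subseteq> R"
  shows "K <#> R = carrier G"
proof -
  have kc: "k \<in> K \<Longrightarrow> k \<in> carrier G" for k using K(1) by (rule subgroup.mem_carrier)
  have "subgroup (K <#> R) G" by (rule set_mult_subgroup[OF R_sub K(1)]) (use K(2) in auto)
  moreover have "R \<subseteq> K <#> R"
    using subgroup.one_closed[OF K(1)] R_carrier by (force simp: set_mult_def)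
  moreover have "K \<subseteq> K <#> R"
    using subgroup.one_closed[OF R_sub] kc by (force simp: set_mult_def)
  ultimately show ?thesis using over_R K(3) by blast
qed

lemma normal_set_mult_R: "K \<lhd> G \<Longrightarrow> \<not> K \<subseteq> R \<Longrightarrow> K <#> R = carrier G"
  by (rule set_mult_R) (auto simp: normal_iff_conjg R_carrier)

lemma normalizer_eq_R:
  assumes K: "subgroup K G" "\<And>x k. x \<in> R \<Longrightarrow> k \<in> K \<Longrightarrow> conjg G x k \<in> K" "\<not> K \<lhd> G"
  shows "set_normalizer G K = R"
proof -
  have Kc: "K \<subseteq> carrier G" using K(1) subgroup.subset by blast
  have fK: "finite K" using Kc fin finite_subset by blast
  have sub: "subgroup (set_normalizer G K) G" by (rule set_normalizer_subgroup[OF Kc])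
  have "R \<subseteq> set_normalizer G K"
    using set_normalizerI[OF fK Kc] R_carrier K(2) by blast
  moreover have "set_normalizer G K \<noteq> carrier G"
  proof
    assume "set_normalizer G K = carrier G"
    then have "\<And>g k. g \<in> carrier G \<Longrightarrow> k \<in> K \<Longrightarrow> conjg G g k \<in> K" by (auto simp: set_normalizer_def)
    then show False using K(1,3) by (simp add: normal_iff_conjg)
  qed
  ultimately show ?thesis using over_R[OF sub] by blast
qed

text \<open>Dedekind's law: KR = G, and an element m = k x of M has x in M \<inter> R = 1. So a
  complement of R has no proper nontrivial R-invariant subgroup.\<close>

lemma eq_if_inside_complement:
  assumes M: "subgroup M G" "M \<inter> R = {\<one>}" and K: "subgroup K G" "K \<subseteq> M" "K \<noteq> {\<one>}"
    "\<And>x k. x \<in> R \<Longrightarrow> k \<in> K \<Longrightarrow> conjg G x k \<in> K"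
  shows "K = M"
proof
  show "M \<subseteq> K"
  proof
    fix m assume m: "m \<in> M"
    have "\<not> K \<subseteq> R" using K M(2) subgroup.one_closed[OF K(1)] by blast
    then have "m \<in> K <#> R" using set_mult_R[OF K(1,4)] m subgroup.mem_carrier[OF M(1)] by simp
    then obtain k x where kx: "k \<in> K" "x \<in> R" "m = k \<otimes> x" by (auto simp: set_mult_def)
    have kM: "k \<in> M" using kx K by auto
    have kc: "k \<in> carrier G" "x \<in> carrier G" using kx R_carrier kM subgroup.mem_carrier[OF M(1)] by auto
    have "x = inv k \<otimes> m" using kx kc by simp
    then have "x \<in> M" using kM m M(1) by (simp add: subgroup.m_closed subgroup.m_inv_closed)
    then have "x = \<one>" using kx M(2) by blast
    then show "m \<in> K" using kx kc by simp
  qed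
qed (rule K(2))

end

locale corefree_maximal_subgroup = maximal_subgroup_of +
  assumes corefree: "K \<lhd> G \<Longrightarrow> K \<subseteq> R \<Longrightarrow> K = {\<one>}"

text \<open>In this setting A turns out to be a Sylow s-subgroup of G with normaliser R: s divides
  |R| only once, and A cannot be normal in G.\<close>

locale corefree_with_prime = corefree_maximal_subgroup +
  fixes A s
  assumes A_sub: "subgroup A G" and A_R: "A \<subseteq> R" and A_inv: "\<And>x a. x \<in> R \<Longrightarrow> a \<in> A \<Longrightarrow> conjg G x a \<in> A"
    and A_card: "card A = s" and s_prime: "Factorial_Ring.prime s" and s_R: "\<not> s * s dvd card R"
begin

lemma A_nontriv: "A \<noteq> {\<one>}"
  using A_card s_prime by auto

lemma fin_sub: "subgroup K G \<Longrightarrow> finite K"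
  using fin finite_subset subgroup.subset by metis

lemma A_carrier: "a \<in> A \<Longrightarrow> a \<in> carrier G"
  using A_sub by (rule subgroup.mem_carrier)

lemma A_not_normal: "\<not> A \<lhd> G"
  using corefree A_R A_nontriv by blast

lemma A_normalizer: "set_normalizer G A = R"
  by (rule normalizer_eq_R[OF A_sub A_inv A_not_normal])

text \<open>If s^2 divided |G|, it would divide the order of the normaliser of A, which is
  R.\<close>

lemma s_sq: "\<not> s * s dvd card (carrier G)"
  using prime_subgroup_normalizer_grows[OF fin A_sub A_card s_prime] s_R unfolding A_normalizer by blast

lemma s_index:
  assumes J: "subgroup J G" "A \<subseteq> J"
  shows "\<exists>k. card J = card A * k \<and> \<not> s dvd k"
proof -
  obtain k where k: "card J = card A * k" using card_subgroup_dvd[OF A_sub J] by (rule dvdE)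
  have "\<not> s dvd k"
  proof
    assume "s dvd k"
    then have "s * s dvd card J" using k A_card by simp
    then show False using s_sq card_subgroup_dvd[OF J(1) subgroup_self] subgroup.subset[OF J(1)] dvd_trans by blast
  qed
  then show ?thesis using k by blast
qed

text \<open>A has index prime to s in J, so Sylow conjugacy applies with A as the Sylow
  subgroup.\<close>

lemma conj_onto_A:
  assumes J: "subgroup J G" "A \<subseteq> J" and P: "subgroup P G" "P \<subseteq> J" "card P = s"
  shows "\<exists>g\<in>J. conjg G g ` P = A"
proof -
  obtain k where "card J = card A * k" "\<not> s dvd k" using s_index[OF J] by blast
  then obtain g where g: "g \<in> J" "conjg G g ` P \<subseteq> A"
    using p_subgroup_conj_into[OF fin J(1) P(1,2), of s 1 A k] P(3) s_prime A_sub J(2) by auto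
  have "g \<in> carrier G" "P \<subseteq> carrier G" using g J P subgroup.subset by blast+
  then have "card (conjg G g ` P) = s" using conjg_inj_on P(3) card_image by metis
  then have "conjg G g ` P = A" using card_subset_eq[OF fin_sub[OF A_sub] g(2)] A_card by simp
  then show ?thesis using g(1) by blast
qed

text \<open>A normal subgroup of M of order divisible by s contains all Sylow s-subgroups of M, hence all conjugates
  of A, hence M. The normal subgroups of M of order prime to s lie in the largest one, which is normal in G
  and therefore trivial. The centraliser of M normalises A, so it lies in R.\<close>

lemma almost_simple_if_prime_dvd:
  assumes M: "M \<lhd> G" "M \<noteq> {\<one>}" and min: "\<And>K. K \<lhd> G \<Longrightarrow> K \<subseteq> M \<Longrightarrow> K = {\<one>} \<or> K = M" and d: "s dvd card M"
  shows "almost_simple G"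
proof -
  have Ms: "subgroup M G" using M(1) normal_imp_subgroup by blast
  have Mc: "m \<in> M \<Longrightarrow> m \<in> carrier G" for m using Ms by (rule subgroup.mem_carrier)
  have MG: "g \<in> carrier G \<Longrightarrow> m \<in> M \<Longrightarrow> conjg G g m \<in> M" for g m using M(1) by (simp add: normal_iff_conjg)
  have AM: "A \<subseteq> M"
  proof -
    obtain P where P: "subgroup P G" "P \<subseteq> M" "card P = s"
      using prime_subgroup_exists[OF fin Ms s_prime d] by blast
    obtain g where "g \<in> carrier G" "conjg G g ` P = A"
      using conj_onto_A[OF subgroup_self _ P(1) _ P(3)] subgroup.subset[OF A_sub] subgroup.subset[OF P(1)] by blast
    then show ?thesis using MG P(2) by blast
  qed
  have A_in: "A \<subseteq> T"
    if T: "subgroup T G" "T \<subseteq> M" "\<And>m t. m \<in> M \<Longrightarrow> t \<in> T \<Longrightarrow> conjg G m t \<in> T" "s dvd card T" for T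
  proof -
    obtain P where P: "subgroup P G" "P \<subseteq> T" "card P = s"
      using prime_subgroup_exists[OF fin T(1) s_prime T(4)] by blast
    obtain g where "g \<in> M" "conjg G g ` P = A"
      using conj_onto_A[OF Ms AM P(1) _ P(3)] P(2) T(2) by blast
    then show ?thesis using T(3) P(2) by blast
  qed
  have conj_T: "subgroup (conjg G g ` T) G \<and> conjg G g ` T \<subseteq> M \<and>
      (\<forall>m\<in>M. \<forall>t\<in>conjg G g ` T. conjg G m t \<in> conjg G g ` T) \<and> card (conjg G g ` T) = card T"
    if T: "subgroup T G" "T \<subseteq> M" "\<And>m t. m \<in> M \<Longrightarrow> t \<in> T \<Longrightarrow> conjg G m t \<in> T" and g: "g \<in> carrier G" for T g
  proof -
    have Tc: "T \<subseteq> carrier G" using T(1) subgroup.subset by blast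
    have "conjg G m (conjg G g t) \<in> conjg G g ` T" if m: "m \<in> M" and t: "t \<in> T" for m t
    proof -
      have tc: "t \<in> carrier G" using t Tc by blast
      have "conjg G m (conjg G g t) = conjg G g (conjg G (conjg G (inv g) m) t)"
        using Mc[OF m] g tc by (simp add: conjg_def m_assoc inv_mult_group)
      moreover have "conjg G (conjg G (inv g) m) t \<in> T" using T(3) MG g m t by simp
      ultimately show ?thesis by auto
    qed
    moreover have "card (conjg G g ` T) = card T" using card_image[OF conjg_inj_on[OF g Tc]] .
    moreover have "conjg G g ` T \<subseteq> M" using T(2) MG g by auto
    ultimately show ?thesis using subgroup_conjg[OF T(1) g] by blast
  qed
  have full: "T = M"
    if T: "subgroup T G" "T \<subseteq> M" "\<And>m t. m \<in> M \<Longrightarrow> t \<in> T \<Longrightarrow> conjg G m t \<in> T" "s dvd card T" for T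
  proof -
    \<comment> \<open>The core of T in G. It contains A because A lies in every conjugate of T, so
      minimality of M gives D = M.\<close>
    define D where "D = {x \<in> T. \<forall>g\<in>carrier G. conjg G g x \<in> T}"
    have Tc: "t \<in> T \<Longrightarrow> t \<in> carrier G" for t using T(1) by (rule subgroup.mem_carrier)
    have "subgroup D G"
    proof (rule subgroupI)
      show "D \<noteq> {}" using subgroup.one_closed[OF T(1)] by (auto simp: D_def)
    qed (use T(1) Tc in \<open>auto simp: D_def subgroup.m_inv_closed subgroup.m_closed conjg_of_inv conjg_of_mult\<close>)
    then have "D \<lhd> G" using Tc by (auto simp: normal_iff_conjg D_def conjg_mult[symmetric])
    moreover have "D \<subseteq> M" using T(2) by (auto simp: D_def)
    moreover have "A \<subseteq> D"
    proof
      fix a assume a: "a \<in> A"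
      have "conjg G g a \<in> T" if g: "g \<in> carrier G" for g
      proof -
        have "A \<subseteq> conjg G (inv g) ` T"
          using A_in[of "conjg G (inv g) ` T"] conj_T[OF T(1-3), of "inv g"] g T(4) by simp
        then show ?thesis using a g Tc by auto
      qed
      then show "a \<in> D" using a A_in[OF T] by (auto simp: D_def)
    qed
    ultimately have "D = M" using min A_nontriv subgroup.one_closed[OF A_sub] by blast
    then show ?thesis using T(2) by (auto simp: D_def)
  qed
  have triv: "T = {\<one>}"
    if T: "subgroup T G" "T \<subseteq> M" "\<And>m t. m \<in> M \<Longrightarrow> t \<in> T \<Longrightarrow> conjg G m t \<in> T" "\<not> s dvd card T" for T
  proof -
    \<comment> \<open>The subgroups of order prime to s that are normal in M. A member L of maximal
      order absorbs all others, since the product of two members is again one; its conjugates in G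
      are members, so L is normal in G.\<close>
    define \<T> where "\<T> = {T. subgroup T G \<and> T \<subseteq> M \<and> (\<forall>m\<in>M. \<forall>t\<in>T. conjg G m t \<in> T) \<and> \<not> s dvd card T}"
    have fT: "finite \<T>" by (rule finite_subset[of _ "Pow M"]) (use fin_sub[OF Ms] in \<open>auto simp: \<T>_def\<close>)
    have TT: "T \<in> \<T>" using T by (auto simp: \<T>_def)
    have "Max (card ` \<T>) \<in> card ` \<T>" using fT TT by (intro Max_in) auto
    then obtain L where L1: "Max (card ` \<T>) = card L" "L \<in> \<T>" by (rule imageE)
    have L: "L \<in> \<T>" "\<And>K. K \<in> \<T> \<Longrightarrow> card K \<le> card L"
      using L1(2) Max_ge[of "card ` \<T>"] fT unfolding L1(1) by auto
    have Ls: "subgroup L G" "L \<subseteq> M" "\<And>m t. m \<in> M \<Longrightarrow> t \<in> L \<Longrightarrow> conjg G m t \<in> L" "\<not> s dvd card L"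
      using L(1) by (auto simp: \<T>_def)
    have into: "K \<subseteq> L" if K: "K \<in> \<T>" for K
    proof -
      have Ks: "subgroup K G" "K \<subseteq> M" "\<And>m t. m \<in> M \<Longrightarrow> t \<in> K \<Longrightarrow> conjg G m t \<in> K" "\<not> s dvd card K"
        using K by (auto simp: \<T>_def)
      have LK: "subgroup (L <#> K) G"
        by (rule set_mult_subgroup[OF Ks(1) Ls(1)]) (use Ks(2) Ls(3) in auto)
      have sub: "L \<subseteq> L <#> K" "K \<subseteq> L <#> K"
        using subgroup.one_closed[OF Ks(1)] subgroup.one_closed[OF Ls(1)] Ls(2) Ks(2) Mc
        by (force simp: set_mult_def)+
      have "L <#> K \<in> \<T>"
      proof -
        have "L <#> K \<subseteq> M" using Ls(2) Ks(2) subgroup.m_closed[OF Ms] by (auto simp: set_mult_def)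
        moreover have "conjg G m t \<in> L <#> K" if m: "m \<in> M" and t: "t \<in> L <#> K" for m t
        proof -
          obtain l k where lk: "l \<in> L" "k \<in> K" "t = l \<otimes> k" using t by (auto simp: set_mult_def)
          have "l \<in> carrier G" "k \<in> carrier G" using lk Ls(2) Ks(2) Mc by auto
          then have "conjg G m t = conjg G m l \<otimes> conjg G m k" using Mc[OF m] by (simp add: lk(3) conjg_of_mult)
          then show ?thesis using Ls(3)[OF m lk(1)] Ks(3)[OF m lk(2)] by (auto simp: set_mult_def)
        qed
        moreover have "\<not> s dvd card (L <#> K)"
        proof
          assume "s dvd card (L <#> K)"
          then have "s dvd card L * card K" using card_set_mult[OF fin Ls(1) Ks(1)] dvd_mult2 by metis
          then show False using s_prime Ls(4) Ks(4) prime_dvd_mult_iff by blast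
        qed
        ultimately show ?thesis using LK by (auto simp: \<T>_def)
      qed
      then have "card (L <#> K) \<le> card L" by (rule L(2))
      then have "L = L <#> K" using card_seteq[OF fin_sub[OF LK] sub(1)] by simp
      then show ?thesis using sub(2) by simp
    qed
    have "L \<lhd> G"
    proof -
      have "conjg G g ` L \<subseteq> L" if g: "g \<in> carrier G" for g
        by (rule into) (use conj_T[OF Ls(1-3) g] Ls(4) in \<open>auto simp: \<T>_def\<close>)
      then show ?thesis using Ls(1) by (auto simp: normal_iff_conjg)
    qed
    then have "L = {\<one>}" using min[OF _ Ls(2)] d Ls(4) by blast
    then show ?thesis using into[OF TT] subgroup.one_closed[OF T(1)] by blast
  qed
  have simple: "simple_group (G\<lparr>carrier := M\<rparr>)"
  proof -
    interpret M: group "G\<lparr>carrier := M\<rparr>" using Ms subgroup_imp_group by blast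
    show ?thesis
    proof
      have "card M \<noteq> 1" using M(2) subgroup.one_closed[OF Ms] by (auto simp: card_1_singleton_iff)
      moreover have "card M > 0" using Ms fin subgroup.finite_imp_card_positive by blast
      ultimately show "order (G\<lparr>carrier := M\<rparr>) > 1" by (simp add: order_def)
      fix H assume H: "H \<lhd> G\<lparr>carrier := M\<rparr>"
      have Hs: "subgroup H G" "H \<subseteq> M"
        using incl_subgroup[OF Ms normal_imp_subgroup[OF H]] subgroup.subset[OF normal_imp_subgroup[OF H]] by auto
      have "conjg G m h \<in> H" if "m \<in> M" "h \<in> H" for m h
        using H that Ms unfolding M.normal_iff_conjg by (simp add: conjg_def)
      then show "H = carrier (G\<lparr>carrier := M\<rparr>) \<or> H = {\<one>\<^bsub>G\<lparr>carrier := M\<rparr>\<^esub>}"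
        using full[OF Hs] triv[OF Hs] by auto
    qed
  qed
  \<comment> \<open>An abelian M would centralise A, which lies in M, so that G = MR would normalise
    A.\<close>
  have nonabelian: "\<not> comm_group (G\<lparr>carrier := M\<rparr>)"
  proof
    assume "comm_group (G\<lparr>carrier := M\<rparr>)"
    then interpret M: comm_group "G\<lparr>carrier := M\<rparr>" .
    have "A \<lhd> G"
      unfolding normal_iff_conjg
    proof (intro conjI ballI A_sub)
      fix g a assume g: "g \<in> carrier G" and a: "a \<in> A"
      have "g \<in> M <#> R" using normal_set_mult_R[OF M(1)] corefree[OF M(1)] M(2) g by blast
      then obtain m x where mx: "m \<in> M" "x \<in> R" "g = m \<otimes> x" by (auto simp: set_mult_def)
      have xa: "conjg G x a \<in> A" using A_inv mx a by blast
      have "m \<otimes> conjg G x a = conjg G x a \<otimes> m" using M.m_comm[of m "conjg G x a"] mx xa AM by auto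
      then have "conjg G m (conjg G x a) = conjg G x a" using mx xa A_carrier Mc by (simp add: conjg_eq_iff)
      then show "conjg G g a \<in> A" using mx xa Mc R_carrier A_carrier[OF a] by (simp add: conjg_mult)
    qed
    then show False using A_not_normal by blast
  qed
  have "set_centralizer G M \<subseteq> R"
  proof
    fix x assume x: "x \<in> set_centralizer G M"
    then have "x \<in> carrier G" "\<And>a. a \<in> A \<Longrightarrow> conjg G x a = a"
      using AM A_carrier by (auto simp: set_centralizer_def conjg_eq_iff)
    then have "x \<in> set_normalizer G A" by (auto simp: set_normalizer_def image_iff)
    then show "x \<in> R" by (simp add: A_normalizer)
  qed
  then have "set_centralizer G M = {\<one>}" using corefree set_centralizer_normal[OF M(1)] by blast
  then show ?thesis
    unfolding almost_simple_def
    using M(1) simple nonabelian group_axioms by (intro conjI exI[of _ M]) (auto simp: set_centralizer_def)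
qed

text \<open>By the Frattini argument A normalises some Sylow p-subgroup P of M, and only one, because the
  normaliser R of A meets M trivially. As R normalises A, it normalises P, so PR = G and P = M.\<close>

lemma abelian_p_group_if_not_prime_dvd:
  assumes M: "M \<lhd> G" "M \<noteq> {\<one>}" "M \<inter> R = {\<one>}" and nd: "\<not> s dvd card M"
  shows "(\<exists>p n. Factorial_Ring.prime p \<and> n > 0 \<and> card M = p ^ n) \<and> (\<forall>v\<in>M. \<forall>w\<in>M. v \<otimes> w = w \<otimes> v)"
proof -
  have Ms: "subgroup M G" using M(1) normal_imp_subgroup by blast
  have Mc: "m \<in> M \<Longrightarrow> m \<in> carrier G" for m using Ms by (rule subgroup.mem_carrier)
  have MG: "g \<in> carrier G \<Longrightarrow> m \<in> M \<Longrightarrow> conjg G g m \<in> M" for g m using M(1) by (simp add: normal_iff_conjg)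
  have "card M \<noteq> 1" using M(2) subgroup.one_closed[OF Ms] by (auto simp: card_1_singleton_iff)
  then obtain p where p: "Factorial_Ring.prime p" "p dvd card M" by (metis prime_factor_nat)
  obtain P0 n k where P0: "subgroup P0 G" "P0 \<subseteq> M" "card P0 = p ^ n" "card M = card P0 * k" "\<not> p dvd k"
    using sylow_subgroup_exists[OF fin Ms p(1)] by blast
  have n: "n > 0" using P0(3-5) p(2) by (cases n) auto
  have sylow: "\<exists>m\<in>M. m \<otimes> g \<in> set_normalizer G P"
    if P: "subgroup P G" "P \<subseteq> M" "card P = p ^ n" and g: "g \<in> carrier G" for P g
  proof -
    have Pc: "P \<subseteq> carrier G" using P(1) subgroup.subset by blast
    have cg: "subgroup (conjg G g ` P) G" "conjg G g ` P \<subseteq> M" "card (conjg G g ` P) = p ^ n"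
      using subgroup_conjg[OF P(1) g] MG[OF g] P(2) card_image[OF conjg_inj_on[OF g Pc]] P(3) by auto
    obtain m where m: "m \<in> M" "conjg G m ` conjg G g ` P \<subseteq> P"
      using p_subgroup_conj_into[OF fin Ms cg p(1) P(1,2) _ P0(5)] P0(3,4) P(3) by auto
    have "m \<otimes> g \<in> set_normalizer G P"
      by (rule set_normalizerI[OF fin_sub[OF P(1)] Pc]) (use m g Mc Pc in \<open>auto simp: conjg_mult subset_eq\<close>)
    then show ?thesis using m(1) by blast
  qed
  \<comment> \<open>Frattini: G = M N(P0), so the index of N(P0) in G is an index in M and therefore
    prime to s. Hence some conjugate of A normalises P0, and undoing that conjugation moves P0 to
    the required P.\<close>
  obtain P where P: "subgroup P G" "P \<subseteq> M" "card P = p ^ n" and AP: "A \<subseteq> set_normalizer G P"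
  proof -
    let ?L = "set_normalizer G P0"
    have P0c: "P0 \<subseteq> carrier G" using P0(1) subgroup.subset by blast
    have L: "subgroup ?L G" by (rule set_normalizer_subgroup[OF P0c])
    have Lc: "x \<in> ?L \<Longrightarrow> x \<in> carrier G" for x by (simp add: set_normalizer_def)
    have "M <#> ?L = carrier G"
    proof
      show "M <#> ?L \<subseteq> carrier G" using Mc Lc by (auto simp: set_mult_def)
      show "carrier G \<subseteq> M <#> ?L"
      proof
        fix g assume g: "g \<in> carrier G"
        obtain m where m: "m \<in> M" "m \<otimes> g \<in> ?L" using sylow[OF P0(1-3) g] by blast
        have "g = inv m \<otimes> (m \<otimes> g)" using Mc[OF m(1)] g by simp
        then show "g \<in> M <#> ?L" using m subgroup.m_inv_closed[OF Ms] by (auto simp: set_mult_def)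
      qed
    qed
    then have cG: "card (carrier G) * card (M \<inter> ?L) = card M * card ?L"
      using card_set_mult[OF fin Ms L] by simp
    have MNL: "subgroup (M \<inter> ?L) G" using Ms L subgroups_Inter_pair by blast
    obtain j where j: "card M = card (M \<inter> ?L) * j" using card_subgroup_dvd[OF MNL Ms] by (auto elim: dvdE)
    have "card (M \<inter> ?L) > 0" using MNL fin subgroup.finite_imp_card_positive by blast
    moreover have "card (M \<inter> ?L) * card (carrier G) = card (M \<inter> ?L) * (card ?L * j)"
      using cG j by (simp add: mult.commute mult.left_commute)
    ultimately have "card (carrier G) = card ?L * j" by simp
    moreover have "\<not> s dvd j" using nd j dvd_mult by metis
    ultimately obtain g where g: "g \<in> carrier G" "conjg G g ` A \<subseteq> ?L"
      using p_subgroup_conj_into[OF fin subgroup_self A_sub _ _ s_prime L, of 1 j]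
        A_card subgroup.subset[OF A_sub] subgroup.subset[OF L] by auto
    let ?P = "conjg G (inv g) ` P0"
    have Ps: "subgroup ?P G" using subgroup_conjg[OF P0(1)] g(1) by simp
    have "A \<subseteq> set_normalizer G ?P"
    proof
      fix a assume a: "a \<in> A"
      show "a \<in> set_normalizer G ?P"
      proof (rule set_normalizerI[OF fin_sub[OF Ps] subgroup.subset[OF Ps] A_carrier[OF a]])
        fix x assume "x \<in> ?P"
        then obtain y where y: "y \<in> P0" "x = conjg G (inv g) y" by blast
        have yc: "y \<in> carrier G" using y P0c by blast
        have "conjg G a x = conjg G (inv g) (conjg G (conjg G g a) y)"
          using g(1) yc A_carrier[OF a] by (simp add: y conjg_def m_assoc inv_mult_group)
        moreover have "conjg G (conjg G g a) y \<in> P0" using g(2) a y(1) by (auto simp: set_normalizer_def)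
        ultimately show "conjg G a x \<in> ?P" by blast
      qed
    qed
    moreover have "?P \<subseteq> M" using MG P0(2) g(1) by auto
    moreover have "card ?P = p ^ n" using card_image[OF conjg_inj_on[OF _ P0c]] g(1) P0(3) by simp
    ultimately show ?thesis using that Ps by blast
  qed
  let ?L = "set_normalizer G P"
  have Pc: "P \<subseteq> carrier G" using P(1) subgroup.subset by blast
  have L: "subgroup ?L G" by (rule set_normalizer_subgroup[OF Pc])
  have RL: "x \<in> ?L" if x: "x \<in> R" for x
  proof -
    have xc: "x \<in> carrier G" using R_carrier x by blast
    obtain m where m: "m \<in> M" "m \<otimes> x \<in> ?L" using sylow[OF P xc] by blast
    have mc: "m \<in> carrier G" using Mc m by blast
    have MA: "subgroup (M <#> A) G" by (rule set_mult_subgroup[OF A_sub Ms]) (use MG A_carrier in auto)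
    have AMA: "A \<subseteq> M <#> A" using subgroup.one_closed[OF Ms] A_carrier by (force simp: set_mult_def)
    \<comment> \<open>Both A and its conjugate by m lie in this subgroup: in N(P) because m x does
      and R normalises A, in MA because M is normal. Sylow conjugacy inside it gives j such that j m
      normalises A, that is, j m lies in R.\<close>
    let ?J = "?L \<inter> (M <#> A)"
    have J: "subgroup ?J G" "A \<subseteq> ?J" using L MA subgroups_Inter_pair AP AMA by auto
    have B: "subgroup (conjg G m ` A) G" "card (conjg G m ` A) = s"
      using subgroup_conjg[OF A_sub mc] card_image[OF conjg_inj_on[OF mc subgroup.subset[OF A_sub]]] A_card by auto
    have "conjg G m ` A \<subseteq> ?J"
    proof
      fix y assume "y \<in> conjg G m ` A"
      then obtain a where a: "a \<in> A" "y = conjg G m a" by blast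
      have ac: "a \<in> carrier G" using A_carrier a by blast
      have "y = (m \<otimes> conjg G a (inv m)) \<otimes> a" using mc ac by (simp add: a conjg_def m_assoc)
      moreover have "m \<otimes> conjg G a (inv m) \<in> M"
        using m(1) MG[OF ac] Ms by (simp add: subgroup.m_closed subgroup.m_inv_closed)
      ultimately have "y \<in> M <#> A" using a(1) by (auto simp: set_mult_def)
      moreover have "y = conjg G (m \<otimes> x) (conjg G (inv x) a)" using mc xc ac by (simp add: a conjg_mult)
      moreover have "conjg G (inv x) a \<in> ?L"
        using A_inv[of "inv x" a] x a(1) subgroup.m_inv_closed[OF R_sub] AP by blast
      ultimately show "y \<in> ?J" using m(2) L by (simp add: conjg_def[of G "m \<otimes> x"] subgroup.m_closed subgroup.m_inv_closed)
    qed
    then obtain j where j: "j \<in> ?J" "conjg G j ` conjg G m ` A = A"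
      using conj_onto_A[OF J B(1) _ B(2)] by blast
    obtain m' a where ma: "m' \<in> M" "a \<in> A" "j = m' \<otimes> a" using j(1) by (auto simp: set_mult_def)
    have cc: "m' \<in> carrier G" "a \<in> carrier G" "j \<in> carrier G" using ma Mc A_carrier by auto
    have "j \<otimes> m \<in> set_normalizer G A"
    proof (rule set_normalizerI[OF fin_sub[OF A_sub] subgroup.subset[OF A_sub]])
      show "j \<otimes> m \<in> carrier G" using cc mc by simp
      show "conjg G (j \<otimes> m) a \<in> A" if "a \<in> A" for a
        using that j(2) cc mc A_carrier by (auto simp: conjg_mult)
    qed
    then have "j \<otimes> m \<in> R" by (simp add: A_normalizer)
    \<comment> \<open>Writing j = m' a places this element in M \<inter> R = 1. So m = j^-1 a
      normalises P, and with m and m x also x does.\<close>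
    then have "inv a \<otimes> (j \<otimes> m) \<in> R"
      using ma(2) A_R R_sub by (auto simp: subgroup.m_closed subgroup.m_inv_closed)
    moreover have e: "inv a \<otimes> (j \<otimes> m) = conjg G (inv a) m' \<otimes> m"
      using cc mc by (simp add: ma(3) conjg_def m_assoc)
    moreover have "conjg G (inv a) m' \<otimes> m \<in> M" using MG[OF _ ma(1)] cc m(1) Ms by (simp add: subgroup.m_closed)
    ultimately have "inv a \<otimes> (j \<otimes> m) = \<one>" using M(3) by auto
    then have "m = inv j \<otimes> a" using cc mc by (metis inv_closed inv_solve_left' m_assoc m_closed r_inv l_inv inv_inv inv_equality inv_mult_group)
    moreover have "j \<in> ?L" "a \<in> ?L" using j(1) AP ma(2) by auto
    ultimately have "m \<in> ?L" using L by (simp add: subgroup.m_closed subgroup.m_inv_closed)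
    moreover have "x = inv m \<otimes> (m \<otimes> x)" using mc xc by simp
    ultimately show ?thesis using m(2) L subgroup.m_closed subgroup.m_inv_closed by metis
  qed
  have "card P > 1" using P(3) one_less_power[OF prime_gt_1_nat[OF p(1)] n] by simp
  then have "P \<noteq> {\<one>}" by auto
  then have PM: "P = M"
    by (intro eq_if_inside_complement[OF Ms M(3) P(1,2)]) (use RL in \<open>auto simp: set_normalizer_def\<close>)
  then have cM: "card M = p ^ n" using P(3) by simp
  \<comment> \<open>The centre of M. It is nontrivial because M is a p-group, and it is R-invariant,
    so \<open>eq_if_inside_complement\<close> makes M abelian.\<close>
  let ?Z = "M \<inter> set_centralizer G M"
  have CM: "set_centralizer G M \<lhd> G" by (rule set_centralizer_normal[OF M(1)])
  obtain z where z: "z \<in> M" "z \<noteq> \<one>" "\<And>v. v \<in> M \<Longrightarrow> v \<otimes> z = z \<otimes> v"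
    using p_group_center[OF Ms cM n p(1) fin_sub[OF Ms]] by blast
  have "?Z = M"
  proof (rule eq_if_inside_complement[OF Ms M(3)])
    show "subgroup ?Z G" using Ms CM normal_imp_subgroup subgroups_Inter_pair by blast
    show "?Z \<noteq> {\<one>}" using z Mc by (auto simp: set_centralizer_def)
    show "conjg G x k \<in> ?Z" if "x \<in> R" "k \<in> ?Z" for x k
      using that MG CM R_carrier by (auto simp: normal_iff_conjg)
  qed auto
  then have "\<forall>v\<in>M. \<forall>w\<in>M. v \<otimes> w = w \<otimes> v" by (auto simp: set_centralizer_def)
  then show ?thesis using cM p(1) n by blast
qed

end

text \<open>If some |A| divides the order of a minimal normal subgroup M, then G is almost simple.
  Otherwise M meets R trivially, since M \<inter> R would contain a member of \<open>\<A>\<close>. A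
  family is taken because R may have several normal subgroups of prime order, such as C_q and C_r in
  the dihedral case.\<close>

lemma (in corefree_maximal_subgroup) almost_simple_or_abelian_normal:
  assumes ne: "\<A> \<noteq> {}"
    and AA: "\<And>A. A \<in> \<A> \<Longrightarrow> subgroup A G \<and> A \<subseteq> R \<and> (\<forall>x\<in>R. \<forall>a\<in>A. conjg G x a \<in> A) \<and>
      Factorial_Ring.prime (card A) \<and> \<not> card A * card A dvd card R"
    and contains: "\<And>K. subgroup K G \<Longrightarrow> K \<subseteq> R \<Longrightarrow> (\<forall>x\<in>R. \<forall>k\<in>K. conjg G x k \<in> K) \<Longrightarrow> K \<noteq> {\<one>} \<Longrightarrow> \<exists>A\<in>\<A>. A \<subseteq> K"
  shows "almost_simple G \<or> (\<exists>V p n. V \<lhd> G \<and> V \<noteq> {\<one>} \<and> V \<inter> R = {\<one>} \<and> Factorial_Ring.prime p \<and> n > 0 \<and>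
    card V = p ^ n \<and> (\<forall>v\<in>V. \<forall>w\<in>V. v \<otimes> w = w \<otimes> v) \<and> (\<forall>A\<in>\<A>. \<not> card A dvd card V))"
proof -
  let ?\<M> = "{M. M \<lhd> G \<and> M \<noteq> {\<one>}}"
  have "carrier G \<in> ?\<M>"
    using R_ne subgroup.one_closed[OF R_sub] subgroup.subset[OF R_sub] subgroup_self
    by (auto simp: normal_iff_conjg)
  moreover have "finite ?\<M>"
    by (rule finite_subset[of _ "Pow (carrier G)"])
      (use fin normal_imp_subgroup subgroup.subset in \<open>blast+\<close>)
  ultimately obtain M where M: "M \<in> ?\<M>" "\<And>K. K \<in> ?\<M> \<Longrightarrow> K \<subseteq> M \<Longrightarrow> K = M"
    using finite_has_minimal[of ?\<M>] by blast
  have Ms: "subgroup M G" using M(1) normal_imp_subgroup by blast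
  have pr: "corefree_with_prime G R A (card A)" if "A \<in> \<A>" for A
    using AA[OF that] by (intro corefree_with_prime.intro corefree_maximal_subgroup_axioms) (simp add: corefree_with_prime_axioms_def)
  show ?thesis
  proof (cases "\<exists>A\<in>\<A>. card A dvd card M")
    case True
    then obtain A where A: "A \<in> \<A>" "card A dvd card M" by blast
    interpret corefree_with_prime G R A "card A" by (rule pr[OF A(1)])
    have "almost_simple G"
      by (rule almost_simple_if_prime_dvd[OF _ _ _ A(2)]) (use M in blast)+
    then show ?thesis ..
  next
    case False
    have MR: "M \<inter> R = {\<one>}"
    proof (rule ccontr)
      assume "M \<inter> R \<noteq> {\<one>}"
      moreover have "subgroup (M \<inter> R) G" using Ms R_sub subgroups_Inter_pair by blast
      moreover have "\<forall>x\<in>R. \<forall>k\<in>M \<inter> R. conjg G x k \<in> M \<inter> R"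
        using M(1) R_carrier conjg_R by (auto simp: normal_iff_conjg)
      ultimately obtain A where A: "A \<in> \<A>" "A \<subseteq> M" using contains[of "M \<inter> R"] by blast
      then show False using False card_subgroup_dvd[OF _ Ms A(2)] AA by blast
    qed
    obtain A where A: "A \<in> \<A>" using ne by blast
    interpret corefree_with_prime G R A "card A" by (rule pr[OF A])
    show ?thesis
      using abelian_p_group_if_not_prime_dvd[of M] M(1) MR False A by blast
  qed
qed

subsection \<open>Overgroups of a regular representation\<close>

lemma (in group) nontrivial_aut_fixingI:
  assumes \<alpha>: "\<alpha> \<in> iso G G" and S: "S \<subseteq> carrier G" "\<And>x. x \<in> carrier G \<Longrightarrow> \<alpha> x \<in> S \<longleftrightarrow> x \<in> S"
    and x: "x \<in> carrier G" "\<alpha> x \<noteq> x"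
  shows "nontrivial_aut_fixing G S"
proof -
  have bij: "bij_betw \<alpha> (carrier G) (carrier G)" using \<alpha> by (auto simp: iso_def)
  have "\<alpha> ` S = S"
  proof
    show "\<alpha> ` S \<subseteq> S" using S by auto
    show "S \<subseteq> \<alpha> ` S"
    proof
      fix y assume y: "y \<in> S"
      then obtain z where "z \<in> carrier G" "y = \<alpha> z" using bij S(1) by (auto simp: bij_betw_def)
      then show "y \<in> \<alpha> ` S" using S(2) y by auto
    qed
  qed
  then show ?thesis using \<alpha> x by (auto simp: nontrivial_aut_fixing_def)
qed

lemma (in group) conjg_iso: "h \<in> carrier G \<Longrightarrow> conjg G h \<in> iso G G"
  by (intro isoI homI bij_betwI[where g = "conjg G (inv h)"]) (auto simp: conjg_of_mult)

text \<open>As act multiplies like composition of functions written on the left, the right regular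
  representation is an anti-homomorphism here.\<close>

locale cayley_action = group R + M: maximal_subgroup_of G "\<rho> ` carrier R"
  for R (structure) and G and \<rho> +
  fixes act :: "'c \<Rightarrow> 'a \<Rightarrow> 'a" and S :: "'a set"
  assumes fin_R: "finite (carrier R)"
    and S_sub: "S \<subseteq> carrier R"
    and act_closed [simp]: "g \<in> carrier G \<Longrightarrow> x \<in> carrier R \<Longrightarrow> act g x \<in> carrier R"
    and act_one [simp]: "x \<in> carrier R \<Longrightarrow> act \<one>\<^bsub>G\<^esub> x = x"
    and act_mult: "g \<in> carrier G \<Longrightarrow> h \<in> carrier G \<Longrightarrow> x \<in> carrier R \<Longrightarrow> act (g \<otimes>\<^bsub>G\<^esub> h) x = act g (act h x)"
    and faithful: "g \<in> carrier G \<Longrightarrow> h \<in> carrier G \<Longrightarrow> (\<And>x. x \<in> carrier R \<Longrightarrow> act g x = act h x) \<Longrightarrow> g = h"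
    and \<rho>_closed [simp]: "x \<in> carrier R \<Longrightarrow> \<rho> x \<in> carrier G"
    and act_\<rho> [simp]: "x \<in> carrier R \<Longrightarrow> y \<in> carrier R \<Longrightarrow> act (\<rho> x) y = y \<otimes> x"
    and preserves: "g \<in> carrier G \<Longrightarrow> x \<in> carrier R \<Longrightarrow> y \<in> carrier R \<Longrightarrow>
      act g y \<otimes> inv (act g x) \<in> S \<longleftrightarrow> y \<otimes> inv x \<in> S"
begin

abbreviation Rh where "Rh \<equiv> \<rho> ` carrier R"

lemma act_inv [simp]:
  assumes "g \<in> carrier G" "x \<in> carrier R"
  shows "act (inv\<^bsub>G\<^esub> g) (act g x) = x" "act g (act (inv\<^bsub>G\<^esub> g) x) = x"
  using assms by (simp_all flip: act_mult)

lemma \<rho>_mult: "x \<in> carrier R \<Longrightarrow> y \<in> carrier R \<Longrightarrow> \<rho> (x \<otimes> y) = \<rho> y \<otimes>\<^bsub>G\<^esub> \<rho> x"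
  by (rule faithful) (auto simp: act_mult m_assoc)

lemma \<rho>_one [simp]: "\<rho> \<one> = \<one>\<^bsub>G\<^esub>"
  by (rule faithful) auto

lemma \<rho>_inv: "x \<in> carrier R \<Longrightarrow> \<rho> (inv x) = inv\<^bsub>G\<^esub> (\<rho> x)"
  by (rule M.inv_equality[symmetric]) (simp_all flip: \<rho>_mult)

lemma \<rho>_eq_iff [simp]: "x \<in> carrier R \<Longrightarrow> y \<in> carrier R \<Longrightarrow> \<rho> x = \<rho> y \<longleftrightarrow> x = y"
  by (metis act_\<rho> l_one one_closed)

lemma \<rho>_inj: "A \<subseteq> carrier R \<Longrightarrow> inj_on \<rho> A"
  by (rule inj_onI) (metis \<rho>_eq_iff subsetD)

lemma \<rho>_mem_iff: "A \<subseteq> carrier R \<Longrightarrow> x \<in> carrier R \<Longrightarrow> \<rho> x \<in> \<rho> ` A \<longleftrightarrow> x \<in> A"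
  by auto

lemma conjg_\<rho>: "x \<in> carrier R \<Longrightarrow> y \<in> carrier R \<Longrightarrow> conjg G (\<rho> x) (\<rho> y) = \<rho> (conjg R (inv x) y)"
  by (simp add: conjg_def \<rho>_mult \<rho>_inv M.m_assoc)

text \<open>Conjugating v by \<rho> x transports its action along right translation by x;
  comparisons of V at different points go through this formula.\<close>

lemma act_conjg_\<rho>:
  "v \<in> carrier G \<Longrightarrow> x \<in> carrier R \<Longrightarrow> y \<in> carrier R \<Longrightarrow>
    act (conjg G (\<rho> x) v) y = act v (y \<otimes> inv x) \<otimes> x"
  by (simp add: conjg_def act_mult \<rho>_inv[symmetric])

lemma \<rho>_subgroup:
  assumes "subgroup A R"
  shows "subgroup (\<rho> ` A) G"
proof (rule M.subgroupI)
  have c: "x \<in> carrier R" if "x \<in> A" for x using assms that by (rule subgroup.mem_carrier)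
  show "\<rho> ` A \<subseteq> carrier G" using c by auto
  show "\<rho> ` A \<noteq> {}" using subgroup_nonempty assms by auto
  show "inv\<^bsub>G\<^esub> a \<in> \<rho> ` A" if "a \<in> \<rho> ` A" for a
    using that c subgroup.m_inv_closed[OF assms] by (auto simp: \<rho>_inv[symmetric])
  show "a \<otimes>\<^bsub>G\<^esub> b \<in> \<rho> ` A" if "a \<in> \<rho> ` A" "b \<in> \<rho> ` A" for a b
    using that c subgroup.m_closed[OF assms] by (auto simp: \<rho>_mult[symmetric])
qed

lemma \<rho>_conj_closed:
  assumes "A \<lhd> R" "x \<in> Rh" "a \<in> \<rho> ` A"
  shows "conjg G x a \<in> \<rho> ` A"
proof -
  have "A \<subseteq> carrier R" using assms(1) normal_imp_subgroup subgroup.subset by blast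
  then show ?thesis using assms by (auto simp: conjg_\<rho> normal_iff_conjg)
qed

lemma \<rho>_vimage_subgroup:
  assumes "subgroup D G"
  shows "subgroup {x \<in> carrier R. \<rho> x \<in> D} R"
  by (rule subgroupI)
    (use assms in \<open>auto simp: \<rho>_mult \<rho>_inv subgroup.m_closed subgroup.m_inv_closed subgroup.one_closed\<close>)

lemma \<rho>_vimage_normal:
  assumes "D \<lhd> G"
  shows "{x \<in> carrier R. \<rho> x \<in> D} \<lhd> R"
  unfolding normal_iff_conjg
proof (intro conjI ballI)
  show "subgroup {x \<in> carrier R. \<rho> x \<in> D} R" by (rule \<rho>_vimage_subgroup[OF normal_imp_subgroup[OF assms]])
  fix g h assume g: "g \<in> carrier R" and h: "h \<in> {x \<in> carrier R. \<rho> x \<in> D}"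
  have "conjg G (\<rho> (inv g)) (\<rho> h) \<in> D" using assms g h by (simp add: M.normal_iff_conjg)
  then show "conjg R g h \<in> {x \<in> carrier R. \<rho> x \<in> D}" using g h by (simp add: conjg_\<rho>)
qed

definition stab where "stab x = {g \<in> carrier G. act g x = x}"

lemma stab_subgroup:
  assumes "x \<in> carrier R"
  shows "subgroup (stab x) G"
proof (rule M.subgroupI)
  have "\<one>\<^bsub>G\<^esub> \<in> stab x" using assms by (simp add: stab_def)
  then show "stab x \<noteq> {}" by blast
  show "inv\<^bsub>G\<^esub> a \<in> stab x" if "a \<in> stab x" for a
    using that act_inv(1)[of a x] assms by (simp add: stab_def)
qed (use assms in \<open>auto simp: stab_def act_mult\<close>)

lemma Rh_stab: "stab \<one> \<inter> Rh = {\<one>\<^bsub>G\<^esub>}"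
proof -
  have "\<one>\<^bsub>G\<^esub> \<in> Rh" using \<rho>_one by (metis imageI one_closed)
  then show ?thesis by (auto simp: stab_def \<rho>_one[symmetric] simp del: \<rho>_one)
qed

text \<open>The factorisation of a transitive group by a regular subgroup. Together with
  \<open>Rh_stab\<close> it makes the stabiliser of \<open>\<one>\<close> a complement of the
  regular subgroup.\<close>

lemma stab_Rh: "stab \<one> <#>\<^bsub>G\<^esub> Rh = carrier G"
proof
  show "stab \<one> <#>\<^bsub>G\<^esub> Rh \<subseteq> carrier G" by (auto simp: set_mult_def stab_def)
  show "carrier G \<subseteq> stab \<one> <#>\<^bsub>G\<^esub> Rh"
  proof
    fix g assume g: "g \<in> carrier G"
    let ?x = "inv (act (inv\<^bsub>G\<^esub> g) \<one>)"
    have x: "?x \<in> carrier R" using g by simp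
    have "act (g \<otimes>\<^bsub>G\<^esub> \<rho> (inv ?x)) \<one> = \<one>" using g x by (simp add: act_mult)
    then have "g \<otimes>\<^bsub>G\<^esub> \<rho> (inv ?x) \<in> stab \<one>" using g x by (simp add: stab_def)
    moreover have "g = (g \<otimes>\<^bsub>G\<^esub> \<rho> (inv ?x)) \<otimes>\<^bsub>G\<^esub> \<rho> ?x"
      using g x unfolding \<rho>_inv[OF x] by (simp add: M.m_assoc)
    ultimately show "g \<in> stab \<one> <#>\<^bsub>G\<^esub> Rh" using x unfolding set_mult_def by blast
  qed
qed

lemma stab_nontrivial: "stab \<one> \<noteq> {\<one>\<^bsub>G\<^esub>}"
proof
  assume "stab \<one> = {\<one>\<^bsub>G\<^esub>}"
  then have "carrier G \<subseteq> Rh" using stab_Rh by (auto simp: set_mult_def)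
  then show False using M.R_ne subgroup.subset[OF M.R_sub] by blast
qed

text \<open>S is the set of out-neighbours of \<open>\<one>\<close>, so the stabiliser of
  \<open>\<one>\<close> permutes it.\<close>

lemma mem_S_iff: "v \<in> stab \<one> \<Longrightarrow> x \<in> carrier R \<Longrightarrow> act v x \<in> S \<longleftrightarrow> x \<in> S"
  using preserves[of v \<one> x] by (simp add: stab_def)

text \<open>If g fixes \<open>\<one>\<close> and normalises the regular subgroup, the conjugate of
  \<rho> x by g is the translation taking \<open>\<one>\<close> to g x, that is, \<rho> (g x).
  Comparing products shows that g acts as an automorphism of R.\<close>

lemma nontrivial_aut_if_regular_normal:
  assumes "Rh \<lhd> G"
  shows "nontrivial_aut_fixing R S"
proof -
  obtain g where g: "g \<in> stab \<one>" "g \<noteq> \<one>\<^bsub>G\<^esub>"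
    using stab_nontrivial subgroup.one_closed[OF stab_subgroup[OF one_closed]] by blast
  have gc: "g \<in> carrier G" "act g \<one> = \<one>" using g(1) by (auto simp: stab_def)
  have conj: "conjg G g (\<rho> x) = \<rho> (act g x)" if x: "x \<in> carrier R" for x
  proof -
    obtain z where z: "z \<in> carrier R" "conjg G g (\<rho> x) = \<rho> z"
      using assms gc x by (auto simp: M.normal_iff_conjg)
    then have "act (conjg G g (\<rho> x)) \<one> = z" by simp
    moreover have "act (inv\<^bsub>G\<^esub> g) \<one> = \<one>" using act_inv(1)[of g \<one>] gc by simp
    ultimately show ?thesis using z(2) gc x by (simp add: conjg_def act_mult)
  qed
  have "act g \<in> hom R R"
  proof (rule homI)
    fix x y assume xy: "x \<in> carrier R" "y \<in> carrier R"
    have "\<rho> (act g (x \<otimes> y)) = conjg G g (\<rho> y \<otimes>\<^bsub>G\<^esub> \<rho> x)"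
      using xy by (simp add: conj[symmetric] \<rho>_mult)
    also have "\<dots> = \<rho> (act g y) \<otimes>\<^bsub>G\<^esub> \<rho> (act g x)"
      using xy gc by (simp add: M.conjg_of_mult conj)
    also have "\<dots> = \<rho> (act g x \<otimes> act g y)" using xy gc by (simp add: \<rho>_mult)
    finally show "act g (x \<otimes> y) = act g x \<otimes> act g y" using xy gc by simp
  qed (use gc in auto)
  moreover have "bij_betw (act g) (carrier R) (carrier R)"
    by (rule bij_betwI[where g = "act (inv\<^bsub>G\<^esub> g)"]) (use gc in auto)
  ultimately have iso: "act g \<in> iso R R" by (rule isoI)
  obtain x where "x \<in> carrier R" "act g x \<noteq> x" using faithful[of g "\<one>\<^bsub>G\<^esub>"] g gc by force
  then show ?thesis using nontrivial_aut_fixingI[OF iso S_sub] mem_S_iff g(1) by blast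
qed

lemma nontrivial_aut_if_conjg:
  assumes h: "h \<in> carrier R" and S: "\<And>x. x \<in> carrier R \<Longrightarrow> conjg R h x \<in> S \<longleftrightarrow> x \<in> S"
    and x: "x \<in> carrier R" "h \<otimes> x \<noteq> x \<otimes> h"
  shows "nontrivial_aut_fixing R S"
  using nontrivial_aut_fixingI[OF conjg_iso[OF h] S_sub S x(1)] conjg_eq_iff[OF h x(1)] x(2) by blast

text \<open>For a = v 1 and b = w 1, the conjugate of v by \<rho> b again lies in V and takes b to a
  b. In other words, the orbit is a block, and a block of a regular group containing the identity is
  a subgroup.\<close>

lemma orbit_subgroup:
  assumes V: "V \<lhd> G"
  shows "subgroup ((\<lambda>v. act v \<one>) ` V) R"
proof -
  have Vs: "subgroup V G" using V by (rule normal_imp_subgroup)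
  have Vc: "v \<in> carrier G" if "v \<in> V" for v using Vs that by (rule subgroup.mem_carrier)
  have VG: "conjg G g v \<in> V" if "g \<in> carrier G" "v \<in> V" for g v using V that by (simp add: M.normal_iff_conjg)
  show ?thesis
  proof (rule subgroupI)
    show "(\<lambda>v. act v \<one>) ` V \<subseteq> carrier R" using Vc by auto
    show "(\<lambda>v. act v \<one>) ` V \<noteq> {}" using Vs subgroup_nonempty by auto
    show "inv a \<in> (\<lambda>v. act v \<one>) ` V" if a: "a \<in> (\<lambda>v. act v \<one>) ` V" for a
    proof -
      obtain v where v: "v \<in> V" "a = act v \<one>" using a by auto
      then have a: "a \<in> carrier R" using Vc by simp
      have "act (inv\<^bsub>G\<^esub> v) a = \<one>" using v Vc by simp
      then have "act (conjg G (\<rho> (inv a)) (inv\<^bsub>G\<^esub> v)) \<one> = inv a"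
        using a v Vc by (simp add: act_conjg_\<rho>)
      moreover have "conjg G (\<rho> (inv a)) (inv\<^bsub>G\<^esub> v) \<in> V"
        using VG a v subgroup.m_inv_closed[OF Vs] by simp
      ultimately show ?thesis by (metis imageI)
    qed
    show "a \<otimes> b \<in> (\<lambda>v. act v \<one>) ` V" if a: "a \<in> (\<lambda>v. act v \<one>) ` V" and b: "b \<in> (\<lambda>v. act v \<one>) ` V" for a b
    proof -
      obtain v w where v: "v \<in> V" "a = act v \<one>" and w: "w \<in> V" "b = act w \<one>" using a b by auto
      have c: "a \<in> carrier R" "b \<in> carrier R" using v w Vc by auto
      have "act (conjg G (\<rho> b) v \<otimes>\<^bsub>G\<^esub> w) \<one> = a \<otimes> b"
        using c v w Vc by (simp add: act_mult act_conjg_\<rho>)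
      moreover have "conjg G (\<rho> b) v \<otimes>\<^bsub>G\<^esub> w \<in> V" using VG c v w subgroup.m_closed[OF Vs] by simp
      ultimately show ?thesis by (metis imageI)
    qed
  qed
qed

text \<open>Normality of V lets \<rho> x carry the orbit of \<open>\<one>\<close> to the orbit of
  x.\<close>

lemma orbit_eq:
  assumes V: "V \<lhd> G" and x: "x \<in> carrier R"
  shows "(\<lambda>v. act v x) ` V = (\<lambda>h. h \<otimes> x) ` (\<lambda>v. act v \<one>) ` V"
proof -
  have Vc: "v \<in> carrier G" if "v \<in> V" for v using normal_imp_subgroup[OF V] that by (rule subgroup.mem_carrier)
  have "(\<lambda>v. act v \<one> \<otimes> x) ` V = (\<lambda>v. act (conjg G (\<rho> x) v) x) ` V"
    by (rule image_cong) (use x Vc in \<open>auto simp: act_conjg_\<rho>\<close>)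
  also have "\<dots> = (\<lambda>v. act v x) ` conjg G (\<rho> x) ` V" by (simp add: image_image)
  also have "\<dots> = (\<lambda>v. act v x) ` V" using M.normal_conjg_image[OF V] x by simp
  finally show ?thesis by (simp add: image_image)
qed

lemma orbit_stabilizer_card:
  assumes V: "subgroup V G" and x: "x \<in> carrier R"
  shows "card V = card ((\<lambda>v. act v x) ` V) * card {v \<in> V. act v x = x}"
proof -
  have Vc: "v \<in> carrier G" if "v \<in> V" for v using V that by (rule subgroup.mem_carrier)
  have fV: "finite V" using M.fin subgroup.subset[OF V] finite_subset by blast
  have fib: "card {v \<in> V. act v x = y} = card {v \<in> V. act v x = x}" if y: "y \<in> (\<lambda>v. act v x) ` V" for y
  proof -
    obtain w where w: "w \<in> V" "y = act w x" using y by blast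
    have "bij_betw (\<lambda>v. w \<otimes>\<^bsub>G\<^esub> v) {v \<in> V. act v x = x} {v \<in> V. act v x = y}"
      by (rule bij_betwI[where g = "\<lambda>v. inv\<^bsub>G\<^esub> w \<otimes>\<^bsub>G\<^esub> v"])
        (use w Vc x V in \<open>auto simp: act_mult subgroup.m_closed subgroup.m_inv_closed\<close>)
    then show ?thesis by (simp add: bij_betw_same_card)
  qed
  have "card V = card (\<Union>y\<in>(\<lambda>v. act v x) ` V. {v \<in> V. act v x = y})" by (rule arg_cong[where f = card]) auto
  also have "\<dots> = (\<Sum>y\<in>(\<lambda>v. act v x) ` V. card {v \<in> V. act v x = y})"
    by (rule card_UN_disjoint) (use fV in auto)
  also have "\<dots> = card ((\<lambda>v. act v x) ` V) * card {v \<in> V. act v x = x}" by (simp add: fib)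
  finally show ?thesis .
qed

lemma orbit_nontrivial:
  assumes V: "V \<lhd> G" "V \<noteq> {\<one>\<^bsub>G\<^esub>}"
  shows "(\<lambda>v. act v \<one>) ` V \<noteq> {\<one>}"
proof
  assume H: "(\<lambda>v. act v \<one>) ` V = {\<one>}"
  have Vc: "v \<in> carrier G" if "v \<in> V" for v using normal_imp_subgroup[OF V(1)] that by (rule subgroup.mem_carrier)
  have "v = \<one>\<^bsub>G\<^esub>" if v: "v \<in> V" for v
  proof (rule faithful)
    fix x assume x: "x \<in> carrier R"
    have "act v x \<in> (\<lambda>h. h \<otimes> x) ` (\<lambda>v. act v \<one>) ` V" using orbit_eq[OF V(1) x] v by blast
    then show "act v x = act \<one>\<^bsub>G\<^esub> x" using x by (simp add: H)
  qed (use Vc v in auto)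
  then show False using V(2) subgroup.one_closed[OF normal_imp_subgroup[OF V(1)]] by blast
qed

text \<open>G is the product of V and the regular subgroup; the first centralises \<rho> A, the
  second normalises it.\<close>

lemma \<rho>_normal_if_commutes:
  assumes A: "A \<lhd> R" and V: "V \<lhd> G" "\<not> V \<subseteq> Rh"
    and comm: "\<And>a v. a \<in> A \<Longrightarrow> v \<in> V \<Longrightarrow> v \<otimes>\<^bsub>G\<^esub> \<rho> a = \<rho> a \<otimes>\<^bsub>G\<^esub> v"
  shows "\<rho> ` A \<lhd> G"
  unfolding M.normal_iff_conjg
proof (intro conjI ballI)
  show "subgroup (\<rho> ` A) G" by (rule \<rho>_subgroup[OF normal_imp_subgroup[OF A]])
  have Ac: "A \<subseteq> carrier R" using subgroup.subset[OF normal_imp_subgroup[OF A]] .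
  have Vc: "v \<in> carrier G" if "v \<in> V" for v using normal_imp_subgroup[OF V(1)] that by (rule subgroup.mem_carrier)
  fix g b assume g: "g \<in> carrier G" and b: "b \<in> \<rho> ` A"
  have "g \<in> V <#>\<^bsub>G\<^esub> Rh" using M.normal_set_mult_R[OF V] g by simp
  then obtain v x where vx: "v \<in> V" "x \<in> Rh" "g = v \<otimes>\<^bsub>G\<^esub> x" by (auto simp: set_mult_def)
  obtain a where a: "a \<in> A" "conjg G x b = \<rho> a" using \<rho>_conj_closed[OF A vx(2) b] by blast
  have "conjg G v (\<rho> a) = \<rho> a" using comm[OF a(1) vx(1)] Vc[OF vx(1)] a(1) Ac by (subst M.conjg_eq_iff) auto
  then show "conjg G g b \<in> \<rho> ` A" using vx a b Ac Vc M.R_carrier by (auto simp: M.conjg_mult subset_eq)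
qed

end

subsection \<open>Abelian normal subgroups with orbits of prime length\<close>

text \<open>Orbits of prime length p mean that every point stabiliser in V has index p and so is a
  maximal subgroup of V. Everything about these blocks rests on that.\<close>

locale cayley_block = cayley_action +
  fixes V and p :: nat
  assumes V_normal: "V \<lhd> G" and V_comm: "v \<in> V \<Longrightarrow> w \<in> V \<Longrightarrow> v \<otimes>\<^bsub>G\<^esub> w = w \<otimes>\<^bsub>G\<^esub> v"
    and p_prime: "Factorial_Ring.prime p" and H_card: "card ((\<lambda>v. act v \<one>) ` V) = p"
begin

definition "H = (\<lambda>v. act v \<one>) ` V"
definition "K x = {v \<in> V. act v x = x}"
definition "W = {x \<in> carrier R. K x = K \<one>}"

lemma V_sub: "subgroup V G"
  using V_normal by (rule normal_imp_subgroup)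

lemma V_carrier: "v \<in> V \<Longrightarrow> v \<in> carrier G"
  using V_sub by (rule subgroup.mem_carrier)

lemma V_conj: "g \<in> carrier G \<Longrightarrow> v \<in> V \<Longrightarrow> conjg G g v \<in> V"
  using V_normal by (simp add: M.normal_iff_conjg)

lemma H_sub: "subgroup H R"
  unfolding H_def by (rule orbit_subgroup[OF V_normal])

lemma H_carrier: "h \<in> H \<Longrightarrow> h \<in> carrier R"
  using H_sub by (rule subgroup.mem_carrier)

lemma K_sub: "x \<in> carrier R \<Longrightarrow> subgroup (K x) G"
proof -
  assume x: "x \<in> carrier R"
  have "K x = V \<inter> stab x" using V_carrier by (auto simp: K_def stab_def)
  then show ?thesis using M.subgroups_Inter_pair[OF V_sub stab_subgroup[OF x]] by simp
qed

lemma K_mult: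
  assumes x: "x \<in> carrier R" and y: "y \<in> carrier R"
  shows "K (x \<otimes> y) = conjg G (\<rho> y) ` K x"
proof
  show "conjg G (\<rho> y) ` K x \<subseteq> K (x \<otimes> y)"
    using x y V_carrier V_conj by (auto simp: K_def act_conjg_\<rho> m_assoc)
  show "K (x \<otimes> y) \<subseteq> conjg G (\<rho> y) ` K x"
  proof
    fix v assume v: "v \<in> K (x \<otimes> y)"
    then have vV: "v \<in> V" "v \<in> carrier G" using V_carrier by (auto simp: K_def)
    have "conjg G (\<rho> (inv y)) v \<in> K x"
      using v vV x y V_conj by (auto simp: K_def act_conjg_\<rho> m_assoc)
    moreover have "conjg G (\<rho> y) (conjg G (\<rho> (inv y)) v) = v" using vV y by (simp add: \<rho>_inv)
    ultimately show "v \<in> conjg G (\<rho> y) ` K x" by force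
  qed
qed

lemma V_index: "x \<in> carrier R \<Longrightarrow> card V = p * card (K x)"
proof -
  assume x: "x \<in> carrier R"
  have "inj_on (\<lambda>h. h \<otimes> x) ((\<lambda>v. act v \<one>) ` V)"
    by (rule inj_onI) (use x V_carrier in auto)
  then have "card ((\<lambda>v. act v x) ` V) = p"
    unfolding orbit_eq[OF V_normal x] H_card[symmetric] by (rule card_image)
  then show ?thesis using orbit_stabilizer_card[OF V_sub x] by (simp add: K_def)
qed

text \<open>V is abelian, so stabilisers are constant along its orbits; this puts \<open>H\<close>
  into \<open>W\<close>.\<close>

lemma K_act:
  assumes v: "v \<in> V" and x: "x \<in> carrier R"
  shows "K (act v x) = K x"
proof -
  have "act w (act v x) = act v x \<longleftrightarrow> act w x = x" if w: "w \<in> V" for w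
  proof -
    have "act w (act v x) = act v (act w x)"
      using V_comm[OF v w] v w V_carrier x by (metis act_mult)
    moreover have "act v (act w x) = act v x \<longleftrightarrow> act w x = x"
      using v w V_carrier x by (metis act_closed act_inv(1))
    ultimately show ?thesis by simp
  qed
  then show ?thesis by (auto simp: K_def)
qed

text \<open>By \<open>K_mult\<close>, \<open>W\<close> consists of the x for which \<rho> x
  normalises the stabiliser of \<open>\<one>\<close> in V.\<close>

lemma W_sub: "subgroup W R"
proof (rule subgroupI)
  have "\<one> \<in> W" by (simp add: W_def)
  then show "W \<noteq> {}" by blast
  show "inv a \<in> W" if "a \<in> W" for a
  proof -
    have a: "a \<in> carrier R" "K a = K \<one>" using that by (auto simp: W_def)
    have "K (inv a) = conjg G (\<rho> (inv a)) ` K \<one>" using K_mult[of \<one> "inv a"] a by simp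
    also have "\<dots> = K \<one>" using K_mult[of a "inv a"] a by simp
    finally show ?thesis using a by (simp add: W_def)
  qed
  show "a \<otimes> b \<in> W" if "a \<in> W" "b \<in> W" for a b
  proof -
    have a: "a \<in> carrier R" "K a = K \<one>" "b \<in> carrier R" "K b = K \<one>" using that by (auto simp: W_def)
    have "K (a \<otimes> b) = conjg G (\<rho> b) ` K \<one>" using K_mult[of a b] a by simp
    also have "\<dots> = K \<one>" using K_mult[of \<one> b] a by simp
    finally show ?thesis using a by (simp add: W_def)
  qed
qed (auto simp: W_def)

lemma W_carrier: "x \<in> W \<Longrightarrow> x \<in> carrier R"
  by (simp add: W_def)

lemma H_W: "H \<subseteq> W"
  using K_act[OF _ one_closed] V_carrier by (auto simp: H_def W_def)

lemma W_conj_K: "x \<in> W \<Longrightarrow> v \<in> K \<one> \<Longrightarrow> conjg G (\<rho> x) v \<in> K \<one>"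
  using K_mult[of \<one> x] by (auto simp: W_def)

text \<open>Two of the point stabilisers in V have prime index in V, so together they generate V if they differ.\<close>

lemma K_transitive:
  assumes x: "x \<in> carrier R" and y: "y \<in> carrier R" and ne: "K x \<noteq> K y" and h: "h \<in> H"
  shows "\<exists>v\<in>K x. act v y = h \<otimes> y"
proof -
  have sub: "K x \<subseteq> V" "K y \<subseteq> V" by (auto simp: K_def)
  have L: "subgroup (K x <#>\<^bsub>G\<^esub> K y) G"
    by (rule M.set_mult_subgroup[OF K_sub[OF y] K_sub[OF x]])
      (use V_comm V_carrier sub in \<open>auto simp: M.conjg_eq_iff[THEN iffD2] subset_eq\<close>)
  have oc: "\<one>\<^bsub>G\<^esub> \<in> K x" "\<one>\<^bsub>G\<^esub> \<in> K y" using K_sub x y subgroup.one_closed by blast+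
  have s2: "K y \<subseteq> K x <#>\<^bsub>G\<^esub> K y"
  proof
    fix k assume k: "k \<in> K y"
    then have "k = \<one>\<^bsub>G\<^esub> \<otimes>\<^bsub>G\<^esub> k" using sub V_carrier by auto
    then show "k \<in> K x <#>\<^bsub>G\<^esub> K y" using k oc unfolding set_mult_def by blast
  qed
  have s1: "K x \<subseteq> K x <#>\<^bsub>G\<^esub> K y"
  proof
    fix k assume k: "k \<in> K x"
    then have "k = k \<otimes>\<^bsub>G\<^esub> \<one>\<^bsub>G\<^esub>" using sub V_carrier by auto
    then show "k \<in> K x <#>\<^bsub>G\<^esub> K y" using k oc unfolding set_mult_def by blast
  qed
  have "K x <#>\<^bsub>G\<^esub> K y \<noteq> K y"
  proof
    assume "K x <#>\<^bsub>G\<^esub> K y = K y"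
    then have "K x \<subseteq> K y" using s1 by simp
    moreover have "card (K x) = card (K y)"
      using V_index[OF x] V_index[OF y] p_prime prime_gt_0_nat by auto
    moreover have "finite (K y)" using M.fin subgroup.subset[OF K_sub[OF y]] finite_subset by blast
    ultimately show False using ne card_subset_eq by blast
  qed
  moreover have "K x <#>\<^bsub>G\<^esub> K y \<subseteq> V"
    using sub subgroup.m_closed[OF V_sub] by (auto simp: set_mult_def)
  ultimately have eq: "K x <#>\<^bsub>G\<^esub> K y = V"
    by (intro M.prime_index_subgroup[OF M.fin K_sub[OF y] L V_sub s2 _ V_index[OF y] p_prime])
  have "h \<otimes> y \<in> (\<lambda>v. act v y) ` V" using orbit_eq[OF V_normal y] h by (simp add: H_def)
  then obtain v where v: "v \<in> V" "act v y = h \<otimes> y" by force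
  have "v \<in> K x <#>\<^bsub>G\<^esub> K y" using v(1) eq by simp
  then obtain a b where ab: "a \<in> K x" "b \<in> K y" "v = a \<otimes>\<^bsub>G\<^esub> b" by (auto simp: set_mult_def)
  have "a \<in> carrier G" "b \<in> carrier G" using ab sub V_carrier by auto
  then have "act v y = act a (act b y)" using ab(3) y by (simp add: act_mult)
  also have "act b y = y" using ab(2) by (simp add: K_def)
  finally show ?thesis using ab(1) v(2) by auto
qed

lemma K_one_stab: "v \<in> K \<one> \<Longrightarrow> v \<in> stab \<one>"
  using V_carrier by (auto simp: K_def stab_def)

text \<open>An element of V that fixes \<open>\<one>\<close> permutes S, and outside
  \<open>W\<close> such elements can move x to any h x.\<close>

lemma S_left_invariant:
  assumes x: "x \<in> carrier R" "x \<notin> W" and h: "h \<in> H"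
  shows "h \<otimes> x \<in> S \<longleftrightarrow> x \<in> S"
proof -
  obtain v where "v \<in> K \<one>" "act v x = h \<otimes> x"
    using K_transitive[OF one_closed x(1) _ h] x by (auto simp: W_def)
  then show ?thesis using mem_S_iff[OF K_one_stab _] x(1) by metis
qed

lemma mult_H_notin_W:
  assumes "x \<in> carrier R" "x \<notin> W" "h \<in> H"
  shows "x \<otimes> h \<notin> W"
proof
  assume "x \<otimes> h \<in> W"
  moreover have "inv h \<in> W" using assms(3) H_W subgroup.m_inv_closed[OF W_sub] by blast
  ultimately have "x \<otimes> h \<otimes> inv h \<in> W" by (rule subgroup.m_closed[OF W_sub])
  then show False using assms H_carrier by (simp add: m_assoc)
qed

lemma S_right_invariant:
  assumes x: "x \<in> carrier R" "x \<notin> W" and h: "h \<in> H"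
  shows "x \<otimes> h \<in> S \<longleftrightarrow> x \<in> S"
proof -
  have hc: "h \<in> carrier R" using H_carrier h by blast
  \<comment> \<open>An element taking \<open>\<one>\<close> to h^-1 maps the pair (1, x) to (h^-1,
    h' x) with some h' in \<open>H\<close>. The quotient of the new pair is h' x h, and left
    invariance removes h'.\<close>
  obtain v where v: "v \<in> V" "inv h = act v \<one>" using subgroup.m_inv_closed[OF H_sub h] by (auto simp: H_def)
  have "act v x \<in> (\<lambda>v. act v x) ` V" using v(1) by blast
  then obtain h' where h': "h' \<in> H" "act v x = h' \<otimes> x" using orbit_eq[OF V_normal x(1)] by (auto simp: H_def)
  have "h' \<otimes> x \<otimes> inv (inv h) \<in> S \<longleftrightarrow> x \<otimes> inv \<one> \<in> S"
    using preserves[of v \<one> x] v h' V_carrier x(1) by simp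
  then have "h' \<otimes> (x \<otimes> h) \<in> S \<longleftrightarrow> x \<in> S" using x(1) hc H_carrier[OF h'(1)] by (simp add: m_assoc)
  then show ?thesis using S_left_invariant[OF _ mult_H_notin_W[OF x h] h'(1)] x(1) hc by simp
qed

lemma S_conjg_invariant:
  assumes x: "x \<in> carrier R" "x \<notin> W" and h: "h \<in> H"
  shows "conjg R h x \<in> S \<longleftrightarrow> x \<in> S"
proof -
  have "inv h \<in> H" using subgroup.m_inv_closed[OF H_sub h] .
  then show ?thesis
    using S_left_invariant[of "x \<otimes> inv h" h] mult_H_notin_W[OF x] S_right_invariant[OF x] x(1) h H_carrier[OF h]
    by (simp add: conjg_def m_assoc)
qed

text \<open>Conjugation by h fixes \<open>W\<close> pointwise and moves the other points within
  double cosets of \<open>H\<close>, where membership in S is constant.\<close>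

lemma nontrivial_aut_if_W_centralizes_H:
  assumes "\<And>w h. w \<in> W \<Longrightarrow> h \<in> H \<Longrightarrow> h \<otimes> w = w \<otimes> h"
    and "h \<in> H" "x \<in> carrier R" "h \<otimes> x \<noteq> x \<otimes> h"
  shows "nontrivial_aut_fixing R S"
proof (rule nontrivial_aut_if_conjg[of h])
  show "conjg R h y \<in> S \<longleftrightarrow> y \<in> S" if "y \<in> carrier R" for y
    using assms(1)[of y h] assms(2) S_conjg_invariant[of y h] that H_carrier conjg_eq_iff[of h y]
    by (cases "y \<in> W") auto
qed (use assms H_carrier in auto)

text \<open>A variant for a \<open>W\<close> that may fail to centralise \<open>H\<close>. If \<rho>
  y commutes with v and h = v 1, then v y = h y; so h y h^-1 is the quotient of the image of the
  pair (1, y) under v, and v preserves adjacency.\<close>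

lemma nontrivial_aut_if_W_centralizes_V:
  assumes comm: "\<And>w v. w \<in> W \<Longrightarrow> v \<in> V \<Longrightarrow> v \<otimes>\<^bsub>G\<^esub> \<rho> w = \<rho> w \<otimes>\<^bsub>G\<^esub> v"
    and h: "h \<in> H" "x \<in> carrier R" "h \<otimes> x \<noteq> x \<otimes> h"
  shows "nontrivial_aut_fixing R S"
proof (rule nontrivial_aut_if_conjg[of h])
  have hc: "h \<in> carrier R" using h(1) by (rule H_carrier)
  obtain v where v: "v \<in> V" "h = act v \<one>" using h(1) by (auto simp: H_def)
  show "conjg R h y \<in> S \<longleftrightarrow> y \<in> S" if y: "y \<in> carrier R" for y
  proof (cases "y \<in> W")
    case True
    have "act v y = act (v \<otimes>\<^bsub>G\<^esub> \<rho> y) \<one>" using v V_carrier y by (simp add: act_mult)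
    also have "\<dots> = h \<otimes> y" using comm[OF True v(1)] v V_carrier y hc by (simp add: act_mult)
    finally show ?thesis using preserves[of v \<one> y] v V_carrier y by (simp add: conjg_def)
  qed (use S_conjg_invariant y h(1) in auto)
qed (use h H_carrier in auto)

text \<open>The commutator u of \<rho> a and v fixes \<open>\<one>\<close>. Its conjugates under
  translations are commutators of the same kind, because A and V are normal, so u fixes every
  point.\<close>

lemma centralizes_V:
  assumes A: "A \<lhd> R" "A \<subseteq> W" and triv: "\<And>a v. a \<in> A \<Longrightarrow> v \<in> V \<Longrightarrow> conjg G (\<rho> a) v \<otimes>\<^bsub>G\<^esub> inv\<^bsub>G\<^esub> v \<in> K \<one>"
    and a: "a \<in> A" and v: "v \<in> V"
  shows "v \<otimes>\<^bsub>G\<^esub> \<rho> a = \<rho> a \<otimes>\<^bsub>G\<^esub> v"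
proof -
  let ?u = "conjg G (\<rho> a) v \<otimes>\<^bsub>G\<^esub> inv\<^bsub>G\<^esub> v"
  have ac: "a \<in> carrier R" using a A(2) W_carrier by blast
  have vc: "v \<in> carrier G" using V_carrier v by blast
  have uc: "?u \<in> carrier G" using ac vc by simp
  have "act ?u x = x" if x: "x \<in> carrier R" for x
  proof -
    have xa: "conjg R x a \<in> A" using A(1) x a by (simp add: normal_iff_conjg)
    have v': "conjg G (\<rho> (inv x)) v \<in> V" using V_conj v x by simp
    have "conjg G (\<rho> (inv x)) ?u =
      conjg G (conjg G (\<rho> (inv x)) (\<rho> a)) (conjg G (\<rho> (inv x)) v) \<otimes>\<^bsub>G\<^esub> inv\<^bsub>G\<^esub> (conjg G (\<rho> (inv x)) v)"
      using ac vc x by (simp add: M.conjg_of_mult M.conjg_of_inv conjg_def[of G "\<rho> a"]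
        conjg_def[of G "conjg G (\<rho> (inv x)) (\<rho> a)"])
    also have "conjg G (\<rho> (inv x)) (\<rho> a) = \<rho> (conjg R x a)" using x ac by (simp add: conjg_\<rho>)
    finally have "conjg G (\<rho> (inv x)) ?u \<in> K \<one>" using triv[OF xa v'] by simp
    then have "act (conjg G (\<rho> (inv x)) ?u) \<one> = \<one>" by (simp add: K_def)
    then have "act ?u x \<otimes> inv x = \<one>" using x uc by (simp add: act_conjg_\<rho>)
    then show ?thesis using x uc by (metis act_closed inv_closed inv_equality inv_inv)
  qed
  then have "?u = \<one>\<^bsub>G\<^esub>" using faithful[OF uc M.one_closed] by simp
  then have "conjg G (\<rho> a) v = v" using ac vc by (metis M.conjg_closed M.inv_closed M.inv_equality M.inv_inv \<rho>_closed)
  then show ?thesis using M.conjg_eq_iff ac vc by simp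
qed

text \<open>A lies in \<open>W\<close>, so it normalises the stabiliser of \<open>\<one>\<close> in
  V, which has index p; the condition on p - 1 makes the action on the quotient trivial.\<close>

lemma prime_centralizes_V:
  assumes A: "A \<lhd> R" "A \<subseteq> W" "card A = s" "Factorial_Ring.prime s" "\<not> s dvd p - 1"
    and a: "a \<in> A" and v: "v \<in> V"
  shows "v \<otimes>\<^bsub>G\<^esub> \<rho> a = \<rho> a \<otimes>\<^bsub>G\<^esub> v"
proof (rule centralizes_V[OF A(1,2) _ a v])
  fix b w assume b: "b \<in> A" and w: "w \<in> V"
  have Ac: "A \<subseteq> carrier R" using A(2) W_carrier by blast
  show "conjg G (\<rho> b) w \<otimes>\<^bsub>G\<^esub> inv\<^bsub>G\<^esub> w \<in> K \<one>"
  proof (rule M.prime_action_trivial_on_quotient[OF M.fin _ _ A(4) V_sub V_comm K_sub[OF one_closed] _ V_index[OF one_closed] p_prime A(5)])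
    show "subgroup (\<rho> ` A) G" by (rule \<rho>_subgroup[OF normal_imp_subgroup[OF A(1)]])
    show "card (\<rho> ` A) = s" using card_image[OF \<rho>_inj[OF Ac]] A(3) by simp
    show "K \<one> \<subseteq> V" by (auto simp: K_def)
    show "conjg G c u \<in> V" if "c \<in> \<rho> ` A" "u \<in> V" for c u using that Ac V_conj by auto
    show "conjg G c u \<in> K \<one>" if "c \<in> \<rho> ` A" "u \<in> K \<one>" for c u using that A(2) W_conj_K by auto
    show "\<rho> b \<in> \<rho> ` A" using b by blast
  qed (use w in auto)
qed

text \<open>The tool that bounds \<open>W\<close>: a subgroup A of this kind that is not in the core
  cannot lie in \<open>W\<close>.\<close>

lemma prime_normal_if_in_W:
  assumes A: "A \<lhd> R" "A \<subseteq> W" "card A = s" "Factorial_Ring.prime s" "\<not> s dvd p - 1" and V: "\<not> V \<subseteq> Rh"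
  shows "\<rho> ` A \<lhd> G"
  by (rule \<rho>_normal_if_commutes[OF A(1) V_normal V]) (rule prime_centralizes_V[OF A])

end

subsection \<open>Coordinates on the product of a cyclic and a dihedral group\<close>

text \<open>A is a normal Sylow s-subgroup, hence the only subgroup of order s.\<close>

lemma (in group) normal_prime_subset:
  assumes fin: "finite (carrier G)" and A: "A \<lhd> G" "card A = s" "Factorial_Ring.prime s" "\<not> s * s dvd card (carrier G)"
    and W: "subgroup W G" "s dvd card W"
  shows "A \<subseteq> W"
proof -
  have As: "subgroup A G" using A(1) by (rule normal_imp_subgroup)
  obtain P where P: "subgroup P G" "P \<subseteq> W" "card P = s"
    using prime_subgroup_exists[OF fin W(1) A(3) W(2)] by blast
  obtain k where k: "card (carrier G) = card A * k"
    using card_subgroup_dvd[OF As subgroup_self subgroup.subset[OF As]] by (rule dvdE)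
  have "\<not> s dvd k" using k A(2,4) by auto
  then obtain g where g: "g \<in> carrier G" "conjg G g ` P \<subseteq> A"
    using p_subgroup_conj_into[OF fin subgroup_self P(1) subgroup.subset[OF P(1)] _ A(3) As subgroup.subset[OF As] k, of 1] P(3) by auto
  have Pc: "P \<subseteq> carrier G" using P(1) subgroup.subset by blast
  have "P \<subseteq> A"
  proof
    fix x assume x: "x \<in> P"
    then have "conjg G (inv g) (conjg G g x) \<in> A" using g A(1) by (auto simp: normal_iff_conjg)
    then show "x \<in> A" using g(1) x Pc by auto
  qed
  moreover have "finite A" using fin subgroup.subset[OF As] finite_subset by blast
  ultimately have "P = A" using card_subset_eq[of A P] P(3) A(2) by simp
  then show ?thesis using P(2) by simp
qed

lemma (in group) prime_subgroup_eq:
  assumes fin: "finite (carrier G)" and A: "subgroup A G" "Factorial_Ring.prime (card A)" and K: "subgroup K G" and x: "x \<in> A" "x \<in> K" "x \<noteq> \<one>"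
  shows "A \<subseteq> K"
proof -
  have AK: "subgroup (A \<inter> K) G" using A(1) K subgroups_Inter_pair by blast
  have "A \<inter> K = A"
    by (rule prime_index_subgroup[OF fin triv_subgroup AK A(1) _ _ _ A(2)])
      (use x subgroup.one_closed[OF AK] in auto)
  then show ?thesis by blast
qed

lemma (in group) prime_subgroup_comm:
  assumes fin: "finite (carrier G)" and A: "subgroup A G" "Factorial_Ring.prime (card A)" and x: "x \<in> A" "y \<in> A"
  shows "x \<otimes> y = y \<otimes> x"
proof -
  have Ac: "A \<subseteq> carrier G" using A(1) subgroup.subset by blast
  obtain z where z: "z \<in> A" "z \<noteq> \<one>" "\<And>v. v \<in> A \<Longrightarrow> v \<otimes> z = z \<otimes> v"
    using p_group_center[OF A(1) _ _ A(2), of 1] finite_subset[OF Ac fin] by auto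
  have "A \<subseteq> set_centralizer G A"
    by (rule prime_subgroup_eq[OF fin A set_centralizer_subgroup[OF Ac] z(1) _ z(2)])
      (use z Ac in \<open>auto simp: set_centralizer_def\<close>)
  then show ?thesis using x by (auto simp: set_centralizer_def)
qed

lemma (in group) prime_subgroup_powers:
  assumes fin: "finite (carrier G)" and A: "subgroup A G" "Factorial_Ring.prime (card A)" and c: "c \<in> A" "c \<noteq> \<one>"
  shows "A = range (\<lambda>k::nat. c [^] k)"
proof
  have cc: "c \<in> carrier G" using A(1) c(1) by (rule subgroup.mem_carrier)
  have "ord c \<noteq> 0" using ord_ge_1[OF fin cc] by simp
  then have gen: "generate G {c} = range (\<lambda>k::nat. c [^] k)"
    using generate_pow_nat[OF cc] by auto
  have "subgroup (generate G {c}) G" using cc by (intro generate_is_subgroup) auto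
  moreover have "c \<in> generate G {c}" by (rule generate.incl) simp
  ultimately show "A \<subseteq> range (\<lambda>k::nat. c [^] k)"
    using prime_subgroup_eq[OF fin A _ c(1) _ c(2)] gen by auto
  have "c [^] k \<in> A" for k :: nat
    by (induction k) (use c A(1) in \<open>auto simp: subgroup.m_closed subgroup.one_closed\<close>)
  then show "range (\<lambda>k::nat. c [^] k) \<subseteq> A" by auto
qed

lemma (in group) pow_coprime_eq_one:
  fixes m n :: nat
  assumes "x \<in> carrier G" "x [^] m = \<one>" "x [^] n = \<one>" "coprime m n"
  shows "x = \<one>"
proof -
  have "ord x dvd m" "ord x dvd n" using assms pow_eq_id by auto
  then have "ord x = 1" using assms(4) coprime_common_divisor_nat by blast
  then show ?thesis using pow_ord_eq_1[OF assms(1)] assms(1) by simp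
qed

text \<open>For primes r > 5 the set {0, 1, 3} is a counterexample.\<close>

lemma reflection_symmetric:
  fixes P :: "int \<Rightarrow> bool"
  assumes "r \<in> {3, 5 :: nat}"
  shows "\<exists>c. 0 \<le> c \<and> c < int r \<and> (\<forall>j\<in>{0..<int r}. P j = P ((2 * c - j) mod int r))"
proof -
  have *: "{0..<5::int} = {0, 1, 2, 3, 4}" "{0..<3::int} = {0, 1, 2}" by auto
  show ?thesis
  proof (cases "r = 3")
    case True
    \<comment> \<open>Exhaustion over the subsets of Z/r, given by the truth values of P.\<close>
    have "\<exists>c\<in>{0..<3}. \<forall>j\<in>{0..<3::int}. P j = P ((2 * c - j) mod 3)"
      unfolding * by (cases "P 0"; cases "P 1"; cases "P 2"; simp)
    then show ?thesis unfolding True of_nat_numeral by (meson atLeastLessThan_iff)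
  next
    case False
    then have r5: "r = 5" using assms by simp
    have "\<exists>c\<in>{0..<5}. \<forall>j\<in>{0..<5::int}. P j = P ((2 * c - j) mod 5)"
      unfolding * by (cases "P 0"; cases "P 1"; cases "P 2"; cases "P 3"; cases "P 4"; simp)
    then show ?thesis unfolding r5 of_nat_numeral by (meson atLeastLessThan_iff)
  qed
qed

text \<open>Coordinates of C_q \<times> D_2r on an abstract group: \<alpha> is the exponent in C_q,
  \<beta> the rotation exponent in D_2r, and \<tau> tells whether the dihedral part is a
  reflection.\<close>

locale dihedral_coords = group R for R (structure) +
  fixes q r :: nat and \<alpha> \<beta> :: "'a \<Rightarrow> int" and \<tau> :: "'a \<Rightarrow> bool"
  assumes q_prime: "Factorial_Ring.prime q" and q_odd: "odd q" and r_cases: "r \<in> {3, 5}" and q_ne_r: "q \<noteq> r"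
    and \<alpha>_range: "x \<in> carrier R \<Longrightarrow> 0 \<le> \<alpha> x \<and> \<alpha> x < int q"
    and \<beta>_range: "x \<in> carrier R \<Longrightarrow> 0 \<le> \<beta> x \<and> \<beta> x < int r"
    and \<alpha>_mult: "x \<in> carrier R \<Longrightarrow> y \<in> carrier R \<Longrightarrow> \<alpha> (x \<otimes> y) = (\<alpha> x + \<alpha> y) mod int q"
    and \<beta>_mult: "x \<in> carrier R \<Longrightarrow> y \<in> carrier R \<Longrightarrow> \<beta> (x \<otimes> y) = (\<beta> x + (if \<tau> x then - \<beta> y else \<beta> y)) mod int r"
    and \<tau>_mult: "x \<in> carrier R \<Longrightarrow> y \<in> carrier R \<Longrightarrow> \<tau> (x \<otimes> y) \<longleftrightarrow> \<tau> x \<noteq> \<tau> y"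
    and coords_eq: "x \<in> carrier R \<Longrightarrow> y \<in> carrier R \<Longrightarrow> \<alpha> x = \<alpha> y \<Longrightarrow> \<beta> x = \<beta> y \<Longrightarrow> \<tau> x = \<tau> y \<Longrightarrow> x = y"
    and coords_ex: "0 \<le> i \<Longrightarrow> i < int q \<Longrightarrow> 0 \<le> j \<Longrightarrow> j < int r \<Longrightarrow> \<exists>x\<in>carrier R. \<alpha> x = i \<and> \<beta> x = j \<and> \<tau> x = k"
begin

lemma r_prime: "Factorial_Ring.prime r"
  using r_cases by auto

lemma q_pos: "int q > 0" and r_pos: "int r > 0"
  using q_prime r_prime prime_gt_0_nat by auto

text \<open>r - 1 is 2 or 4, and q is an odd prime. Used when V has orbits of length r, to keep C_q
  out of \<open>W\<close>.\<close>

lemma q_ndvd: "\<not> q dvd r - 1"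
proof
  assume "q dvd r - 1"
  then have "q \<le> r - 1" using r_cases by (intro dvd_imp_le) auto
  then have "q \<le> 4" using r_cases by auto
  then have "q = 0 \<or> q = 1 \<or> q = 2 \<or> q = 3 \<or> q = 4" by auto
  then show False using \<open>q dvd r - 1\<close> q_prime q_odd r_cases q_ne_r by auto
qed

lemma \<alpha>_mod [simp]: "x \<in> carrier R \<Longrightarrow> \<alpha> x mod int q = \<alpha> x"
  using \<alpha>_range by simp

lemma \<beta>_mod [simp]: "x \<in> carrier R \<Longrightarrow> \<beta> x mod int r = \<beta> x"
  using \<beta>_range by simp

lemma coords_one [simp]: "\<alpha> \<one> = 0" "\<beta> \<one> = 0" "\<not> \<tau> \<one>"
proof -
  have t: "\<not> \<tau> \<one>" using \<tau>_mult[of \<one> \<one>] by simp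
  obtain x where x: "x \<in> carrier R" "\<alpha> x = 0" "\<beta> x = 0" "\<tau> x = False"
    using coords_ex[of 0 0 False] q_pos r_pos by auto
  show "\<alpha> \<one> = 0" using \<alpha>_mult[of x \<one>] x by simp
  show "\<beta> \<one> = 0" using \<beta>_mult[of x \<one>] x by simp
  show "\<not> \<tau> \<one>" by fact
qed

lemma coords_inv:
  assumes x: "x \<in> carrier R"
  shows "\<alpha> (inv x) = (- \<alpha> x) mod int q" "\<beta> (inv x) = (if \<tau> x then \<beta> x else (- \<beta> x) mod int r)" "\<tau> (inv x) = \<tau> x"
proof -
  have c: "inv x \<in> carrier R" using x by simp
  have a: "(\<alpha> x + \<alpha> (inv x)) mod int q = 0"
    using \<alpha>_mult[OF x c] x by simp
  show "\<alpha> (inv x) = (- \<alpha> x) mod int q"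
    by (metis a add_0 add_diff_cancel_left' \<alpha>_mod c diff_0 mod_0 mod_diff_left_eq)
  show t: "\<tau> (inv x) = \<tau> x" using \<tau>_mult[OF x c] x by simp
  have b: "(\<beta> x + (if \<tau> x then - \<beta> (inv x) else \<beta> (inv x))) mod int r = 0"
    using \<beta>_mult[OF x c] x by simp
  show "\<beta> (inv x) = (if \<tau> x then \<beta> x else (- \<beta> x) mod int r)"
  proof (cases "\<tau> x")
    case True
    then have "(\<beta> x - \<beta> (inv x)) mod int r = 0" using b by simp
    then have "\<beta> x mod int r = \<beta> (inv x) mod int r" by (simp add: mod_eq_dvd_iff mod_0_imp_dvd)
    then show ?thesis using True x c by simp
  next
    case False
    then have "(\<beta> x + \<beta> (inv x)) mod int r = 0" using b by simp
    then have "\<beta> (inv x) = (- \<beta> x) mod int r"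
      by (metis add_0 add_diff_cancel_left' \<beta>_mod c diff_0 mod_0 mod_diff_left_eq)
    then show ?thesis using False by simp
  qed
qed

lemma coords_conjg:
  assumes x: "x \<in> carrier R" and y: "y \<in> carrier R"
  shows "\<alpha> (conjg R x y) = \<alpha> y" "\<tau> (conjg R x y) = \<tau> y"
    "\<beta> (conjg R x y) = ((if \<tau> x then - \<beta> y else \<beta> y) + (if \<tau> y then 2 * \<beta> x else 0)) mod int r"
proof -
  have xy: "x \<otimes> y \<in> carrier R" "inv x \<in> carrier R" using x y by auto
  have "\<alpha> (conjg R x y) = (\<alpha> x + \<alpha> y - \<alpha> x) mod int q"
    using \<alpha>_mult[OF xy] \<alpha>_mult[OF x y] coords_inv[OF x] unfolding conjg_def
    by (simp only: mod_add_left_eq mod_add_right_eq add_uminus_conv_diff[symmetric])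
  then show "\<alpha> (conjg R x y) = \<alpha> y" using y by simp
  show "\<tau> (conjg R x y) = \<tau> y"
    using \<tau>_mult[OF xy] \<tau>_mult[OF x y] coords_inv[OF x] unfolding conjg_def by auto
  show "\<beta> (conjg R x y) = ((if \<tau> x then - \<beta> y else \<beta> y) + (if \<tau> y then 2 * \<beta> x else 0)) mod int r"
    by (cases "\<tau> x"; cases "\<tau> y";
        simp add: conjg_def \<beta>_mult[OF xy] \<beta>_mult[OF x y] coords_inv[OF x] \<tau>_mult[OF x y] mod_simps y;
        simp add: algebra_simps)
qed

lemma \<alpha>_pow: "x \<in> carrier R \<Longrightarrow> \<alpha> (x [^] (n::nat)) = (int n * \<alpha> x) mod int q"
proof (induction n)
  case (Suc n)
  then have "\<alpha> (x [^] Suc n) = (int n * \<alpha> x + \<alpha> x) mod int q" by (simp add: \<alpha>_mult mod_add_left_eq)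
  then show ?case by (simp only: of_nat_Suc distrib_right mult_1_left add.commute)
qed simp

lemma rotation_pow: "x \<in> carrier R \<Longrightarrow> \<not> \<tau> x \<Longrightarrow> \<not> \<tau> (x [^] (n::nat)) \<and> \<beta> (x [^] n) = (int n * \<beta> x) mod int r"
proof (induction n)
  case (Suc n)
  then have "\<beta> (x [^] Suc n) = (int n * \<beta> x + \<beta> x) mod int r" "\<not> \<tau> (x [^] Suc n)"
    by (simp_all add: \<beta>_mult \<tau>_mult mod_add_left_eq)
  then show ?case by (simp only: of_nat_Suc distrib_right mult_1_left add.commute simp_thms)
qed simp

lemma reflection_square:
  assumes "x \<in> carrier R" "\<tau> x"
  shows "\<beta> (x \<otimes> x) = 0" "\<not> \<tau> (x \<otimes> x)"
  using assms by (auto simp: \<beta>_mult \<tau>_mult)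

section \<open>Normal subgroups of the product of C_q and D_2r\<close>

text \<open>These four sets are the factor C_q, the rotation subgroup C_r of the dihedral factor,
  the dihedral factor itself, and the cyclic subgroup of order q r and index two. Apart from the
  trivial group and R there are no other normal subgroups, see \<open>normal_cases\<close>.\<close>

definition "A = {x \<in> carrier R. \<beta> x = 0 \<and> \<not> \<tau> x}"
definition "B = {x \<in> carrier R. \<alpha> x = 0 \<and> \<not> \<tau> x}"
definition "D = {x \<in> carrier R. \<alpha> x = 0}"
definition "AB = {x \<in> carrier R. \<not> \<tau> x}"

lemmas part_defs = A_def B_def D_def AB_def

lemma parts_normal: "A \<lhd> R" "B \<lhd> R" "D \<lhd> R" "AB \<lhd> R"
proof -
  have ne: "A \<noteq> {}" "B \<noteq> {}" "D \<noteq> {}" "AB \<noteq> {}"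
    using one_closed coords_one unfolding part_defs by blast+
  have "subgroup A R" by (rule subgroupI) (use ne in \<open>auto simp: part_defs coords_inv \<beta>_mult \<tau>_mult\<close>)
  moreover have "subgroup B R" by (rule subgroupI) (use ne in \<open>auto simp: part_defs coords_inv \<alpha>_mult \<tau>_mult\<close>)
  moreover have "subgroup D R" by (rule subgroupI) (use ne in \<open>auto simp: part_defs coords_inv \<alpha>_mult\<close>)
  moreover have "subgroup AB R" by (rule subgroupI) (use ne in \<open>auto simp: part_defs coords_inv \<tau>_mult\<close>)
  ultimately show "A \<lhd> R" "B \<lhd> R" "D \<lhd> R" "AB \<lhd> R"
    by (auto simp: normal_iff_conjg part_defs coords_conjg)
qed

lemmas parts_subgroup = parts_normal[THEN normal_imp_subgroup]

lemma parts_carrier: "x \<in> A \<Longrightarrow> x \<in> carrier R" "x \<in> B \<Longrightarrow> x \<in> carrier R" "x \<in> D \<Longrightarrow> x \<in> carrier R" "x \<in> AB \<Longrightarrow> x \<in> carrier R"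
  by (auto simp: part_defs)

lemma card_coords:
  "card {x \<in> carrier R. \<alpha> x \<in> I \<and> \<beta> x \<in> J \<and> \<tau> x \<in> T} = card I * card J * card T"
  if I: "I \<subseteq> {0..<int q}" and J: "J \<subseteq> {0..<int r}"
proof -
  have "bij_betw (\<lambda>x. (\<alpha> x, \<beta> x, \<tau> x)) {x \<in> carrier R. \<alpha> x \<in> I \<and> \<beta> x \<in> J \<and> \<tau> x \<in> T} (I \<times> J \<times> T)"
    unfolding bij_betw_def
  proof
    show "inj_on (\<lambda>x. (\<alpha> x, \<beta> x, \<tau> x)) {x \<in> carrier R. \<alpha> x \<in> I \<and> \<beta> x \<in> J \<and> \<tau> x \<in> T}"
      by (rule inj_onI) (auto intro: coords_eq)
    have "z \<in> (\<lambda>x. (\<alpha> x, \<beta> x, \<tau> x)) ` {x \<in> carrier R. \<alpha> x \<in> I \<and> \<beta> x \<in> J \<and> \<tau> x \<in> T}"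
      if z: "z \<in> I \<times> J \<times> T" for z
    proof -
      obtain i j k where ijk: "z = (i, j, k)" "i \<in> I" "j \<in> J" "k \<in> T" using z by auto
      obtain x where "x \<in> carrier R" "\<alpha> x = i" "\<beta> x = j" "\<tau> x = k"
        using coords_ex[of i j k] I J ijk by (auto simp: subset_eq)
      then show ?thesis using ijk by (intro image_eqI[where x = x]) auto
    qed
    then show "(\<lambda>x. (\<alpha> x, \<beta> x, \<tau> x)) ` {x \<in> carrier R. \<alpha> x \<in> I \<and> \<beta> x \<in> J \<and> \<tau> x \<in> T} = I \<times> J \<times> T"
      by auto
  qed
  then show ?thesis by (simp add: bij_betw_same_card card_cartesian_product)
qed

lemma card_parts: "card A = q" "card B = r" "card D = 2 * r" "card AB = q * r" "card (carrier R) = 2 * q * r"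
proof -
  have "A = {x \<in> carrier R. \<alpha> x \<in> {0..<int q} \<and> \<beta> x \<in> {0} \<and> \<tau> x \<in> {False}}"
    using \<alpha>_range by (auto simp: part_defs)
  then show "card A = q" using card_coords[of "{0..<int q}" "{0}" "{False}"] r_pos by simp
  have "B = {x \<in> carrier R. \<alpha> x \<in> {0} \<and> \<beta> x \<in> {0..<int r} \<and> \<tau> x \<in> {False}}"
    using \<beta>_range by (auto simp: part_defs)
  then show "card B = r" using card_coords[of "{0}" "{0..<int r}" "{False}"] q_pos by simp
  have "D = {x \<in> carrier R. \<alpha> x \<in> {0} \<and> \<beta> x \<in> {0..<int r} \<and> \<tau> x \<in> UNIV}"
    using \<beta>_range by (auto simp: part_defs)
  then show "card D = 2 * r" using card_coords[of "{0}" "{0..<int r}" UNIV] q_pos by simp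
  have "AB = {x \<in> carrier R. \<alpha> x \<in> {0..<int q} \<and> \<beta> x \<in> {0..<int r} \<and> \<tau> x \<in> {False}}"
    using \<alpha>_range \<beta>_range by (auto simp: part_defs)
  then show "card AB = q * r" using card_coords[of "{0..<int q}" "{0..<int r}" "{False}"] by simp
  have "carrier R = {x \<in> carrier R. \<alpha> x \<in> {0..<int q} \<and> \<beta> x \<in> {0..<int r} \<and> \<tau> x \<in> UNIV}"
    using \<alpha>_range \<beta>_range by auto
  then have "card (carrier R) = card {0..<int q} * card {0..<int r} * card (UNIV :: bool set)"
    using card_coords[of "{0..<int q}" "{0..<int r}" UNIV] by (metis (no_types, lifting) order_refl)
  then show "card (carrier R) = 2 * q * r" by simp
qed

lemma fin_R: "finite (carrier R)"
  by (rule card_ge_0_finite) (use q_pos r_pos card_parts(5) in simp)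

lemma r_ndvd_2: "\<not> r dvd 2" and q_ndvd_2: "\<not> q dvd 2"
  using r_cases q_odd primes_dvd_imp_eq[OF q_prime two_is_prime_nat] by auto

lemma sq_ndvd: "\<not> q * q dvd card (carrier R)" "\<not> r * r dvd card (carrier R)"
proof -
  have "\<not> q dvd r" "\<not> r dvd q" using q_prime r_prime q_ne_r primes_dvd_imp_eq by blast+
  then have "\<not> q dvd 2 * r" "\<not> r dvd 2 * q"
    using q_ndvd_2 r_ndvd_2 q_prime r_prime by (simp_all add: prime_dvd_mult_iff)
  moreover have "card (carrier R) = q * (2 * r)" "card (carrier R) = r * (2 * q)" using card_parts(5) by auto
  ultimately show "\<not> q * q dvd card (carrier R)" "\<not> r * r dvd card (carrier R)"
    using q_pos r_pos by (metis nat_mult_dvd_cancel1 of_nat_0_less_iff)+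
qed

lemma A_central: "x \<in> A \<Longrightarrow> y \<in> carrier R \<Longrightarrow> x \<otimes> y = y \<otimes> x"
  by (rule coords_eq) (simp_all add: A_def \<alpha>_mult \<beta>_mult \<tau>_mult add.commute)

lemma AB_comm: "x \<in> AB \<Longrightarrow> y \<in> AB \<Longrightarrow> x \<otimes> y = y \<otimes> x"
  by (rule coords_eq) (simp_all add: AB_def \<alpha>_mult \<beta>_mult \<tau>_mult add.commute)

lemma B_comm: "x \<in> B \<Longrightarrow> y \<in> B \<Longrightarrow> x \<otimes> y = y \<otimes> x"
  using AB_comm by (auto simp: part_defs)

text \<open>\<alpha> and \<tau> are homomorphisms to abelian groups, and \<open>B\<close> is their
  common kernel.\<close>

lemma commutator_B:
  assumes "x \<in> carrier R" "y \<in> carrier R"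
  shows "conjg R x y \<otimes> inv y \<in> B"
proof -
  have c: "conjg R x y \<in> carrier R" "inv y \<in> carrier R" using assms by auto
  have "\<alpha> (conjg R x y \<otimes> inv y) = 0"
    using \<alpha>_mult[OF c] coords_conjg[OF assms] coords_inv[OF assms(2)] by (simp add: mod_simps)
  moreover have "\<not> \<tau> (conjg R x y \<otimes> inv y)"
    using \<tau>_mult[OF c] coords_conjg[OF assms] coords_inv[OF assms(2)] by simp
  ultimately show ?thesis using c by (simp add: B_def)
qed

lemma dvd_double:
  assumes "(2 * b) mod int r = 0" "0 \<le> b" "b < int r"
  shows "b = 0"
proof -
  have "int r dvd 2 * b" using assms(1) by (rule mod_0_imp_dvd)
  moreover have "Factorial_Ring.prime (int r)" using r_prime by simp
  ultimately have "int r dvd 2 \<or> int r dvd b" by (simp add: prime_dvd_mult_iff)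
  moreover have "\<not> int r dvd 2" using r_ndvd_2 by (metis int_dvd_int_iff of_nat_numeral)
  ultimately show ?thesis using assms(2,3) by (metis zdvd_not_zless order_le_imp_less_or_eq)
qed

text \<open>r is odd, so negation on Z/r fixes only 0.\<close>

lemma neg_eq_self: "x \<in> carrier R \<Longrightarrow> (- \<beta> x) mod int r = \<beta> x \<Longrightarrow> \<beta> x = 0"
proof -
  assume x: "x \<in> carrier R" and e: "(- \<beta> x) mod int r = \<beta> x"
  have "(- \<beta> x) mod int r = \<beta> x mod int r" using e x by simp
  then have "int r dvd - \<beta> x - \<beta> x" by (simp add: mod_eq_dvd_iff)
  then have "int r dvd 2 * \<beta> x" by (simp add: dvd_def) (metis minus_mult_right minus_minus minus_add_distrib mult_2 diff_conv_add_uminus)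
  then have "(2 * \<beta> x) mod int r = 0" by (rule dvd_imp_mod_0)
  then show "\<beta> x = 0" by (rule dvd_double) (use \<beta>_range[OF x] in blast)+
qed

lemma reflection_ex: "0 \<le> c \<Longrightarrow> c < int r \<Longrightarrow> \<exists>t\<in>D. \<beta> t = c \<and> \<tau> t"
  using coords_ex[of 0 c True] q_pos by (auto simp: D_def)

lemma rotation_ex: "0 \<le> c \<Longrightarrow> c < int r \<Longrightarrow> \<exists>t\<in>B. \<beta> t = c"
  using coords_ex[of 0 c False] q_pos by (auto simp: B_def)

text \<open>Reflections invert rotations, and r is odd, so the dihedral factor has trivial
  centre.\<close>

lemma noncentral_D:
  assumes x: "x \<in> D" "x \<noteq> \<one>"
  shows "\<exists>y\<in>carrier R. x \<otimes> y \<noteq> y \<otimes> x"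
proof -
  have xc: "x \<in> carrier R" "\<alpha> x = 0" using x by (auto simp: D_def)
  show ?thesis
  proof (cases "\<tau> x")
    case False
    then have ne: "\<beta> x \<noteq> 0" using x coords_eq[OF xc(1) one_closed] xc by auto
    obtain t where t: "t \<in> D" "\<tau> t" using reflection_ex[of 0] r_pos by auto
    have tc: "t \<in> carrier R" using t parts_carrier by blast
    have "conjg R t x \<noteq> x" using coords_conjg(3)[OF tc xc(1)] t False ne neg_eq_self[OF xc(1)] by auto
    then show ?thesis using conjg_eq_iff[OF tc xc(1)] tc by metis
  next
    case True
    obtain y where y: "y \<in> B" "\<beta> y = 1" using rotation_ex[of 1] r_cases by auto
    have yc: "y \<in> carrier R" "\<not> \<tau> y" using y by (auto simp: B_def)
    have "(- 1) mod int r \<noteq> 1" using r_cases by auto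
    then have "conjg R x y \<noteq> y" using coords_conjg(3)[OF xc(1) yc(1)] True y yc by auto
    then show ?thesis using conjg_eq_iff[OF xc(1) yc(1)] yc by metis
  qed
qed

lemma B_generator:
  assumes K: "subgroup K R" and x: "x \<in> K" "\<alpha> x = 0" "\<not> \<tau> x" "\<beta> x \<noteq> 0"
  shows "B \<subseteq> K"
proof (rule prime_subgroup_eq[OF fin_R parts_subgroup(2) _ K _ x(1)])
  show "x \<in> B" using x subgroup.mem_carrier[OF K] by (auto simp: B_def)
  show "x \<noteq> \<one>" using x by auto
qed (simp add: card_parts r_prime)

lemma A_generator:
  assumes K: "subgroup K R" and x: "x \<in> K" "\<beta> x = 0" "\<not> \<tau> x" "\<alpha> x \<noteq> 0"
  shows "A \<subseteq> K"
proof (rule prime_subgroup_eq[OF fin_R parts_subgroup(1) _ K _ x(1)])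
  show "x \<in> A" using x subgroup.mem_carrier[OF K] by (auto simp: A_def)
  show "x \<noteq> \<one>" using x by auto
qed (simp add: card_parts q_prime)

lemma centralizer_B:
  assumes x: "x \<in> carrier R" and comm: "\<And>b. b \<in> B \<Longrightarrow> x \<otimes> b = b \<otimes> x"
  shows "x \<in> AB"
proof (rule ccontr)
  assume "x \<notin> AB"
  then have t: "\<tau> x" using x by (auto simp: AB_def)
  obtain y where y: "y \<in> B" "\<beta> y = 1" using rotation_ex[of 1] r_cases by auto
  have yc: "y \<in> carrier R" "\<not> \<tau> y" using y by (auto simp: B_def)
  have "(- 1) mod int r \<noteq> 1" using r_cases by auto
  then have "conjg R x y \<noteq> y" using coords_conjg(3)[OF x yc(1)] t y yc by auto
  then show False using conjg_eq_iff[OF x yc(1)] comm y by metis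
qed

lemma centralizer_D:
  assumes x: "x \<in> carrier R" and comm: "\<And>b. b \<in> D \<Longrightarrow> x \<otimes> b = b \<otimes> x"
  shows "x \<in> A"
proof -
  have t: "\<not> \<tau> x" using centralizer_B[OF x] comm by (auto simp: part_defs)
  obtain y where y: "y \<in> D" "\<tau> y" using reflection_ex[of 0] r_pos by auto
  have yc: "y \<in> carrier R" using y parts_carrier by blast
  have "conjg R y x = x" using comm[OF y(1)] conjg_eq_iff[OF yc x] by simp
  then have "(- \<beta> x) mod int r = \<beta> x" using coords_conjg(3)[OF yc x] t y by simp
  then show ?thesis using neg_eq_self[OF x] x t by (simp add: A_def)
qed

lemma pow_q_dvd: "x \<in> carrier R \<Longrightarrow> (int n * \<alpha> x) mod int q = 0 \<Longrightarrow> coprime n q \<Longrightarrow> \<alpha> x = 0"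
proof -
  assume x: "x \<in> carrier R" and e: "(int n * \<alpha> x) mod int q = 0" and c: "coprime n q"
  have "int q dvd int n * \<alpha> x" using e by (rule mod_0_imp_dvd)
  moreover have "coprime (int q) (int n)" using c by (simp add: coprime_commute)
  ultimately have "int q dvd \<alpha> x" by (simp add: coprime_dvd_mult_right_iff)
  then show "\<alpha> x = 0" using \<alpha>_range[OF x] by (metis zdvd_not_zless order_le_imp_less_or_eq)
qed

lemma pow_r_dvd: "x \<in> carrier R \<Longrightarrow> (int n * \<beta> x) mod int r = 0 \<Longrightarrow> coprime n r \<Longrightarrow> \<beta> x = 0"
proof -
  assume x: "x \<in> carrier R" and e: "(int n * \<beta> x) mod int r = 0" and c: "coprime n r"
  have "int r dvd int n * \<beta> x" using e by (rule mod_0_imp_dvd)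
  moreover have "coprime (int r) (int n)" using c by (simp add: coprime_commute)
  ultimately have "int r dvd \<beta> x" by (simp add: coprime_dvd_mult_right_iff)
  then show "\<beta> x = 0" using \<beta>_range[OF x] by (metis zdvd_not_zless order_le_imp_less_or_eq)
qed

lemma coprime_qr: "coprime q r" "coprime q 2" "coprime r 2"
  using primes_coprime[OF q_prime r_prime q_ne_r] prime_imp_coprime_nat[OF q_prime q_ndvd_2]
    prime_imp_coprime_nat[OF r_prime r_ndvd_2] by auto

lemma normal_without_B:
  assumes K: "K \<lhd> R" "\<not> B \<subseteq> K"
  shows "K \<subseteq> A"
proof
  have Ks: "subgroup K R" using K(1) by (rule normal_imp_subgroup)
  fix x assume x: "x \<in> K"
  have xc: "x \<in> carrier R" using Ks x by (rule subgroup.mem_carrier)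
  have t: "\<not> \<tau> x"
  proof
    assume t: "\<tau> x"
    obtain y where y: "y \<in> B" "\<beta> y = 1" using rotation_ex[of 1] r_cases by auto
    have yc: "y \<in> carrier R" "\<not> \<tau> y" using y by (auto simp: B_def)
    \<comment> \<open>The commutator of the rotation y with the reflection x is the rotation with
      exponent 2, which generates \<open>B\<close>.\<close>
    let ?z = "conjg R y x \<otimes> inv x"
    have z: "?z \<in> K" using K(1) Ks x yc by (simp add: normal_iff_conjg subgroup.m_closed subgroup.m_inv_closed)
    have zB: "?z \<in> B" by (rule commutator_B[OF yc(1) xc])
    have "\<beta> ?z = 2 mod int r"
      using xc yc y t by (simp add: \<beta>_mult coords_conjg coords_inv mod_simps)
    then have "\<beta> ?z \<noteq> 0" using r_cases by auto
    then show False using B_generator[OF Ks z] zB K(2) by (auto simp: B_def)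
  qed
  have "\<beta> x = 0"
  proof (rule ccontr)
    assume b: "\<beta> x \<noteq> 0"
    \<comment> \<open>The q-th power removes the C_q coordinate and keeps the rotation nontrivial,
      as q is prime to r.\<close>
    have z: "x [^] q \<in> K" by (induction q) (use x Ks in \<open>auto simp: subgroup.m_closed subgroup.one_closed\<close>)
    have "\<beta> (x [^] q) \<noteq> 0" using rotation_pow[OF xc t] pow_r_dvd[OF xc] b coprime_qr(1) by metis
    moreover have "\<alpha> (x [^] q) = 0" using \<alpha>_pow[OF xc] by simp
    ultimately show False using B_generator[OF Ks z] K(2) rotation_pow[OF xc t] by blast
  qed
  then show "x \<in> A" using t xc by (simp add: A_def)
qed

lemma normal_contains:
  assumes K: "K \<lhd> R" "K \<noteq> {\<one>}"
  shows "A \<subseteq> K \<or> B \<subseteq> K"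
proof (rule ccontr)
  assume n: "\<not> (A \<subseteq> K \<or> B \<subseteq> K)"
  then have KA: "K \<subseteq> A" using normal_without_B[OF K(1)] by blast
  have Ks: "subgroup K R" using K(1) by (rule normal_imp_subgroup)
  obtain x where x: "x \<in> K" "x \<noteq> \<one>" using K(2) subgroup.one_closed[OF Ks] by blast
  have xA: "x \<in> A" using KA x by blast
  have "A \<subseteq> K"
    by (rule prime_subgroup_eq[OF fin_R parts_subgroup(1) _ Ks xA x]) (simp add: card_parts q_prime)
  then show False using n by blast
qed

text \<open>Squaring x gives a non-reflection, and the r-th power then removes its rotation. What
  remains has C_q coordinate 2 r \<alpha>(x); if nonzero, it generates \<open>A\<close>.\<close>

lemma pow_2r_D:
  assumes x: "x \<in> carrier R" and K: "subgroup K R" "x \<in> K" "\<not> A \<subseteq> K"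
  shows "x \<in> D"
proof (rule ccontr)
  assume "x \<notin> D"
  then have a: "\<alpha> x \<noteq> 0" using x by (simp add: D_def)
  let ?y = "(x \<otimes> x) [^] r"
  have xx: "x \<otimes> x \<in> carrier R" "x \<otimes> x \<in> K" using x subgroup.m_closed[OF K(1,2,2)] by auto
  have t: "\<not> \<tau> (x \<otimes> x)" using \<tau>_mult[OF x x] by simp
  have y: "?y \<in> K" by (induction r) (use xx K(1) in \<open>auto simp: subgroup.m_closed subgroup.one_closed\<close>)
  have yc: "\<not> \<tau> ?y" "\<beta> ?y = 0" using rotation_pow[OF xx(1) t, of r] by auto
  have "\<alpha> ?y = (int (2 * r) * \<alpha> x) mod int q"
    using \<alpha>_pow[OF xx(1)] \<alpha>_mult[OF x x] by (simp add: mod_simps algebra_simps)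
  moreover have "coprime (2 * r) q" using coprime_qr by (simp add: coprime_commute)
  ultimately have "\<alpha> ?y \<noteq> 0" using pow_q_dvd[OF x, of "2 * r"] a by metis
  then show False using A_generator[OF K(1) y] yc K(3) by auto
qed

text \<open>Split by which of \<open>A\<close> and \<open>B\<close> lie in K. If \<open>B\<close>
  does, then K lies between \<open>B\<close> and \<open>D\<close> or between \<open>AB\<close> and
  R, and both steps have index 2.\<close>

lemma normal_cases:
  assumes K: "K \<lhd> R"
  shows "K = {\<one>} \<or> K = A \<or> K = B \<or> K = D \<or> K = AB \<or> K = carrier R"
proof -
  have Ks: "subgroup K R" using K by (rule normal_imp_subgroup)
  have Kc: "K \<subseteq> carrier R" using Ks by (rule subgroup.subset)
  show ?thesis
  proof (cases "B \<subseteq> K")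
    case False
    then have "K \<subseteq> A" by (rule normal_without_B[OF K])
    moreover have "A \<subseteq> K" if "K \<noteq> {\<one>}" using normal_contains[OF K that] False by blast
    ultimately show ?thesis by blast
  next
    case B: True
    show ?thesis
    proof (cases "A \<subseteq> K")
      case True
      have "AB \<subseteq> K"
      proof
        fix x assume x: "x \<in> AB"
        then have xc: "x \<in> carrier R" "\<not> \<tau> x" by (auto simp: AB_def)
        obtain y where y: "y \<in> B" "\<beta> y = \<beta> x" using rotation_ex[of "\<beta> x"] \<beta>_range[OF xc(1)] by auto
        have yc: "y \<in> carrier R" "\<not> \<tau> y" using y by (auto simp: B_def)
        have "x \<otimes> inv y \<in> A" using xc yc y by (simp add: A_def \<beta>_mult \<tau>_mult coords_inv mod_simps)
        then have "x \<otimes> inv y \<otimes> y \<in> K" using True B y subgroup.m_closed[OF Ks] by blast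
        then show "x \<in> K" using xc yc by (simp add: m_assoc)
      qed
      then have "K = AB \<or> K = carrier R"
        using prime_index_subgroup[OF fin_R parts_subgroup(4) Ks subgroup_self _ Kc, of 2] card_parts by auto
      then show ?thesis by blast
    next
      case False
      then have "K \<subseteq> D" using pow_2r_D[OF _ Ks] Kc by blast
      then have "K = B \<or> K = D"
        using prime_index_subgroup[OF fin_R parts_subgroup(2) Ks parts_subgroup(3) B, of 2] card_parts by auto
      then show ?thesis by blast
    qed
  qed
qed

text \<open>A non-reflection with nonzero rotation has a q-th power that generates \<open>B\<close>.
  So the non-reflections of W lie in \<open>A\<close>.\<close>

lemma rotation_if_coprime:
  assumes W: "subgroup W R" "\<not> B \<subseteq> W" and w: "w \<in> W"
  shows "\<beta> w = 0 \<or> \<tau> w"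
proof (rule ccontr)
  assume n: "\<not> (\<beta> w = 0 \<or> \<tau> w)"
  have wc: "w \<in> carrier R" using W(1) w by (rule subgroup.mem_carrier)
  have z: "w [^] q \<in> W" by (induction q) (use w W(1) in \<open>auto simp: subgroup.m_closed subgroup.one_closed\<close>)
  have "\<beta> (w [^] q) \<noteq> 0" using rotation_pow[OF wc] pow_r_dvd[OF wc] n coprime_qr(1) by metis
  moreover have "\<alpha> (w [^] q) = 0" using \<alpha>_pow[OF wc] by simp
  ultimately show False using B_generator[OF W(1) z] W(2) rotation_pow[OF wc] n by blast
qed

text \<open>The automorphism that inverts the factor C_q and fixes the dihedral factor pointwise;
  coordinates determine an element, so the description is unique.\<close>

definition \<iota> where "\<iota> x = (THE y. y \<in> carrier R \<and> \<alpha> y = (- \<alpha> x) mod int q \<and> \<beta> y = \<beta> x \<and> \<tau> y = \<tau> x)"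

lemma \<iota>:
  assumes x: "x \<in> carrier R"
  shows "\<iota> x \<in> carrier R" "\<alpha> (\<iota> x) = (- \<alpha> x) mod int q" "\<beta> (\<iota> x) = \<beta> x" "\<tau> (\<iota> x) = \<tau> x"
proof -
  obtain y where y: "y \<in> carrier R" "\<alpha> y = (- \<alpha> x) mod int q" "\<beta> y = \<beta> x" "\<tau> y = \<tau> x"
    using coords_ex[of "(- \<alpha> x) mod int q" "\<beta> x" "\<tau> x"] \<beta>_range[OF x] q_pos by auto
  have "\<iota> x = y" unfolding \<iota>_def
    by (rule the_equality) (use y in \<open>auto intro: coords_eq\<close>)
  then show "\<iota> x \<in> carrier R" "\<alpha> (\<iota> x) = (- \<alpha> x) mod int q" "\<beta> (\<iota> x) = \<beta> x" "\<tau> (\<iota> x) = \<tau> x"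
    using y by auto
qed

lemma \<iota>_iso: "\<iota> \<in> iso R R"
proof (rule isoI)
  show "\<iota> \<in> hom R R"
    by (rule homI; (rule coords_eq)?)
      (auto simp: \<iota> \<alpha>_mult \<beta>_mult \<tau>_mult mod_simps algebra_simps)
  have "\<iota> (\<iota> x) = x" if "x \<in> carrier R" for x
    by (rule coords_eq) (use that in \<open>auto simp: \<iota> mod_simps\<close>)
  then show "bij_betw \<iota> (carrier R) (carrier R)"
    by (intro bij_betwI[where g = \<iota>]) (auto simp: \<iota>)
qed

text \<open>\<beta> and \<tau> are coordinates on the quotient of R by \<open>A\<close>.\<close>

lemma A_coset_iff:
  assumes "x \<in> carrier R" "y \<in> carrier R" "\<beta> x = \<beta> y" "\<tau> x = \<tau> y"
  shows "y \<otimes> inv x \<in> A"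
  using assms by (cases "\<tau> y") (simp_all add: A_def \<beta>_mult \<tau>_mult coords_inv mod_add_right_eq)

end

subsection \<open>The core of the regular subgroup\<close>

context group
begin

lemma pow_card_subgroup:
  assumes "subgroup V G" "v \<in> V" "finite V"
  shows "v [^] card V = \<one>"
proof -
  interpret V: group "G\<lparr>carrier := V\<rparr>" using assms(1) subgroup_imp_group by blast
  have "v [^]\<^bsub>G\<lparr>carrier := V\<rparr>\<^esub> card V = \<one>"
    using V.pow_order_eq_1[of v] assms by (simp add: order_def)
  then show ?thesis by (simp add: nat_pow_consistent[symmetric])
qed

lemma core_eq: "core H G = carrier G \<inter> (\<Inter>g\<in>carrier G. conjg G g ` H)"
  by (simp add: core_def conjg_def)

lemma core_subset:
  assumes "subgroup H G"
  shows "core H G \<subseteq> H"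
proof
  fix x assume "x \<in> core H G"
  then have "x \<in> conjg G \<one> ` H" unfolding core_eq by blast
  then show "x \<in> H" using subgroup.mem_carrier[OF assms] by auto
qed

lemma core_conjg_iff:
  assumes "subgroup H G" "x \<in> carrier G"
  shows "x \<in> core H G \<longleftrightarrow> (\<forall>g\<in>carrier G. conjg G g x \<in> H)"
proof
  assume x: "x \<in> core H G"
  show "\<forall>g\<in>carrier G. conjg G g x \<in> H"
  proof
    fix g assume g: "g \<in> carrier G"
    then have "x \<in> conjg G (inv g) ` H" using x inv_closed[OF g] unfolding core_eq by blast
    then show "conjg G g x \<in> H" using g subgroup.mem_carrier[OF assms(1)] by auto
  qed
next
  assume c: "\<forall>g\<in>carrier G. conjg G g x \<in> H"
  have "x \<in> conjg G g ` H" if g: "g \<in> carrier G" for g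
    using bspec[OF c inv_closed[OF g]] assms(2) g by (auto intro!: image_eqI[where x = "conjg G (inv g) x"])
  then show "x \<in> core H G" using assms(2) by (auto simp: core_eq)
qed

lemma core_normal:
  assumes H: "subgroup H G"
  shows "core H G \<lhd> G"
  unfolding normal_iff_conjg
proof (intro conjI ballI)
  have c: "core H G \<subseteq> carrier G" by (auto simp: core_eq)
  show "subgroup (core H G) G"
  proof (rule subgroupI[OF c])
    have "\<one> \<in> core H G" using subgroup.one_closed[OF H] by (simp add: core_conjg_iff[OF H])
    then show "core H G \<noteq> {}" by blast
    show "inv a \<in> core H G" if "a \<in> core H G" for a
      using that c core_conjg_iff[OF H] subgroup.m_inv_closed[OF H] by (auto simp: conjg_of_inv subset_eq)
    show "a \<otimes> b \<in> core H G" if ab: "a \<in> core H G" "b \<in> core H G" for a b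
    proof -
      have cc: "a \<in> carrier G" "b \<in> carrier G" using ab c by auto
      then have "\<forall>g\<in>carrier G. conjg G g a \<in> H" "\<forall>g\<in>carrier G. conjg G g b \<in> H"
        using ab core_conjg_iff[OF H] by blast+
      then show ?thesis using cc subgroup.m_closed[OF H] by (simp add: core_conjg_iff[OF H] conjg_of_mult)
    qed
  qed
  show "conjg G g h \<in> core H G" if "g \<in> carrier G" "h \<in> core H G" for g h
    using that c core_conjg_iff[OF H] by (auto simp: conjg_mult[symmetric] subset_eq)
qed

lemma core_greatest:
  assumes H: "subgroup H G" and K: "K \<lhd> G" "K \<subseteq> H"
  shows "K \<subseteq> core H G"
proof
  fix x assume x: "x \<in> K"
  then have "x \<in> carrier G" using subgroup.mem_carrier[OF normal_imp_subgroup[OF K(1)]] by blast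
  then show "x \<in> core H G" using K x by (auto simp: core_conjg_iff[OF H] normal_iff_conjg)
qed

end

section \<open>Passing to the quotient by the core\<close>

text \<open>The core-free dichotomy in G/N, with the single prime-order subgroup B/N of R/N. The
  abelian alternative is pulled back to the preimage M and stated without cosets: M/N is abelian and
  its exponent divides p^n.\<close>

lemma (in maximal_subgroup_of) almost_simple_quotient_or_abelian:
  assumes N: "N \<lhd> G" "N \<subseteq> R" and max: "\<And>K. K \<lhd> G \<Longrightarrow> K \<subseteq> R \<Longrightarrow> K \<subseteq> N"
    and B: "subgroup B G" "N \<subseteq> B" "B \<subseteq> R" "\<And>x b. x \<in> R \<Longrightarrow> b \<in> B \<Longrightarrow> conjg G x b \<in> B"
    and Bc: "card B = card N * s" "Factorial_Ring.prime s" "\<not> card N * (s * s) dvd card R"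
    and contains: "\<And>K. subgroup K G \<Longrightarrow> N \<subseteq> K \<Longrightarrow> K \<subseteq> R \<Longrightarrow> (\<And>x k. x \<in> R \<Longrightarrow> k \<in> K \<Longrightarrow> conjg G x k \<in> K) \<Longrightarrow>
      K \<noteq> N \<Longrightarrow> B \<subseteq> K"
  shows "almost_simple (G Mod N) \<or> (\<exists>M p n. M \<lhd> G \<and> N \<subseteq> M \<and> M \<inter> R = N \<and> Factorial_Ring.prime p \<and> n > 0 \<and>
    card M = card N * p ^ n \<and> \<not> s dvd p ^ n \<and> (\<forall>v\<in>M. \<forall>w\<in>M. conjg G v w \<otimes> inv w \<in> N) \<and> (\<forall>v\<in>M. v [^] (p ^ n) \<in> N))"
proof -
  let ?Q = "G Mod N" and ?\<pi> = "(#>) N"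
  interpret N: normal N G by (rule N(1))
  interpret Q: group ?Q by (rule N.factorgroup_is_group)
  have hom: "group_hom G ?Q ?\<pi>"
    using N.r_coset_hom_Mod by (simp add: group_hom_def group_hom_axioms_def Q.group_axioms)
  interpret h: group_hom G ?Q ?\<pi> by (rule hom)
  have Ns: "subgroup N G" using N(1) by (rule normal_imp_subgroup)
  have fN: "finite N" using fin subgroup.subset[OF Ns] finite_subset by blast
  have Npos: "card N > 0" using Ns fin subgroup.finite_imp_card_positive by blast
  have carQ: "carrier ?Q = ?\<pi> ` carrier G" by (rule carrier_FactGroup)
  have pi_one: "?\<pi> x = \<one>\<^bsub>?Q\<^esub> \<longleftrightarrow> x \<in> N" if "x \<in> carrier G" for x
    using rcos_eq_iff[OF Ns that one_closed] that subgroup.subset[OF Ns] by simp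
  have pi_conj: "?\<pi> (conjg G g x) = conjg ?Q (?\<pi> g) (?\<pi> x)" if "g \<in> carrier G" "x \<in> carrier G" for g x
    using that by (simp add: conjg_def del: mult_FactGroup)
  have pi_mem: "?\<pi> g \<in> ?\<pi> ` H \<longleftrightarrow> g \<in> H" if H: "subgroup H G" "N \<subseteq> H" and g: "g \<in> carrier G" for H g
  proof
    assume "?\<pi> g \<in> ?\<pi> ` H"
    then obtain x where x: "x \<in> H" "?\<pi> g = ?\<pi> x" by blast
    have xc: "x \<in> carrier G" using H(1) x(1) by (rule subgroup.mem_carrier)
    have "g \<otimes> inv x \<in> H" using x(2) rcos_eq_iff[OF Ns g xc] H(2) by blast
    then have "g \<otimes> inv x \<otimes> x \<in> H" using x(1) by (rule subgroup.m_closed[OF H(1)])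
    then show "g \<in> H" using g xc by (simp add: m_assoc)
  qed blast
  define pre where "pre K = {g \<in> carrier G. ?\<pi> g \<in> K}" for K
  have pre_sub: "subgroup (pre K) G \<and> N \<subseteq> pre K \<and> ?\<pi> ` pre K = K" if K: "subgroup K ?Q" for K
  proof (intro conjI)
    show "subgroup (pre K) G"
    proof (rule subgroupI)
      have "\<one> \<in> pre K" using subgroup.one_closed[OF K] h.hom_one by (simp add: pre_def)
      then show "pre K \<noteq> {}" by blast
      show "inv a \<in> pre K" if "a \<in> pre K" for a
        using that subgroup.m_inv_closed[OF K] h.hom_inv by (simp add: pre_def)
      show "a \<otimes> b \<in> pre K" if "a \<in> pre K" "b \<in> pre K" for a b
        using that subgroup.m_closed[OF K] h.hom_mult by (simp add: pre_def del: mult_FactGroup)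
    qed (auto simp: pre_def)
    show "N \<subseteq> pre K"
    proof
      fix x assume x: "x \<in> N"
      have "x \<in> carrier G" using Ns x by (rule subgroup.mem_carrier)
      moreover from this have "?\<pi> x = \<one>\<^bsub>?Q\<^esub>" using pi_one x by blast
      ultimately show "x \<in> pre K" using subgroup.one_closed[OF K] by (simp add: pre_def del: one_FactGroup)
    qed
    show "?\<pi> ` pre K = K"
    proof
      show "K \<subseteq> ?\<pi> ` pre K"
      proof
        fix y assume y: "y \<in> K"
        then have "y \<in> ?\<pi> ` carrier G" using subgroup.subset[OF K] carQ by blast
        then show "y \<in> ?\<pi> ` pre K" using y by (auto simp: pre_def)
      qed
    qed (auto simp: pre_def)
  qed
  have pre_normal: "pre K \<lhd> G" if K: "K \<lhd> ?Q" for K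
    unfolding normal_iff_conjg
  proof (intro conjI ballI)
    show "subgroup (pre K) G" using pre_sub[OF normal_imp_subgroup[OF K]] by blast
    fix g x assume "g \<in> carrier G" "x \<in> pre K"
    then show "conjg G g x \<in> pre K" using K by (auto simp: pre_def pi_conj Q.normal_iff_conjg)
  qed
  have card_pi: "card (?\<pi> ` H) * card N = card H" if "subgroup H G" "N \<subseteq> H" for H
    by (rule lagrange_sub[OF Ns that])
  interpret Q: corefree_maximal_subgroup ?Q "?\<pi> ` R"
  proof
    show "finite (carrier ?Q)" using fin by (simp add: carQ)
    show "maximal_subgroup (?\<pi> ` R) ?Q"
      unfolding maximal_subgroup_def
    proof (intro conjI allI impI)
      show "subgroup (?\<pi> ` R) ?Q" using h.subgroup_img_is_subgroup[OF R_sub] .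
      show "?\<pi> ` R \<noteq> carrier ?Q"
      proof
        assume "?\<pi> ` R = carrier ?Q"
        then have "g \<in> R" if "g \<in> carrier G" for g using pi_mem[OF R_sub N(2) that] that carQ by blast
        then show False using R_ne subgroup.subset[OF R_sub] by blast
      qed
      fix K assume K: "subgroup K ?Q" "?\<pi> ` R \<subseteq> K"
      have "R \<subseteq> pre K" using K(2) R_carrier by (auto simp: pre_def)
      then have "pre K = R \<or> pre K = carrier G" using over_R pre_sub[OF K(1)] by blast
      then show "K = ?\<pi> ` R \<or> K = carrier ?Q" using pre_sub[OF K(1)] carQ by metis
    qed
    fix K assume K: "K \<lhd> ?Q" "K \<subseteq> ?\<pi> ` R"
    have "pre K \<subseteq> R" using K(2) pi_mem[OF R_sub N(2)] by (auto simp: pre_def)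
    then have "pre K \<subseteq> N" using max pre_normal[OF K(1)] by blast
    have "K \<subseteq> {\<one>\<^bsub>?Q\<^esub>}"
    proof
      fix k assume "k \<in> K"
      then obtain x where x: "x \<in> pre K" "k = ?\<pi> x" using pre_sub[OF normal_imp_subgroup[OF K(1)]] by blast
      moreover have "x \<in> carrier G" "x \<in> N" using x(1) \<open>pre K \<subseteq> N\<close> by (auto simp: pre_def)
      ultimately show "k \<in> {\<one>\<^bsub>?Q\<^esub>}" using pi_one by blast
    qed
    then show "K = {\<one>\<^bsub>?Q\<^esub>}" using subgroup.one_closed[OF normal_imp_subgroup[OF K(1)]] by blast
  qed
  have cB: "card (?\<pi> ` B) = s" using card_pi[OF B(1,2)] Bc(1) Npos by simp
  have fam: "subgroup A ?Q \<and> A \<subseteq> ?\<pi> ` R \<and> (\<forall>x\<in>?\<pi> ` R. \<forall>a\<in>A. conjg ?Q x a \<in> A) \<and>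
      Factorial_Ring.prime (card A) \<and> \<not> card A * card A dvd card (?\<pi> ` R)" if "A \<in> {?\<pi> ` B}" for A
  proof -
    have A: "A = ?\<pi> ` B" using that by blast
    have "conjg ?Q x a \<in> A" if xa: "x \<in> ?\<pi> ` R" "a \<in> A" for x a
    proof -
      obtain y b where "y \<in> R" "x = ?\<pi> y" "b \<in> B" "a = ?\<pi> b" using xa A by blast
      then show ?thesis using pi_conj[of y b] R_carrier B(3,4) A by (metis imageI subsetD)
    qed
    moreover have "\<not> s * s dvd card (?\<pi> ` R)"
    proof
      assume "s * s dvd card (?\<pi> ` R)"
      then have "s * s * card N dvd card R" using card_pi[OF R_sub N(2)] by (metis mult_dvd_mono dvd_refl)
      then show False using Bc(3) by (simp add: mult.commute)
    qed
    ultimately show ?thesis using A h.subgroup_img_is_subgroup[OF B(1)] B(3) cB Bc(2) by auto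
  qed
  have cont: "\<exists>A\<in>{?\<pi> ` B}. A \<subseteq> K"
    if K: "subgroup K ?Q" "K \<subseteq> ?\<pi> ` R" "\<forall>x\<in>?\<pi> ` R. \<forall>k\<in>K. conjg ?Q x k \<in> K" "K \<noteq> {\<one>\<^bsub>?Q\<^esub>}" for K
  proof -
    have p: "subgroup (pre K) G" "N \<subseteq> pre K" "?\<pi> ` pre K = K" using pre_sub[OF K(1)] by auto
    have "B \<subseteq> pre K"
    proof (rule contains[OF p(1,2)])
      show "pre K \<subseteq> R" using K(2) pi_mem[OF R_sub N(2)] by (auto simp: pre_def)
      show "conjg G x k \<in> pre K" if "x \<in> R" "k \<in> pre K" for x k
        using that K(3) R_carrier by (auto simp: pre_def pi_conj)
      have "?\<pi> ` N \<subseteq> {\<one>\<^bsub>?Q\<^esub>}" using pi_one subgroup.mem_carrier[OF Ns] by blast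
      then show "pre K \<noteq> N" using p(3) K(4) subgroup.one_closed[OF K(1)] by blast
    qed
    then show ?thesis using p(3) by blast
  qed
  have "almost_simple ?Q \<or> (\<exists>V p n. V \<lhd> ?Q \<and> V \<noteq> {\<one>\<^bsub>?Q\<^esub>} \<and> V \<inter> ?\<pi> ` R = {\<one>\<^bsub>?Q\<^esub>} \<and> Factorial_Ring.prime p \<and> n > 0 \<and>
    card V = p ^ n \<and> (\<forall>v\<in>V. \<forall>w\<in>V. v \<otimes>\<^bsub>?Q\<^esub> w = w \<otimes>\<^bsub>?Q\<^esub> v) \<and> (\<forall>A\<in>{?\<pi> ` B}. \<not> card A dvd card V))"
    by (rule Q.almost_simple_or_abelian_normal, simp, erule fam, erule cont, assumption+)
  then show ?thesis
  proof (elim disjE exE conjE)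
    fix V p n
    assume 2: "V \<lhd> ?Q" "V \<inter> ?\<pi> ` R = {\<one>\<^bsub>?Q\<^esub>}" "Factorial_Ring.prime p" "n > 0"
      "card V = p ^ n" "\<forall>v\<in>V. \<forall>w\<in>V. v \<otimes>\<^bsub>?Q\<^esub> w = w \<otimes>\<^bsub>?Q\<^esub> v" and nd: "\<forall>A\<in>{?\<pi> ` B}. \<not> card A dvd card V"
    have nd': "\<not> s dvd p ^ n" using nd cB 2(5) by simp
    have Vs: "subgroup V ?Q" using 2(1) by (rule normal_imp_subgroup)
    have M: "subgroup (pre V) G" "N \<subseteq> pre V" "?\<pi> ` pre V = V" using pre_sub[OF Vs] by auto
    have Mc: "x \<in> carrier G" if "x \<in> pre V" for x using that by (simp add: pre_def)
    have "pre V \<inter> R = N"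
    proof
      show "pre V \<inter> R \<subseteq> N"
      proof
        fix x assume x: "x \<in> pre V \<inter> R"
        then have "?\<pi> x \<in> V \<inter> ?\<pi> ` R" by (simp add: pre_def)
        then have "?\<pi> x = \<one>\<^bsub>?Q\<^esub>" unfolding 2(2) by (rule singletonD)
        then show "x \<in> N" using pi_one[OF R_carrier] x by blast
      qed
    qed (use M(2) N(2) in blast)
    moreover have "card (pre V) = card N * p ^ n" using card_pi[OF M(1,2)] M(3) 2(5) by (simp add: mult.commute)
    moreover have "conjg G v w \<otimes> inv w \<in> N" if vw: "v \<in> pre V" "w \<in> pre V" for v w
    proof -
      have c: "v \<in> carrier G" "w \<in> carrier G" using vw Mc by auto
      have "?\<pi> v \<in> V" "?\<pi> w \<in> V" using vw by (auto simp: pre_def)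
      then have "conjg ?Q (?\<pi> v) (?\<pi> w) = ?\<pi> w" using Q.conjg_eq_iff[of "?\<pi> v" "?\<pi> w"] 2(6) c h.hom_closed by blast
      then have "?\<pi> (conjg G v w) = ?\<pi> w" using pi_conj c by simp
      then show ?thesis using rcos_eq_iff[OF Ns] c by simp
    qed
    moreover have "v [^] (p ^ n) \<in> N" if v: "v \<in> pre V" for v
    proof -
      have c: "v \<in> carrier G" using v Mc by auto
      have "?\<pi> v \<in> V" using v by (auto simp: pre_def)
      moreover have "finite V" using Q.fin subgroup.subset[OF Vs] finite_subset by blast
      ultimately have "?\<pi> v [^]\<^bsub>?Q\<^esub> (p ^ n) = \<one>\<^bsub>?Q\<^esub>" using Q.pow_card_subgroup[OF Vs] 2(5) by metis
      then have "?\<pi> (v [^] (p ^ n)) = \<one>\<^bsub>?Q\<^esub>" using h.hom_nat_pow[OF c] by simp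
      then show ?thesis using pi_one c by simp
    qed
    ultimately show ?thesis using pre_normal[OF 2(1)] M(2) 2(3,4) nd' by blast
  qed simp
qed

lemma (in cayley_action) cayley_blockI:
  assumes "V \<lhd> G" "\<forall>v\<in>V. \<forall>w\<in>V. v \<otimes>\<^bsub>G\<^esub> w = w \<otimes>\<^bsub>G\<^esub> v"
    "Factorial_Ring.prime p" "card ((\<lambda>v. act v \<one>) ` V) = p"
  shows "cayley_block R G \<rho> act S V p"
  by (intro cayley_block.intro cayley_action_axioms cayley_block_axioms.intro) (use assms in blast)+

section \<open>Frobenius structure when the quotient by the core is abelian\<close>

text \<open>The core is described by its preimage N in R. A normal regular subgroup is excluded
  here, being settled by \<open>nontrivial_aut_if_regular_normal\<close>.\<close>

locale cayley_core = cayley_action +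
  fixes N
  assumes N_carrier: "N \<subseteq> carrier R" and N_normal: "\<rho> ` N \<lhd> G"
    and N_max: "D \<lhd> G \<Longrightarrow> D \<subseteq> Rh \<Longrightarrow> D \<subseteq> \<rho> ` N"
    and not_normal: "\<not> Rh \<lhd> G"
begin

lemma N_R: "N \<lhd> R"
proof -
  have "{x \<in> carrier R. \<rho> x \<in> \<rho> ` N} = N" using N_carrier \<rho>_mem_iff[OF N_carrier] by blast
  then show ?thesis using \<rho>_vimage_normal[OF N_normal] by simp
qed

lemma \<rho>N_Rh: "\<rho> ` N \<subseteq> Rh"
  using N_carrier by blast

lemma normal_le_N: "A \<subseteq> carrier R \<Longrightarrow> \<rho> ` A \<lhd> G \<Longrightarrow> A \<subseteq> N"
  using N_max[of "\<rho> ` A"] \<rho>_mem_iff[OF N_carrier] by blast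

lemma normalizer_\<rho>:
  assumes "A \<lhd> R" "\<not> A \<subseteq> N"
  shows "set_normalizer G (\<rho> ` A) = Rh"
proof (rule M.normalizer_eq_R)
  have As: "subgroup A R" using assms(1) by (rule normal_imp_subgroup)
  show "subgroup (\<rho> ` A) G" by (rule \<rho>_subgroup[OF As])
  show "\<not> \<rho> ` A \<lhd> G" using normal_le_N[OF subgroup.subset[OF As]] assms(2) by blast
qed (rule \<rho>_conj_closed[OF assms(1)])

lemma set_normalizer_Rh: "set_normalizer G Rh = Rh"
  by (rule M.normalizer_eq_R[OF M.R_sub M.conjg_R not_normal])

lemma \<rho>_pow: "x \<in> carrier R \<Longrightarrow> \<rho> (x [^] (n::nat)) = \<rho> x [^]\<^bsub>G\<^esub> n"
proof (induction n)
  case (Suc n)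
  then show ?case by (simp add: \<rho>_mult) (metis M.nat_pow_Suc M.nat_pow_Suc2 \<rho>_closed)
qed simp

text \<open>\<open>\<rho>\<close> reverses products, so the commutator in G is the image of y^-1 c
  instead of c y^-1, where c is a conjugate of y; conjugation by y^-1 inside the normal subgroup N
  passes from one to the other.\<close>

lemma Rh_commutator:
  assumes comm: "\<forall>x\<in>carrier R. \<forall>y\<in>carrier R. conjg R x y \<otimes> inv y \<in> N"
    and u: "u \<in> Rh" "d \<in> Rh"
  shows "conjg G u d \<otimes>\<^bsub>G\<^esub> inv\<^bsub>G\<^esub> d \<in> \<rho> ` N"
proof -
  obtain x y where xy: "x \<in> carrier R" "u = \<rho> x" "y \<in> carrier R" "d = \<rho> y" using u by blast
  let ?c = "conjg R (inv x) y"
  have c: "?c \<in> carrier R" using xy by simp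
  have "conjg R (inv y) (?c \<otimes> inv y) \<in> N"
    using N_R comm xy by (simp add: normal_iff_conjg)
  moreover have "conjg R (inv y) (?c \<otimes> inv y) = inv y \<otimes> ?c" using c xy by (simp add: conjg_def[of R "inv y"] m_assoc)
  moreover have "conjg G u d \<otimes>\<^bsub>G\<^esub> inv\<^bsub>G\<^esub> d = \<rho> (inv y \<otimes> ?c)"
    using xy c by (simp add: conjg_\<rho> \<rho>_mult \<rho>_inv)
  ultimately show ?thesis by simp
qed

text \<open>Let D be the intersection of the regular subgroup with its conjugate by g^-1. D contains
  the core, and the quotient by the core is abelian, so both groups normalise D. If the normaliser
  of D is only the regular subgroup, then g normalises that subgroup and lies in it; otherwise D is
  normal in G and lies in the core.\<close>

lemma frobenius_condition:
  assumes comm: "\<forall>x\<in>carrier R. \<forall>y\<in>carrier R. conjg R x y \<otimes> inv y \<in> N"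
    and g: "g \<in> carrier G" "g \<notin> Rh" and x: "x \<in> Rh" "conjg G g x \<in> Rh"
  shows "x \<in> \<rho> ` N"
proof -
  define D where "D = {x \<in> Rh. conjg G g x \<in> Rh}"
  have Rc: "x \<in> carrier G" if "x \<in> Rh" for x using that M.R_carrier by blast
  have Dc: "D \<subseteq> carrier G" using Rc by (auto simp: D_def)
  have Ns: "subgroup (\<rho> ` N) G" using N_normal by (rule normal_imp_subgroup)
  have NG: "conjg G h n \<in> \<rho> ` N" if "h \<in> carrier G" "n \<in> \<rho> ` N" for h n
    using that N_normal unfolding M.normal_iff_conjg by blast
  have D: "subgroup D G"
  proof (rule M.subgroupI[OF Dc])
    have "\<one>\<^bsub>G\<^esub> \<in> D" using subgroup.one_closed[OF M.R_sub] M.conjg_of_one[OF g(1)] unfolding D_def mem_Collect_eq by metis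
    then show "D \<noteq> {}" by blast
    show "inv\<^bsub>G\<^esub> a \<in> D" if "a \<in> D" for a
      using that Rc g(1) subgroup.m_inv_closed[OF M.R_sub] unfolding D_def mem_Collect_eq by (metis M.conjg_of_inv)
    show "a \<otimes>\<^bsub>G\<^esub> b \<in> D" if "a \<in> D" "b \<in> D" for a b
      using that Rc g(1) subgroup.m_closed[OF M.R_sub] unfolding D_def mem_Collect_eq by (metis M.conjg_of_mult)
  qed
  have ND: "\<rho> ` N \<subseteq> D" using NG[OF g(1)] \<rho>N_Rh by (auto simp: D_def)
  have fD: "finite D" using Dc M.fin finite_subset by blast
  let ?L = "set_normalizer G D"
  have L: "subgroup ?L G" by (rule M.set_normalizer_subgroup[OF Dc])
  have RL: "Rh \<subseteq> ?L"
  proof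
    fix u assume u: "u \<in> Rh"
    show "u \<in> ?L"
    proof (rule M.set_normalizerI[OF fD Dc Rc[OF u]])
      fix d assume d: "d \<in> D"
      then have dR: "d \<in> Rh" by (simp add: D_def)
      have "conjg G u d = (conjg G u d \<otimes>\<^bsub>G\<^esub> inv\<^bsub>G\<^esub> d) \<otimes>\<^bsub>G\<^esub> d" using Rc[OF u] Rc[OF dR] by (simp add: M.m_assoc)
      moreover have "conjg G u d \<otimes>\<^bsub>G\<^esub> inv\<^bsub>G\<^esub> d \<in> D" using Rh_commutator[OF comm u dR] ND by blast
      ultimately show "conjg G u d \<in> D" using d subgroup.m_closed[OF D] by metis
    qed
  qed
  \<comment> \<open>The same argument for the conjugate of the regular subgroup, carried out after
    conjugation by g.\<close>
  have RL': "conjg G (inv\<^bsub>G\<^esub> g) u \<in> ?L" if u: "u \<in> Rh" for u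
  proof (rule M.set_normalizerI[OF fD Dc])
    let ?w = "conjg G (inv\<^bsub>G\<^esub> g) u"
    show wc: "?w \<in> carrier G" using Rc[OF u] g(1) by simp
    fix d assume d: "d \<in> D"
    let ?d = "conjg G g d" and ?n = "conjg G u (conjg G g d) \<otimes>\<^bsub>G\<^esub> inv\<^bsub>G\<^esub> conjg G g d"
    have dR: "d \<in> Rh" "?d \<in> Rh" using d by (auto simp: D_def)
    have n: "?n \<in> \<rho> ` N" by (rule Rh_commutator[OF comm u dR(2)])
    have cc: "u \<in> carrier G" "d \<in> carrier G" using Rc u dR by auto
    have 1: "conjg G g (conjg G ?w d) = conjg G u ?d"
      using cc g(1) by (simp add: conjg_def M.m_assoc M.inv_mult_group)
    have "conjg G u ?d = ?n \<otimes>\<^bsub>G\<^esub> ?d" using cc g(1) by (simp add: M.m_assoc)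
    then have "conjg G (inv\<^bsub>G\<^esub> g) (conjg G g (conjg G ?w d)) = conjg G (inv\<^bsub>G\<^esub> g) (?n \<otimes>\<^bsub>G\<^esub> ?d)" using 1 by simp
    also have "\<dots> = conjg G (inv\<^bsub>G\<^esub> g) ?n \<otimes>\<^bsub>G\<^esub> d"
      using cc g(1) by (subst M.conjg_of_mult) auto
    finally have "conjg G ?w d = conjg G (inv\<^bsub>G\<^esub> g) ?n \<otimes>\<^bsub>G\<^esub> d" using cc g(1) by simp
    moreover have "conjg G (inv\<^bsub>G\<^esub> g) ?n \<in> Rh" using NG[OF _ n] g(1) \<rho>N_Rh by blast
    ultimately have "conjg G ?w d \<in> Rh" using dR(1) subgroup.m_closed[OF M.R_sub] by metis
    moreover have "conjg G u ?d \<in> Rh" using M.conjg_R u dR by blast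
    ultimately show "conjg G ?w d \<in> D" using 1 by (simp add: D_def)
  qed
  from M.over_R[OF L RL] show ?thesis
  proof
    assume "?L = Rh"
    then have "\<And>u. u \<in> Rh \<Longrightarrow> conjg G (inv\<^bsub>G\<^esub> g) u \<in> Rh" using RL' by blast
    then have "inv\<^bsub>G\<^esub> g \<in> set_normalizer G Rh"
      using g(1) M.fin finite_subset[OF subgroup.subset[OF M.R_sub]] by (intro M.set_normalizerI) auto
    then have "inv\<^bsub>G\<^esub> (inv\<^bsub>G\<^esub> g) \<in> Rh" unfolding set_normalizer_Rh by (rule subgroup.m_inv_closed[OF M.R_sub])
    then show ?thesis using g by simp
  next
    assume "?L = carrier G"
    then have "D \<lhd> G" using D by (auto simp: M.normal_iff_conjg set_normalizer_def)
    then show ?thesis using N_max[of D] x by (auto simp: D_def)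
  qed
qed

text \<open>\<open>Z\<close> is the core times the stabiliser of \<open>\<one>\<close>. By
  \<open>frobenius_kernel_unique\<close> this subgroup equals a conjugation-invariant set, so it is
  normal. The uniqueness clause later identifies \<open>Z\<close> with a centraliser, or with its
  intersection with one.\<close>

lemma frobenius_kernel:
  assumes comm: "\<forall>x\<in>carrier R. \<forall>y\<in>carrier R. conjg R x y \<otimes> inv y \<in> N"
  shows "\<exists>Z. Z \<lhd> G \<and> stab \<one> \<subseteq> Z \<and> \<rho> ` N \<subseteq> Z \<and> Z \<inter> Rh = \<rho> ` N \<and> (\<lambda>v. act v \<one>) ` Z = N \<and>
    (\<forall>D. D \<lhd> G \<longrightarrow> D \<inter> Rh = \<rho> ` N \<longrightarrow> \<not> D \<subseteq> Rh \<longrightarrow> D = Z)"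
proof -
  have Y: "subgroup (stab \<one>) G" by (rule stab_subgroup) simp
  have Ns: "subgroup (\<rho> ` N) G" using N_normal by (rule normal_imp_subgroup)
  have "\<exists>Z. (\<forall>g\<in>carrier G. \<forall>z\<in>Z. conjg G g z \<in> Z) \<and>
    (\<forall>D. subgroup D G \<longrightarrow> D \<inter> Rh = \<rho> ` N \<longrightarrow> D <#>\<^bsub>G\<^esub> Rh = carrier G \<longrightarrow> D = Z)"
    by (rule M.frobenius_kernel_unique[OF M.fin M.R_sub N_normal \<rho>N_Rh _ Y Rh_stab stab_Rh])
      (rule frobenius_condition[OF comm])
  then obtain Z where Z1: "\<forall>g\<in>carrier G. \<forall>z\<in>Z. conjg G g z \<in> Z"
    and Z2: "\<forall>D. subgroup D G \<longrightarrow> D \<inter> Rh = \<rho> ` N \<longrightarrow> D <#>\<^bsub>G\<^esub> Rh = carrier G \<longrightarrow> D = Z"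
    by (elim exE conjE)
  note Z = Z1 Z2[rule_format]
  let ?Z = "\<rho> ` N <#>\<^bsub>G\<^esub> stab \<one>"
  have Yc: "g \<in> carrier G" if "g \<in> stab \<one>" for g using that by (simp add: stab_def)
  have Zs: "subgroup ?Z G"
  proof (rule M.set_mult_subgroup[OF Y Ns])
    show "conjg G h k \<in> \<rho> ` N" if "h \<in> stab \<one>" "k \<in> \<rho> ` N" for h k
      using that N_normal Yc unfolding M.normal_iff_conjg by blast
  qed
  have YZ: "stab \<one> \<subseteq> ?Z"
  proof
    fix g assume g: "g \<in> stab \<one>"
    then have "g = \<one>\<^bsub>G\<^esub> \<otimes>\<^bsub>G\<^esub> g" using Yc by simp
    then show "g \<in> ?Z" using g subgroup.one_closed[OF Ns] unfolding set_mult_def by blast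
  qed
  have NZ: "\<rho> ` N \<subseteq> ?Z"
  proof
    fix n assume n: "n \<in> \<rho> ` N"
    then have "n = n \<otimes>\<^bsub>G\<^esub> \<one>\<^bsub>G\<^esub>" using N_carrier by auto
    then show "n \<in> ?Z" using n subgroup.one_closed[OF Y] unfolding set_mult_def by blast
  qed
  have ZR: "?Z \<inter> Rh = \<rho> ` N"
  proof
    show "?Z \<inter> Rh \<subseteq> \<rho> ` N"
    proof
      fix z assume z: "z \<in> ?Z \<inter> Rh"
      then obtain n g where ng: "n \<in> \<rho> ` N" "g \<in> stab \<one>" "z = n \<otimes>\<^bsub>G\<^esub> g" by (auto simp: set_mult_def)
      have c: "n \<in> carrier G" "g \<in> carrier G" using ng Yc N_carrier by auto
      have "g = inv\<^bsub>G\<^esub> n \<otimes>\<^bsub>G\<^esub> z" using c by (simp add: ng)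
      moreover have "inv\<^bsub>G\<^esub> n \<in> Rh" using ng(1) \<rho>N_Rh subgroup.m_inv_closed[OF M.R_sub] by blast
      ultimately have "g \<in> Rh" using z subgroup.m_closed[OF M.R_sub] by simp
      then have "g = \<one>\<^bsub>G\<^esub>" using ng(2) Rh_stab by blast
      then show "z \<in> \<rho> ` N" using ng c by simp
    qed
  qed (use NZ \<rho>N_Rh in blast)
  have "?Z <#>\<^bsub>G\<^esub> Rh = carrier G"
  proof
    show "carrier G \<subseteq> ?Z <#>\<^bsub>G\<^esub> Rh" using mono_set_mult[OF YZ order_refl[of Rh], of G] stab_Rh by simp
    show "?Z <#>\<^bsub>G\<^esub> Rh \<subseteq> carrier G"
      by (rule M.set_mult_closed) (use subgroup.subset[OF Zs] in auto)
  qed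
  then have eq: "?Z = Z" using Z(2)[OF Zs ZR] by blast
  have Zn: "Z \<lhd> G" using Z(1) Zs eq by (simp add: M.normal_iff_conjg)
  have "(\<lambda>v. act v \<one>) ` Z = N"
  proof
    show "(\<lambda>v. act v \<one>) ` Z \<subseteq> N"
    proof
      fix x assume "x \<in> (\<lambda>v. act v \<one>) ` Z"
      then obtain n g where ng: "n \<in> N" "g \<in> stab \<one>" "x = act (\<rho> n \<otimes>\<^bsub>G\<^esub> g) \<one>"
        unfolding eq[symmetric] by (auto simp: set_mult_def)
      have c: "n \<in> carrier R" "g \<in> carrier G" "act g \<one> = \<one>" using ng N_carrier by (auto simp: stab_def)
      then have "x = n" unfolding ng(3) by (simp add: act_mult)
      then show "x \<in> N" using ng by simp
    qed
    show "N \<subseteq> (\<lambda>v. act v \<one>) ` Z"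
    proof
      fix n assume n: "n \<in> N"
      then have "n = act (\<rho> n) \<one>" "\<rho> n \<in> Z" using N_carrier NZ eq by (auto simp: subset_eq)
      then show "n \<in> (\<lambda>v. act v \<one>) ` Z" by blast
    qed
  qed
  moreover have "D = Z" if D: "D \<lhd> G" "D \<inter> Rh = \<rho> ` N" "\<not> D \<subseteq> Rh" for D
    using Z(2)[OF normal_imp_subgroup[OF D(1)] D(2)] M.normal_set_mult_R[OF D(1,3)] by blast
  ultimately show ?thesis using Zn YZ NZ ZR unfolding eq by blast
qed

lemma \<rho>_centralizer: "A \<subseteq> carrier R \<Longrightarrow> x \<in> carrier R \<Longrightarrow>
    \<rho> x \<in> set_centralizer G (\<rho> ` A) \<longleftrightarrow> (\<forall>a\<in>A. x \<otimes> a = a \<otimes> x)"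
  by (auto simp: set_centralizer_def \<rho>_mult[symmetric] subset_eq)

lemma orbit_in_coset:
  assumes V: "V \<lhd> G" "(\<lambda>v. act v \<one>) ` V \<subseteq> A" and A: "A \<lhd> R" and v: "v \<in> V" and x: "x \<in> carrier R"
  shows "\<exists>n\<in>A. act v x = x \<otimes> n"
proof -
  have Ac: "a \<in> carrier R" if "a \<in> A" for a using normal_imp_subgroup[OF A] that by (rule subgroup.mem_carrier)
  have "act v x \<in> (\<lambda>v. act v x) ` V" using v by blast
  then obtain h where h: "h \<in> A" "act v x = h \<otimes> x" using orbit_eq[OF V(1) x] V(2) by auto
  have "conjg R (inv x) h \<in> A" using A h x by (simp add: normal_iff_conjg)
  moreover have "x \<otimes> conjg R (inv x) h = h \<otimes> x" using x Ac[OF h(1)] by (simp add: conjg_def m_assoc)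
  ultimately show ?thesis using h by metis
qed

text \<open>An element commuting with right translations by A acts on the coset x A as x a -> x n a
  for a fixed n in A; two such maps commute because A is abelian.\<close>

lemma commute_if_centralizes:
  assumes V: "V \<lhd> G" "(\<lambda>v. act v \<one>) ` V \<subseteq> A" and A: "A \<lhd> R"
    and comm: "\<And>a b. a \<in> A \<Longrightarrow> b \<in> A \<Longrightarrow> a \<otimes> b = b \<otimes> a"
    and cent: "\<And>v a. v \<in> V \<Longrightarrow> a \<in> A \<Longrightarrow> v \<otimes>\<^bsub>G\<^esub> \<rho> a = \<rho> a \<otimes>\<^bsub>G\<^esub> v"
    and v: "v \<in> V" "w \<in> V"
  shows "v \<otimes>\<^bsub>G\<^esub> w = w \<otimes>\<^bsub>G\<^esub> v"
proof (rule faithful)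
  have Ac: "a \<in> carrier R" if "a \<in> A" for a using normal_imp_subgroup[OF A] that by (rule subgroup.mem_carrier)
  have Vc: "v \<in> carrier G" if "v \<in> V" for v using normal_imp_subgroup[OF V(1)] that by (rule subgroup.mem_carrier)
  have shift: "act v (x \<otimes> a) = act v x \<otimes> a" if "v \<in> V" "x \<in> carrier R" "a \<in> A" for v x a
  proof -
    have "act v (x \<otimes> a) = act (v \<otimes>\<^bsub>G\<^esub> \<rho> a) x" using that Vc Ac by (simp add: act_mult)
    also have "\<dots> = act v x \<otimes> a" using that Vc Ac by (simp add: cent act_mult)
    finally show ?thesis .
  qed
  fix x assume x: "x \<in> carrier R"
  obtain n m where nm: "n \<in> A" "act v x = x \<otimes> n" "m \<in> A" "act w x = x \<otimes> m"
    using orbit_in_coset[OF V A] v x by metis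
  have "act (v \<otimes>\<^bsub>G\<^esub> w) x = x \<otimes> n \<otimes> m" using nm v Vc x shift by (simp add: act_mult)
  also have "\<dots> = x \<otimes> m \<otimes> n" using comm[OF nm(1,3)] Ac nm x by (simp add: m_assoc)
  also have "\<dots> = act (w \<otimes>\<^bsub>G\<^esub> v) x" using nm v Vc x shift by (simp add: act_mult)
  finally show "act (v \<otimes>\<^bsub>G\<^esub> w) x = act (w \<otimes>\<^bsub>G\<^esub> v) x" .
qed (use v subgroup.mem_carrier[OF normal_imp_subgroup[OF V(1)]] in auto)

text \<open>The centraliser C of the core meets the regular subgroup exactly in the core. It is not
  contained in the regular subgroup: G/C embeds in the abelian automorphism group of a cyclic group,
  so all commutators would lie in the regular subgroup and make it normal. Hence C is the kernel,
  which is abelian because it centralises N and has orbits x N.\<close>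

lemma cyclic_core_kernel:
  assumes comm: "\<forall>x\<in>carrier R. \<forall>y\<in>carrier R. conjg R x y \<otimes> inv y \<in> N"
    and c: "c \<in> N" "N = range (\<lambda>k::nat. c [^] k)"
    and self: "\<forall>x\<in>carrier R. (\<forall>n\<in>N. x \<otimes> n = n \<otimes> x) \<longrightarrow> x \<in> N"
  shows "\<exists>Z. Z \<lhd> G \<and> stab \<one> \<subseteq> Z \<and> \<rho> ` N \<subseteq> Z \<and> Z \<inter> Rh = \<rho> ` N \<and> (\<lambda>v. act v \<one>) ` Z = N \<and>
    (\<forall>v\<in>Z. \<forall>w\<in>Z. v \<otimes>\<^bsub>G\<^esub> w = w \<otimes>\<^bsub>G\<^esub> v)"
proof -
  from frobenius_kernel[OF comm]
  obtain Z where Z: "Z \<lhd> G" "stab \<one> \<subseteq> Z" "\<rho> ` N \<subseteq> Z" "Z \<inter> Rh = \<rho> ` N" "(\<lambda>v. act v \<one>) ` Z = N"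
    and Z6: "\<forall>D. D \<lhd> G \<longrightarrow> D \<inter> Rh = \<rho> ` N \<longrightarrow> \<not> D \<subseteq> Rh \<longrightarrow> D = Z"
    by (elim exE conjE)
  have cc: "c \<in> carrier R" using c N_carrier by blast
  have abelian: "a \<otimes> b = b \<otimes> a" if "a \<in> N" "b \<in> N" for a b
  proof -
    have "a \<in> range (\<lambda>k::nat. c [^] k)" "b \<in> range (\<lambda>k::nat. c [^] k)" using that c(2) by blast+
    then obtain i j :: nat where "a = c [^] i" "b = c [^] j" by (elim rangeE)
    then show ?thesis using cc by (simp add: nat_pow_mult add.commute)
  qed
  let ?C = "set_centralizer G (\<rho> ` N)"
  have C: "?C \<lhd> G" by (rule M.set_centralizer_normal[OF N_normal])
  have CR: "?C \<inter> Rh = \<rho> ` N"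
  proof
    show "?C \<inter> Rh \<subseteq> \<rho> ` N" using \<rho>_centralizer[OF N_carrier] self by blast
    show "\<rho> ` N \<subseteq> ?C \<inter> Rh" using \<rho>_centralizer[OF N_carrier] abelian N_carrier by blast
  qed
  have "\<not> ?C \<subseteq> Rh"
  proof
    assume "?C \<subseteq> Rh"
    have "\<rho> ` N = range (\<lambda>k::nat. \<rho> c [^]\<^bsub>G\<^esub> k)" using cc by (subst c(2)) (simp add: image_image \<rho>_pow)
    then have "conjg G g h \<otimes>\<^bsub>G\<^esub> inv\<^bsub>G\<^esub> h \<in> Rh" if "g \<in> carrier G" "h \<in> Rh" for g h
      using M.cyclic_centralizer_commutator[OF N_normal _ _ that(1) M.R_carrier[OF that(2)], of "\<rho> c"] c(1) \<open>?C \<subseteq> Rh\<close> by blast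
    then have "conjg G g h \<otimes>\<^bsub>G\<^esub> inv\<^bsub>G\<^esub> h \<otimes>\<^bsub>G\<^esub> h \<in> Rh" if "g \<in> carrier G" "h \<in> Rh" for g h
      using that subgroup.m_closed[OF M.R_sub] by blast
    then have "Rh \<lhd> G" using M.R_sub M.R_carrier by (simp add: M.normal_iff_conjg M.m_assoc)
    then show False using not_normal by blast
  qed
  then have "?C = Z" using Z6 C CR by blast
  then have cent: "v \<otimes>\<^bsub>G\<^esub> \<rho> a = \<rho> a \<otimes>\<^bsub>G\<^esub> v" if "v \<in> Z" "a \<in> N" for v a
    using that by (auto simp: set_centralizer_def)
  have "\<forall>v\<in>Z. \<forall>w\<in>Z. v \<otimes>\<^bsub>G\<^esub> w = w \<otimes>\<^bsub>G\<^esub> v"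
    using commute_if_centralizes[OF Z(1) _ N_R abelian cent] Z(5) by blast
  then show ?thesis using Z(1-5) by blast
qed

text \<open>In both uses, \<open>p0\<close> is the prime divisor of |R| not represented in the
  family: r for order q r, and 2 for order 2 q r. The abelian normal subgroup has orbits of length
  \<open>p0\<close>, no member of the family fits into \<open>W\<close>, and so \<open>W\<close> =
  \<open>H\<close> is a noncentral group of prime order.\<close>

lemma corefree_case:
  assumes N: "N = {\<one>}" and ne: "\<A> \<noteq> {}"
    and AA: "\<And>A. A \<in> \<A> \<Longrightarrow> A \<lhd> R \<and> Factorial_Ring.prime (card A) \<and> \<not> card A * card A dvd card (carrier R) \<and> \<not> card A dvd p0 - 1"
    and contains: "\<And>K. K \<lhd> R \<Longrightarrow> K \<noteq> {\<one>} \<Longrightarrow> \<exists>A\<in>\<A>. A \<subseteq> K"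
    and primes: "\<And>l. Factorial_Ring.prime l \<Longrightarrow> l dvd card (carrier R) \<Longrightarrow> l = p0 \<or> (\<exists>A\<in>\<A>. card A = l)"
    and p0: "\<not> p0 * p0 dvd card (carrier R)"
    and noncentral: "\<And>H. subgroup H R \<Longrightarrow> card H = p0 \<Longrightarrow> \<exists>h\<in>H. \<exists>x\<in>carrier R. h \<otimes> x \<noteq> x \<otimes> h"
  shows "almost_simple G \<or> nontrivial_aut_fixing R S"
proof -
  interpret cf: corefree_maximal_subgroup G Rh
  proof
    show "K = {\<one>\<^bsub>G\<^esub>}" if "K \<lhd> G" "K \<subseteq> Rh" for K
      using N_max[OF that] N subgroup.one_closed[OF normal_imp_subgroup[OF that(1)]] by auto
  qed
  have cR: "card Rh = card (carrier R)" by (rule card_image[OF \<rho>_inj]) simp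
  have As: "subgroup A R" "A \<subseteq> carrier R" "card (\<rho> ` A) = card A" if "A \<in> \<A>" for A
  proof -
    have "A \<lhd> R" using AA[OF that] by blast
    then show s: "subgroup A R" by (rule normal_imp_subgroup)
    show "A \<subseteq> carrier R" using s by (rule subgroup.subset)
    then show "card (\<rho> ` A) = card A" by (intro card_image \<rho>_inj)
  qed
  have fam: "subgroup A G \<and> A \<subseteq> Rh \<and> (\<forall>x\<in>Rh. \<forall>a\<in>A. conjg G x a \<in> A) \<and>
      Factorial_Ring.prime (card A) \<and> \<not> card A * card A dvd card Rh" if A: "A \<in> (\<lambda>A. \<rho> ` A) ` \<A>" for A
  proof -
    obtain A' where A': "A' \<in> \<A>" "A = \<rho> ` A'" using A by blast
    then show ?thesis using As[OF A'(1)] AA[OF A'(1)] \<rho>_subgroup \<rho>_conj_closed cR by auto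
  qed
  have cont: "\<exists>A\<in>(\<lambda>A. \<rho> ` A) ` \<A>. A \<subseteq> K"
    if K: "subgroup K G" "K \<subseteq> Rh" "\<forall>x\<in>Rh. \<forall>k\<in>K. conjg G x k \<in> K" "K \<noteq> {\<one>\<^bsub>G\<^esub>}" for K
  proof -
    let ?K = "{x \<in> carrier R. \<rho> x \<in> K}"
    have "?K \<lhd> R"
      unfolding normal_iff_conjg
    proof (intro conjI ballI)
      show "subgroup ?K R" by (rule \<rho>_vimage_subgroup[OF K(1)])
      fix g h assume g: "g \<in> carrier R" and h: "h \<in> ?K"
      have "conjg G (\<rho> (inv g)) (\<rho> h) \<in> K" using K(3) g h by blast
      then show "conjg R g h \<in> ?K" using g h by (simp add: conjg_\<rho>)
    qed
    moreover have "?K \<noteq> {\<one>}"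
    proof
      assume e: "?K = {\<one>}"
      have "K \<subseteq> {\<one>\<^bsub>G\<^esub>}"
      proof
        fix k assume k: "k \<in> K"
        then obtain x where "x \<in> carrier R" "k = \<rho> x" using K(2) by blast
        then have "x \<in> ?K" using k by simp
        then show "k \<in> {\<one>\<^bsub>G\<^esub>}" using e \<open>k = \<rho> x\<close> by simp
      qed
      then show False using K(4) subgroup.one_closed[OF K(1)] by blast
    qed
    ultimately obtain A where "A \<in> \<A>" "A \<subseteq> ?K" using contains by blast
    then show ?thesis by blast
  qed
  have "almost_simple G \<or> (\<exists>V p n. V \<lhd> G \<and> V \<noteq> {\<one>\<^bsub>G\<^esub>} \<and> V \<inter> Rh = {\<one>\<^bsub>G\<^esub>} \<and> Factorial_Ring.prime p \<and> n > 0 \<and>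
    card V = p ^ n \<and> (\<forall>v\<in>V. \<forall>w\<in>V. v \<otimes>\<^bsub>G\<^esub> w = w \<otimes>\<^bsub>G\<^esub> v) \<and> (\<forall>A\<in>(\<lambda>A. \<rho> ` A) ` \<A>. \<not> card A dvd card V))"
    by (rule cf.almost_simple_or_abelian_normal, simp add: ne, erule fam, erule cont, assumption+)
  then show ?thesis
  proof (elim disjE exE conjE)
    fix V p n
    assume 2: "V \<lhd> G" "V \<noteq> {\<one>\<^bsub>G\<^esub>}" "V \<inter> Rh = {\<one>\<^bsub>G\<^esub>}" "Factorial_Ring.prime p" "n > 0"
      "card V = p ^ n" "\<forall>v\<in>V. \<forall>w\<in>V. v \<otimes>\<^bsub>G\<^esub> w = w \<otimes>\<^bsub>G\<^esub> v" "\<forall>A\<in>(\<lambda>A. \<rho> ` A) ` \<A>. \<not> card A dvd card V"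
    let ?H = "(\<lambda>v. act v \<one>) ` V"
    have H: "subgroup ?H R" by (rule orbit_subgroup[OF 2(1)])
    have cH: "card ?H dvd card (carrier R)" by (rule card_subgroup_dvd[OF H subgroup_self subgroup.subset[OF H]])
    have "card ?H dvd p ^ n" using orbit_stabilizer_card[OF normal_imp_subgroup[OF 2(1)] one_closed] 2(6) by (metis dvd_triv_left)
    then obtain i where i: "card ?H = p ^ i" using divides_primepow_nat[OF 2(4)] by blast
    have "card ?H \<noteq> 1"
    proof
      assume "card ?H = 1"
      then obtain x where x: "?H = {x}" by (rule card_1_singletonE)
      moreover have "\<one> = x" using subgroup.one_closed[OF H] unfolding x by (rule singletonD)
      ultimately show False using orbit_nontrivial[OF 2(1,2)] by blast
    qed
    then obtain j where j: "i = Suc j" using i by (cases i) auto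
    have pR: "p dvd card (carrier R)" using cH i j dvd_trans by (metis dvd_triv_left power_Suc)
    have "card A \<noteq> p" if "A \<in> \<A>" for A
    proof
      assume "card A = p"
      then have "card (\<rho> ` A) dvd card V" using As[OF that] 2(5,6) by (simp add: dvd_power)
      then show False using 2(8) that by blast
    qed
    then have pp: "p = p0" using primes[OF 2(4) pR] by blast
    have "j = 0"
    proof (rule ccontr)
      assume "j \<noteq> 0"
      then obtain j' where "j = Suc j'" by (cases j) auto
      then have "p * p dvd card ?H" using i j by (simp add: mult.assoc[symmetric])
      then show False using p0 pp cH dvd_trans by blast
    qed
    then have Hp: "card ?H = p" using i j by simp
    interpret cb: cayley_block R G \<rho> act S V p
      by (rule cayley_blockI[OF 2(1,7,4) Hp])
    have VR: "\<not> V \<subseteq> Rh" using 2(2,3) subgroup.one_closed[OF normal_imp_subgroup[OF 2(1)]] by blast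
    have notin: "\<not> A \<subseteq> cb.W" if A: "A \<in> \<A>" for A
    proof
      assume AW: "A \<subseteq> cb.W"
      have "\<rho> ` A \<lhd> G"
        by (rule cb.prime_normal_if_in_W[OF _ AW refl _ _ VR]) (use AA[OF A] pp in auto)
      then have "A \<subseteq> {\<one>}" using normal_le_N[OF As(2)[OF A]] N by blast
      then have "card A \<le> 1" using card_mono[of "{\<one>}" A] by simp
      then show False using AA[OF A] prime_gt_1_nat[of "card A"] by simp
    qed
    \<comment> \<open>A prime l dividing |W:H| cannot be \<open>p0\<close>, because
      \<open>p0\<close>^2 does not divide |R|. If l = |A| for a member A of the family, then A lies
      in \<open>W\<close> as the only subgroup of its order, which \<open>notin\<close>
      excludes.\<close>
    have HW: "cb.H = cb.W"
    proof -
      have cHp: "card cb.H = p" using Hp by (simp add: cb.H_def)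
      obtain k where k: "card cb.W = card cb.H * k" using card_subgroup_dvd[OF cb.H_sub cb.W_sub cb.H_W] by (rule dvdE)
      have WR: "card cb.W dvd card (carrier R)" by (rule card_subgroup_dvd[OF cb.W_sub subgroup_self subgroup.subset[OF cb.W_sub]])
      have "k = 1"
      proof (rule ccontr)
        assume "k \<noteq> 1"
        then obtain l where l: "Factorial_Ring.prime l" "l dvd k" using prime_factor_nat by blast
        have lW: "l dvd card cb.W" using l k by simp
        consider "l = p0" | A where "A \<in> \<A>" "card A = l" using primes[OF l(1)] lW WR dvd_trans by blast
        then show False
        proof cases
          case 1
          then have "p0 * p0 dvd card cb.W" using l k cHp pp by simp
          then show False using p0 WR dvd_trans by blast
        next
          case A: 2
          have "A \<subseteq> cb.W"
            by (rule normal_prime_subset[OF fin_R _ refl _ _ cb.W_sub]) (use AA[OF A(1)] A lW in auto)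
          then show False using notin[OF A(1)] by blast
        qed
      qed
      then show ?thesis
        using card_subset_eq[OF finite_subset[OF subgroup.subset[OF cb.W_sub] fin_R] cb.H_W] k by simp
    qed
    obtain h x where hx: "h \<in> cb.H" "x \<in> carrier R" "h \<otimes> x \<noteq> x \<otimes> h"
      using noncentral[OF H] Hp pp by (auto simp: cb.H_def)
    have "w \<otimes> h = h \<otimes> w" if "w \<in> cb.H" "h \<in> cb.H" for w h
      using prime_subgroup_comm[OF fin_R cb.H_sub _ that] Hp 2(4) by (simp add: cb.H_def)
    then have "nontrivial_aut_fixing R S"
      using cb.nontrivial_aut_if_W_centralizes_H[OF _ hx] HW by blast
    then show ?thesis ..
  qed simp
qed

end

text \<open>If \<open>W\<close> were R, all point stabilisers in V would coincide, and the common
  one would fix every point.\<close>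

lemma (in cayley_block) W_ne_carrier:
  assumes "K \<one> \<noteq> {\<one>\<^bsub>G\<^esub>}"
  shows "W \<noteq> carrier R"
proof
  assume W: "W = carrier R"
  have "v = \<one>\<^bsub>G\<^esub>" if v: "v \<in> K \<one>" for v
  proof (rule faithful)
    fix x assume x: "x \<in> carrier R"
    then have "v \<in> K x" using W v by (auto simp: W_def)
    then show "act v x = act \<one>\<^bsub>G\<^esub> x" using x by (simp add: K_def)
  qed (use v V_carrier in \<open>auto simp: K_def\<close>)
  then show False using assms subgroup.one_closed[OF K_sub[OF one_closed]] by blast
qed

section \<open>Nonabelian groups of order qr\<close>

locale prime_semidirect = group R for R (structure) +
  fixes A q r
  assumes A_normal: "A \<lhd> R" and A_card: "card A = q" and R_card: "card (carrier R) = q * r"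
    and q_prime: "Factorial_Ring.prime q" and r_prime: "Factorial_Ring.prime r" and q_ne_r: "q \<noteq> r"
    and commutators: "x \<in> carrier R \<Longrightarrow> y \<in> carrier R \<Longrightarrow> conjg R x y \<otimes> inv y \<in> A"
    and nonabelian: "\<not> comm_group R"
begin

lemma fin_carrier: "finite (carrier R)"
  by (rule card_ge_0_finite) (use R_card q_prime r_prime prime_gt_0_nat in simp)

lemma A_sub: "subgroup A R"
  using A_normal by (rule normal_imp_subgroup)

lemma A_carrier: "a \<in> A \<Longrightarrow> a \<in> carrier R"
  using A_sub by (rule subgroup.mem_carrier)

lemma sq_ndvd: "\<not> q * q dvd card (carrier R)" "\<not> r * r dvd card (carrier R)"
proof -
  have "\<not> q dvd r" "\<not> r dvd q" using q_prime r_prime q_ne_r primes_dvd_imp_eq by blast+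
  then show "\<not> q * q dvd card (carrier R)" "\<not> r * r dvd card (carrier R)"
    using q_prime r_prime prime_gt_0_nat unfolding R_card by auto
qed

lemma over_A:
  assumes "subgroup K R" "A \<subseteq> K" "K \<noteq> A"
  shows "K = carrier R"
  using prime_index_subgroup[OF fin_carrier A_sub assms(1) subgroup_self assms(2) subgroup.subset[OF assms(1)] _ r_prime assms(3)]
    R_card A_card by (simp add: mult.commute)

lemma A_comm: "a \<in> A \<Longrightarrow> b \<in> A \<Longrightarrow> a \<otimes> b = b \<otimes> a"
  using prime_subgroup_comm[OF fin_carrier A_sub] A_card q_prime by simp

text \<open>A has prime index, so a centraliser exceeding A is R and A is central. Then the
  centraliser of any y outside A exceeds A as well, and R would be abelian.\<close>

lemma self_centralizing:
  assumes x: "x \<in> carrier R" and comm: "\<forall>a\<in>A. x \<otimes> a = a \<otimes> x"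
  shows "x \<in> A"
proof (rule ccontr)
  assume xA: "x \<notin> A"
  have Ac: "A \<subseteq> carrier R" using A_carrier by blast
  have "set_centralizer R A = carrier R"
    by (rule over_A[OF set_centralizer_subgroup[OF Ac]]) (use x xA comm A_comm A_carrier in \<open>auto simp: set_centralizer_def\<close>)
  then have central: "y \<otimes> a = a \<otimes> y" if "a \<in> A" "y \<in> carrier R" for a y
    using that unfolding set_centralizer_def by blast
  have "y \<otimes> z = z \<otimes> y" if y: "y \<in> carrier R" and z: "z \<in> carrier R" for y z
  proof (cases "y \<in> A")
    case False
    have "set_centralizer R {y} = carrier R"
      by (rule over_A[OF set_centralizer_subgroup]) (use y False central A_carrier in \<open>auto simp: set_centralizer_def\<close>)
    then have "z \<in> set_centralizer R {y}" using z by simp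
    then show ?thesis by (simp add: set_centralizer_def)
  qed (use central z in auto)
  then have "comm_group R" by (intro group_comm_groupI) auto
  then show False using nonabelian by blast
qed

text \<open>A subgroup of order r must act nontrivially on A, so r divides q - 1 and r < q.\<close>

lemma q_ndvd: "\<not> q dvd r - 1"
proof
  assume d: "q dvd r - 1"
  have "r dvd q - 1"
  proof (rule ccontr)
    assume nd: "\<not> r dvd q - 1"
    obtain P where P: "subgroup P R" "card P = r"
      using prime_subgroup_exists[OF fin_carrier subgroup_self r_prime] R_card by auto
    have Pc: "y \<in> carrier R" if "y \<in> P" for y using P(1) that by (rule subgroup.mem_carrier)
    have "y \<in> A" if y: "y \<in> P" for y
    proof (rule self_centralizing[OF Pc[OF y]], rule)
      fix a assume a: "a \<in> A"
      have "conjg R y a \<otimes> inv a \<in> {\<one>}"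
        by (rule prime_action_trivial_on_quotient[OF fin_carrier P r_prime A_sub A_comm triv_subgroup _ _ q_prime nd _ _ y a])
          (use A_normal A_card Pc subgroup.one_closed[OF A_sub] in \<open>auto simp: normal_iff_conjg\<close>)
      then have "conjg R y a \<otimes> inv a \<otimes> a = a" using A_carrier[OF a] by simp
      then have "conjg R y a = a" using Pc[OF y] A_carrier[OF a] by (simp add: m_assoc)
      then show "y \<otimes> a = a \<otimes> y" using conjg_eq_iff Pc[OF y] A_carrier[OF a] by blast
    qed
    then have "r dvd q" using card_subgroup_dvd[OF P(1) A_sub] P(2) A_card by blast
    then show False using primes_dvd_imp_eq[OF r_prime q_prime] q_ne_r by blast
  qed
  then have "r \<le> q - 1" using prime_gt_1_nat[OF q_prime] by (intro dvd_imp_le) auto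
  moreover have "q \<le> r - 1" using d prime_gt_1_nat[OF r_prime] by (intro dvd_imp_le) auto
  ultimately show False using prime_gt_1_nat[OF q_prime] by linarith
qed

text \<open>If K \<inter> A is trivial, K and A commute elementwise, so K lies in the centraliser of
  A, which is A.\<close>

lemma normal_contains_A:
  assumes K: "K \<lhd> R" "K \<noteq> {\<one>}"
  shows "A \<subseteq> K"
proof (rule ccontr)
  assume n: "\<not> A \<subseteq> K"
  have Ks: "subgroup K R" using K(1) by (rule normal_imp_subgroup)
  have Kc: "k \<in> carrier R" if "k \<in> K" for k using Ks that by (rule subgroup.mem_carrier)
  have triv: "x = \<one>" if "x \<in> A" "x \<in> K" for x
    using prime_subgroup_eq[OF fin_carrier A_sub _ Ks that] n A_card q_prime by blast
  have "k = \<one>" if k: "k \<in> K" for k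
  proof -
    have "k \<otimes> a = a \<otimes> k" if a: "a \<in> A" for a
    proof -
      have c: "k \<in> carrier R" "a \<in> carrier R" using Kc k A_carrier a by auto
      have "conjg R k a \<otimes> inv a \<in> A"
        using A_normal a c A_sub by (simp add: normal_iff_conjg subgroup.m_closed subgroup.m_inv_closed)
      moreover have "conjg R k a \<otimes> inv a = k \<otimes> conjg R a (inv k)" using c by (simp add: conjg_def m_assoc)
      moreover have "k \<otimes> conjg R a (inv k) \<in> K"
        using K(1) k c Ks by (simp add: normal_iff_conjg subgroup.m_closed subgroup.m_inv_closed)
      ultimately have "conjg R k a \<otimes> inv a = \<one>" using triv by metis
      then have "conjg R k a \<otimes> inv a \<otimes> a = a" using c by simp
      then have "conjg R k a = a" using c by (simp add: m_assoc)
      then show ?thesis using conjg_eq_iff c by blast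
    qed
    then have "k \<in> A" using self_centralizing Kc[OF k] by blast
    then show ?thesis using triv k by blast
  qed
  then show False using K(2) subgroup.one_closed[OF Ks] by blast
qed

end

locale cayley_semidirect = cayley_core R G \<rho> act S N + prime_semidirect R A q r
  for R (structure) and G \<rho> act S N A q r
begin

lemma core_cases: "N = {\<one>} \<or> N = A"
proof -
  have "N \<noteq> carrier R" using N_normal not_normal by blast
  then show ?thesis using normal_contains_A[OF N_R] over_A[OF normal_imp_subgroup[OF N_R]] by blast
qed

text \<open>For core \<open>A\<close>, the abelian kernel has orbits of length q and
  \<open>W\<close> = \<open>A\<close>, so conjugation by a nontrivial element of \<open>A\<close>
  fixes S.\<close>

lemma conclusion: "nontrivial_aut_fixing R S \<or> (N = {\<one>} \<and> almost_simple G)"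
proof (cases "N = A")
  case False
  then have N: "N = {\<one>}" using core_cases by blast
  have "almost_simple G \<or> nontrivial_aut_fixing R S"
  proof (rule corefree_case[OF N, of "{A}" r])
    show "\<exists>X'\<in>{A}. X' \<subseteq> K" if "K \<lhd> R" "K \<noteq> {\<one>}" for K using normal_contains_A[OF that] by blast
    show "l = r \<or> (\<exists>A\<in>{A}. card A = l)" if l: "Factorial_Ring.prime l" "l dvd card (carrier R)" for l
    proof -
      have "l dvd q \<or> l dvd r" using l R_card by (simp add: prime_dvd_mult_iff)
      then show ?thesis using primes_dvd_imp_eq[OF l(1)] q_prime r_prime A_card by blast
    qed
    show "\<exists>h\<in>H. \<exists>x\<in>carrier R. h \<otimes> x \<noteq> x \<otimes> h" if H: "subgroup H R" "card H = r" for H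
    proof (rule ccontr)
      assume "\<not> ?thesis"
      then have "H \<subseteq> A" using self_centralizing A_carrier subgroup.mem_carrier[OF H(1)] by blast
      then have "r dvd q" using card_subgroup_dvd[OF H(1) A_sub] H(2) A_card by blast
      then show False using primes_dvd_imp_eq[OF r_prime q_prime] q_ne_r by blast
    qed
  qed (use A_normal A_card q_prime sq_ndvd q_ndvd in auto)
  then show ?thesis using N by blast
next
  case N: True
  obtain c where c: "c \<in> N" "c \<noteq> \<one>"
  proof -
    have "A \<noteq> {\<one>}" using A_card q_prime by auto
    then show ?thesis using that N subgroup.one_closed[OF A_sub] by blast
  qed
  have cyc: "N = range (\<lambda>k::nat. c [^] k)"
    unfolding N by (rule prime_subgroup_powers[OF fin_carrier A_sub]) (use A_card q_prime c N in auto)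
  have "\<forall>x\<in>carrier R. \<forall>y\<in>carrier R. conjg R x y \<otimes> inv y \<in> N"
    "\<forall>x\<in>carrier R. (\<forall>n\<in>N. x \<otimes> n = n \<otimes> x) \<longrightarrow> x \<in> N"
    unfolding N using commutators self_centralizing by auto
  from cyclic_core_kernel[OF this(1) c(1) cyc this(2)]
  obtain Z where Z: "Z \<lhd> G" "stab \<one> \<subseteq> Z" "\<rho> ` N \<subseteq> Z" "Z \<inter> Rh = \<rho> ` N" "(\<lambda>v. act v \<one>) ` Z = N"
    "\<forall>v\<in>Z. \<forall>w\<in>Z. v \<otimes>\<^bsub>G\<^esub> w = w \<otimes>\<^bsub>G\<^esub> v"
    by (elim exE conjE)
  interpret cb: cayley_block R G \<rho> act S Z q
    by (rule cayley_blockI[OF Z(1,6) q_prime]) (simp add: Z(5) N A_card)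
  have H: "cb.H = A" using Z(5) N by (simp add: cb.H_def)
  have "cb.K \<one> = stab \<one>" using Z(2) subgroup.mem_carrier[OF normal_imp_subgroup[OF Z(1)]] by (auto simp: cb.K_def stab_def)
  then have "cb.W \<noteq> carrier R" using cb.W_ne_carrier stab_nontrivial by simp
  then have W: "cb.W = A" using over_A[OF cb.W_sub] cb.H_W H by blast
  \<comment> \<open>If c were central, so would be \<open>A\<close>; being self-centralising,
    \<open>A\<close> would be R, and the regular subgroup would be normal.\<close>
  have "\<exists>x\<in>carrier R. c \<otimes> x \<noteq> x \<otimes> c"
  proof (rule ccontr)
    assume "\<not> ?thesis"
    then have central: "c \<in> set_centralizer R (carrier R)" using c N A_carrier by (auto simp: set_centralizer_def)
    have "A \<subseteq> set_centralizer R (carrier R)"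
      using prime_subgroup_eq[OF fin_carrier A_sub _ set_centralizer_subgroup[OF order_refl] _ central c(2)] A_card q_prime c N by blast
    then have "carrier R \<subseteq> A" using self_centralizing by (auto simp: set_centralizer_def subset_eq)
    then have "A = carrier R" using A_carrier by blast
    then show False using N N_normal not_normal by simp
  qed
  then show ?thesis using cb.nontrivial_aut_if_W_centralizes_H[of c] H W A_comm c N by blast
qed

end

subsection \<open>The dihedral case\<close>

lemma (in group) torsion_normal:
  fixes n :: nat
  assumes Z: "Z \<lhd> G" and comm: "\<And>v w. v \<in> Z \<Longrightarrow> w \<in> Z \<Longrightarrow> v \<otimes> w = w \<otimes> v"
  shows "{z \<in> Z. z [^] n = \<one>} \<lhd> G"
  unfolding normal_iff_conjg
proof (intro conjI ballI)
  have Zs: "subgroup Z G" using Z by (rule normal_imp_subgroup)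
  have Zc: "z \<in> carrier G" if "z \<in> Z" for z using Zs that by (rule subgroup.mem_carrier)
  show "subgroup {z \<in> Z. z [^] n = \<one>} G"
  proof (rule subgroupI)
    have "\<one> \<in> {z \<in> Z. z [^] n = \<one>}" using subgroup.one_closed[OF Zs] by simp
    then show "{z \<in> Z. z [^] n = \<one>} \<noteq> {}" by blast
    show "inv a \<in> {z \<in> Z. z [^] n = \<one>}" if "a \<in> {z \<in> Z. z [^] n = \<one>}" for a
      using that Zc subgroup.m_inv_closed[OF Zs] by (simp add: nat_pow_inv)
    show "a \<otimes> b \<in> {z \<in> Z. z [^] n = \<one>}" if "a \<in> {z \<in> Z. z [^] n = \<one>}" "b \<in> {z \<in> Z. z [^] n = \<one>}" for a b
      using that Zc subgroup.m_closed[OF Zs] pow_mult_distrib[OF comm] by simp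
  qed (use Zc in auto)
  show "conjg G g z \<in> {z \<in> Z. z [^] n = \<one>}" if "g \<in> carrier G" "z \<in> {z \<in> Z. z [^] n = \<one>}" for g z
    using that Z Zc by (auto simp: normal_iff_conjg conjg_of_pow[symmetric])
qed

lemma (in cayley_action) act_shift:
  assumes "v \<in> carrier G" "a \<in> carrier R" "x \<in> carrier R" "v \<otimes>\<^bsub>G\<^esub> \<rho> a = \<rho> a \<otimes>\<^bsub>G\<^esub> v"
  shows "act v (x \<otimes> a) = act v x \<otimes> a"
proof -
  have "act v (x \<otimes> a) = act (v \<otimes>\<^bsub>G\<^esub> \<rho> a) x" using assms(1-3) by (simp add: act_mult)
  also have "\<dots> = act v x \<otimes> a" using assms by (simp add: act_mult)
  finally show ?thesis .
qed

text \<open>v commutes with the translation \<rho> n, so it repeats the same step along x, x n, x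
  n^2 and so on. This relates the order of v to the orders of the steps n.\<close>

lemma (in cayley_action) act_pow:
  fixes k :: nat
  assumes "v \<in> carrier G" "n \<in> carrier R" "x \<in> carrier R" "v \<otimes>\<^bsub>G\<^esub> \<rho> n = \<rho> n \<otimes>\<^bsub>G\<^esub> v" "act v x = x \<otimes> n"
  shows "act (v [^]\<^bsub>G\<^esub> k) x = x \<otimes> n [^] k"
proof (induction k)
  case (Suc k)
  have "v [^]\<^bsub>G\<^esub> k \<otimes>\<^bsub>G\<^esub> \<rho> n = \<rho> n \<otimes>\<^bsub>G\<^esub> v [^]\<^bsub>G\<^esub> k"
    using M.group_commutes_pow[OF assms(4)] assms(1,2) by simp
  then have "act (v [^]\<^bsub>G\<^esub> k) (x \<otimes> n) = act (v [^]\<^bsub>G\<^esub> k) x \<otimes> n" using assms by (intro act_shift) auto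
  then show ?case using Suc assms by (simp add: act_mult m_assoc)
qed (use assms in simp)

lemma (in cayley_block) W_if_commutes:
  assumes x: "x \<in> carrier R" and comm: "\<And>v. v \<in> V \<Longrightarrow> v \<otimes>\<^bsub>G\<^esub> \<rho> x = \<rho> x \<otimes>\<^bsub>G\<^esub> v"
  shows "x \<in> W"
proof -
  have "conjg G (\<rho> x) v = v" if v: "v \<in> V" for v
    using comm[OF v] M.conjg_eq_iff[of "\<rho> x" v] x V_carrier[OF v] by simp
  then have "conjg G (\<rho> x) ` K \<one> = K \<one>" by (auto simp: K_def)
  then show ?thesis using K_mult[OF one_closed x] x by (simp add: W_def)
qed

lemma (in group) powers_subgroup:
  assumes fin: "finite (carrier G)" and c: "c \<in> carrier G"
  shows "subgroup (range (\<lambda>k::nat. c [^] k)) G"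
proof -
  have "ord c \<noteq> 0" using ord_ge_1[OF fin c] by simp
  then have "generate G {c} = range (\<lambda>k::nat. c [^] k)" using generate_pow_nat[OF c] by auto
  then show ?thesis using generate_is_subgroup[of "{c}"] c by simp
qed

context dihedral_coords
begin

lemma AB_generated:
  assumes K: "subgroup K R" "A \<subseteq> K" "B \<subseteq> K"
  shows "AB \<subseteq> K"
proof
  fix x assume x: "x \<in> AB"
  then have xc: "x \<in> carrier R" "\<not> \<tau> x" by (auto simp: AB_def)
  obtain y where y: "y \<in> B" "\<beta> y = \<beta> x" using rotation_ex[of "\<beta> x"] \<beta>_range[OF xc(1)] by auto
  have yc: "y \<in> carrier R" "\<not> \<tau> y" using y by (auto simp: B_def)
  have "x \<otimes> inv y \<in> A" using A_coset_iff[OF yc(1) xc(1)] y xc yc by simp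
  then have "x \<otimes> inv y \<otimes> y \<in> K" using K y subgroup.m_closed[OF K(1)] by blast
  then show "x \<in> K" using xc yc by (simp add: m_assoc)
qed

text \<open>Chinese remainder theorem: for c with both exponents 1, the q-th power generates
  \<open>B\<close> and the r-th power generates \<open>A\<close>.\<close>

lemma AB_cyclic: "\<exists>c\<in>AB. AB = range (\<lambda>k::nat. c [^] k)"
proof -
  obtain c where c: "c \<in> carrier R" "\<alpha> c = 1" "\<beta> c = 1" "\<not> \<tau> c"
    using coords_ex[of 1 1 False] prime_gt_1_nat[OF q_prime] prime_gt_1_nat[OF r_prime] by auto
  let ?K = "range (\<lambda>k::nat. c [^] k)"
  have K: "subgroup ?K R" by (rule powers_subgroup[OF fin_R c(1)])
  have "\<beta> (c [^] q) \<noteq> 0" using rotation_pow[OF c(1,4)] pow_r_dvd[OF c(1)] c(3) coprime_qr(1) by (metis zero_neq_one)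
  then have "B \<subseteq> ?K"
    using rotation_pow[OF c(1,4)] \<alpha>_pow[OF c(1), of q] by (intro B_generator[OF K rangeI[of _ q]]) auto
  moreover have "\<alpha> (c [^] r) \<noteq> 0" using \<alpha>_pow[OF c(1)] pow_q_dvd[OF c(1)] c(2) coprime_qr(1) coprime_commute by (metis zero_neq_one)
  then have "A \<subseteq> ?K"
    using rotation_pow[OF c(1,4), of r] by (intro A_generator[OF K rangeI[of _ r]]) auto
  ultimately have "AB \<subseteq> ?K" by (intro AB_generated[OF K])
  moreover have "?K \<subseteq> AB" using c rotation_pow[OF c(1,4)] by (auto simp: AB_def)
  ultimately show ?thesis using c by (intro bexI[of _ c]) (auto simp: AB_def)
qed

lemma part_products: "x \<in> carrier R \<Longrightarrow> \<exists>a\<in>A. \<exists>d\<in>D. x = d \<otimes> a"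
proof -
  assume x: "x \<in> carrier R"
  obtain d where d: "d \<in> carrier R" "\<alpha> d = 0" "\<beta> d = \<beta> x" "\<tau> d = \<tau> x"
    using coords_ex[of 0 "\<beta> x" "\<tau> x"] \<beta>_range[OF x] q_pos by auto
  have a: "x \<otimes> inv d \<in> A" by (rule A_coset_iff) (use d x in auto)
  have "x = (x \<otimes> inv d) \<otimes> d" using x d by (simp add: m_assoc)
  also have "\<dots> = d \<otimes> (x \<otimes> inv d)" by (rule A_central[OF a d(1)])
  finally show ?thesis using a d by (auto simp: D_def)
qed

lemma parts_disjoint: "x \<in> A \<Longrightarrow> x \<in> D \<Longrightarrow> x = \<one>"
  by (rule coords_eq) (auto simp: part_defs)

lemma A_nontrivial: "\<exists>a\<in>A. a \<noteq> \<one>"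
proof -
  have "A \<noteq> {\<one>}" using card_parts(1) q_prime by auto
  then show ?thesis using subgroup.one_closed[OF parts_subgroup(1)] by blast
qed

lemma B_nontrivial: "\<exists>a\<in>B. a \<noteq> \<one>"
proof -
  have "B \<noteq> {\<one>}" using card_parts(2) r_prime by auto
  then show ?thesis using subgroup.one_closed[OF parts_subgroup(2)] by blast
qed

lemma A_not_le_D: "\<not> A \<subseteq> D"
  using A_nontrivial parts_disjoint by blast

lemma B_not_le_A: "\<not> B \<subseteq> A"
  using B_nontrivial parts_disjoint by (auto simp: part_defs)

lemma two_lt_q: "2 < q"
  using prime_gt_1_nat[OF q_prime] q_odd by (cases "q = 2") auto

lemma order_two_D:
  assumes H: "subgroup H R" "card H = 2" and h: "h \<in> H"
  shows "h \<in> D"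
proof (rule pow_2r_D[OF _ H(1) h])
  show "h \<in> carrier R" using H(1) h by (rule subgroup.mem_carrier)
  show "\<not> A \<subseteq> H"
  proof
    assume "A \<subseteq> H"
    moreover have "finite H" using H(2) card.infinite by fastforce
    ultimately have "q \<le> 2" using card_mono[of H A] card_parts(1) H(2) by simp
    then show False using two_lt_q by simp
  qed
qed

end

section \<open>The possible cores in the dihedral case\<close>

locale cayley_dihedral = cayley_core R G \<rho> act S N + dihedral_coords R q r \<alpha> \<beta> \<tau>
  for R (structure) and G \<rho> act S N q r \<alpha> \<beta> \<tau> +
  assumes S_inv: "x \<in> carrier R \<Longrightarrow> inv x \<in> S \<longleftrightarrow> x \<in> S"
begin

text \<open>q and r are represented by \<open>A\<close> and \<open>B\<close>, which leaves 2 as the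
  orbit length. A subgroup of order two lies in \<open>D\<close>, whose centre is trivial.\<close>

lemma core_one_case:
  assumes N: "N = {\<one>}"
  shows "almost_simple G \<or> nontrivial_aut_fixing R S"
proof (rule corefree_case[OF N, of "{A, B}" 2])
  show "\<exists>K'\<in>{A, B}. K' \<subseteq> K" if "K \<lhd> R" "K \<noteq> {\<one>}" for K using normal_contains[OF that] by blast
  show "l = 2 \<or> (\<exists>K\<in>{A, B}. card K = l)" if l: "Factorial_Ring.prime l" "l dvd card (carrier R)" for l
  proof -
    have "l dvd 2 \<or> l dvd q \<or> l dvd r" using l card_parts(5) by (simp add: prime_dvd_mult_iff)
    then show ?thesis
      using primes_dvd_imp_eq[OF l(1) two_is_prime_nat] primes_dvd_imp_eq[OF l(1) q_prime] primes_dvd_imp_eq[OF l(1) r_prime]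
        card_parts by auto
  qed
  show "\<not> 2 * 2 dvd card (carrier R)"
  proof
    assume "2 * 2 dvd card (carrier R)"
    then have "2 * 2 dvd 2 * (q * r)" using card_parts(5) by (simp add: mult.assoc)
    then have "2 dvd q * r" by (metis nat_mult_dvd_cancel_disj zero_neq_numeral)
    then show False using q_odd r_cases by auto
  qed
  show "\<exists>h\<in>H. \<exists>x\<in>carrier R. h \<otimes> x \<noteq> x \<otimes> h" if H: "subgroup H R" "card H = 2" for H
  proof -
    have "H \<noteq> {\<one>}" using H(2) by auto
    then obtain h where h: "h \<in> H" "h \<noteq> \<one>" using subgroup.one_closed[OF H(1)] by blast
    then show ?thesis using noncentral_D[OF order_two_D[OF H h(1)]] by blast
  qed
  show "K \<lhd> R \<and> Factorial_Ring.prime (card K) \<and> \<not> card K * card K dvd card (carrier R) \<and> \<not> card K dvd 2 - 1"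
    if "K \<in> {A, B}" for K
  proof -
    have "\<not> q dvd 2 - 1" "\<not> r dvd 2 - 1"
      using prime_gt_1_nat[OF q_prime] prime_gt_1_nat[OF r_prime] by simp_all
    then show ?thesis
      using that parts_normal(1,2) q_prime r_prime sq_ndvd card_parts(1,2) by (elim insertE emptyE) metis+
  qed
qed simp

text \<open>The trace of S on the reflections of the dihedral factor, read as a subset of
  Z/r.\<close>

definition refl_S where "refl_S j \<longleftrightarrow> (\<exists>x\<in>S. x \<in> D \<and> \<tau> x \<and> \<beta> x = j)"

lemma refl_S_iff: "x \<in> D \<Longrightarrow> \<tau> x \<Longrightarrow> refl_S (\<beta> x) \<longleftrightarrow> x \<in> S"
proof -
  assume x: "x \<in> D" "\<tau> x"
  have "y = x" if "y \<in> D" "\<tau> y" "\<beta> y = \<beta> x" for y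
    by (rule coords_eq) (use that x in \<open>auto simp: D_def\<close>)
  then show ?thesis using x unfolding refl_S_def by blast
qed

text \<open>The constant c of \<open>reflection_symmetric\<close> becomes a reflection t with
  \<beta>(t) = c, since conjugation by t sends the reflection with exponent j to the one with
  exponent 2 c - j.\<close>

lemma reflection_for_S: "\<exists>t\<in>D. \<tau> t \<and> (\<forall>x\<in>carrier R. refl_S ((2 * \<beta> t - \<beta> x) mod int r) \<longleftrightarrow> refl_S (\<beta> x))"
proof -
  obtain c where c: "0 \<le> c" "c < int r" "\<forall>j\<in>{0..<int r}. refl_S j = refl_S ((2 * c - j) mod int r)"
    using reflection_symmetric[OF r_cases, of refl_S] by blast
  obtain t where t: "t \<in> D" "\<beta> t = c" "\<tau> t" using reflection_ex[OF c(1,2)] by blast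
  then show ?thesis using c(3) \<beta>_range by (intro bexI[of _ t]) auto
qed

text \<open>The kernel Z is abelian, and its s-torsion for s = q or r serves as V, with
  \<open>H\<close> equal to \<open>A\<close> or \<open>B\<close> and \<open>W\<close> =
  \<open>AB\<close>. If \<open>H\<close> = \<open>B\<close>, conjugation by a rotation works. If
  \<open>H\<close> = \<open>A\<close>, which is central, the automorphism is \<iota> after
  conjugation by a reflection: it inverts \<open>AB\<close>, and on the cosets of \<open>A\<close>
  outside it acts as a symmetry of \<open>refl_S\<close>.\<close>

lemma core_AB_case:
  assumes N: "N = AB"
  shows "nontrivial_aut_fixing R S"
proof -
  obtain c where c: "c \<in> N" "N = range (\<lambda>k::nat. c [^] k)" using AB_cyclic N by blast
  have BAB: "B \<subseteq> AB" by (auto simp: part_defs)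
  have "\<forall>x\<in>carrier R. \<forall>y\<in>carrier R. conjg R x y \<otimes> inv y \<in> N" using commutator_B BAB N by blast
  moreover have "\<forall>x\<in>carrier R. (\<forall>n\<in>N. x \<otimes> n = n \<otimes> x) \<longrightarrow> x \<in> N" using centralizer_B BAB N by blast
  ultimately have "\<exists>Z. Z \<lhd> G \<and> stab \<one> \<subseteq> Z \<and> \<rho> ` N \<subseteq> Z \<and> Z \<inter> Rh = \<rho> ` N \<and> (\<lambda>v. act v \<one>) ` Z = N \<and>
    (\<forall>v\<in>Z. \<forall>w\<in>Z. v \<otimes>\<^bsub>G\<^esub> w = w \<otimes>\<^bsub>G\<^esub> v)" by (intro cyclic_core_kernel[OF _ c])
  then obtain Z where Z: "Z \<lhd> G" "stab \<one> \<subseteq> Z" "\<rho> ` N \<subseteq> Z" "Z \<inter> Rh = \<rho> ` N" "(\<lambda>v. act v \<one>) ` Z = N"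
    and Zcomm: "\<forall>v\<in>Z. \<forall>w\<in>Z. v \<otimes>\<^bsub>G\<^esub> w = w \<otimes>\<^bsub>G\<^esub> v"
    by (elim exE conjE)
  have Zc: "z \<in> carrier G" if "z \<in> Z" for z using normal_imp_subgroup[OF Z(1)] that by (rule subgroup.mem_carrier)
  have ABc: "n \<in> carrier R" if "n \<in> AB" for n using that by (simp add: AB_def)
  have \<rho>Z: "\<rho> n \<in> Z" if "n \<in> AB" for n using that Z(3) N by blast
  have orbit: "\<exists>n\<in>AB. act z x = x \<otimes> n" if "z \<in> Z" "x \<in> carrier R" for z x
    using orbit_in_coset[OF Z(1) _ parts_normal(4) that] Z(5) N by blast
  have pow: "act (z [^]\<^bsub>G\<^esub> k) x = x \<otimes> n [^] k" if "z \<in> Z" "x \<in> carrier R" "n \<in> AB" "act z x = x \<otimes> n" for z x n and k :: nat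
    using that Zc ABc \<rho>Z Zcomm by (intro act_pow) auto
  have exponent: "z [^]\<^bsub>G\<^esub> (q * r) = \<one>\<^bsub>G\<^esub>" if z: "z \<in> Z" for z
  proof (rule faithful)
    fix x assume x: "x \<in> carrier R"
    obtain n where n: "n \<in> AB" "act z x = x \<otimes> n" using orbit[OF z x] by blast
    have "n [^] (q * r) = \<one>"
      using pow_card_subgroup[OF parts_subgroup(4) n(1)] fin_R finite_subset[OF subgroup.subset[OF parts_subgroup(4)]] card_parts(4) by simp
    then show "act (z [^]\<^bsub>G\<^esub> (q * r)) x = act \<one>\<^bsub>G\<^esub> x" using pow[OF z x n] x by simp
  qed (use z Zc in auto)
  obtain g where g: "g \<in> stab \<one>" "g \<noteq> \<one>\<^bsub>G\<^esub>"
    using stab_nontrivial subgroup.one_closed[OF stab_subgroup[OF one_closed]] by blast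
  have gpow: "g [^]\<^bsub>G\<^esub> k \<in> stab \<one>" for k :: nat
    by (induction k) (use g(1) stab_subgroup[OF one_closed] in \<open>auto simp: subgroup.m_closed subgroup.one_closed\<close>)
  have gc: "g \<in> carrier G" using g Z(2) Zc by blast
  \<comment> \<open>g^(q r) = 1, so g or its q-th power has prime order.\<close>
  have "\<exists>s g. (s = q \<or> s = r) \<and> g \<in> stab \<one> \<and> g \<noteq> \<one>\<^bsub>G\<^esub> \<and> g [^]\<^bsub>G\<^esub> s = \<one>\<^bsub>G\<^esub>"
  proof (cases "g [^]\<^bsub>G\<^esub> q = \<one>\<^bsub>G\<^esub>")
    case False
    have "(g [^]\<^bsub>G\<^esub> q) [^]\<^bsub>G\<^esub> r = \<one>\<^bsub>G\<^esub>" using exponent[of g] g(1) Z(2) gc by (auto simp: M.nat_pow_pow)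
    then show ?thesis using False gpow by blast
  qed (use g in blast)
  then obtain s u where s: "s = q \<or> s = r" and u: "u \<in> stab \<one>" "u \<noteq> \<one>\<^bsub>G\<^esub>" "u [^]\<^bsub>G\<^esub> s = \<one>\<^bsub>G\<^esub>" by blast
  have s_prime: "Factorial_Ring.prime s" using s q_prime r_prime by blast
  let ?V = "{z \<in> Z. z [^]\<^bsub>G\<^esub> s = \<one>\<^bsub>G\<^esub>}" and ?H = "if s = q then A else B"
  have V: "?V \<lhd> G" by (rule M.torsion_normal[OF Z(1)]) (use Zcomm in blast)
  have Hpow: "n [^] s = \<one> \<longleftrightarrow> n \<in> ?H" if n: "n \<in> AB" for n
  proof -
    have nc: "n \<in> carrier R" "\<not> \<tau> n" using n by (auto simp: AB_def)
    show ?thesis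
    proof (cases "s = q")
      case True
      have "n \<in> A" if "n [^] q = \<one>"
      proof -
        have "(int q * \<beta> n) mod int r = 0" using rotation_pow[OF nc, of q] unfolding that coords_one by metis
        then have "\<beta> n = 0" by (rule pow_r_dvd[OF nc(1) _ coprime_qr(1)])
        then show ?thesis using nc by (simp add: A_def)
      qed
      moreover have "n [^] q = \<one>" if "n \<in> A"
        using pow_card_subgroup[OF parts_subgroup(1) that] finite_subset[OF subgroup.subset[OF parts_subgroup(1)] fin_R] card_parts(1) by simp
      ultimately show ?thesis using True by auto
    next
      case False
      then have sr: "s = r" using s by blast
      have "coprime r q" using coprime_qr(1) by (simp add: coprime_commute)
      have "n \<in> B" if "n [^] r = \<one>"
      proof -
        have "(int r * \<alpha> n) mod int q = 0" using \<alpha>_pow[OF nc(1), of r] unfolding that coords_one by metis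
        then have "\<alpha> n = 0" by (rule pow_q_dvd[OF nc(1) _ \<open>coprime r q\<close>])
        then show ?thesis using nc by (simp add: B_def)
      qed
      moreover have "n [^] r = \<one>" if "n \<in> B"
        using pow_card_subgroup[OF parts_subgroup(2) that] finite_subset[OF subgroup.subset[OF parts_subgroup(2)] fin_R] card_parts(2) by simp
      ultimately show ?thesis using False sr by auto
    qed
  qed
  have H: "(\<lambda>v. act v \<one>) ` ?V = ?H"
  proof
    show "(\<lambda>v. act v \<one>) ` ?V \<subseteq> ?H"
    proof
      fix y assume "y \<in> (\<lambda>v. act v \<one>) ` ?V"
      then obtain v where v: "v \<in> Z" "v [^]\<^bsub>G\<^esub> s = \<one>\<^bsub>G\<^esub>" "y = act v \<one>" by blast
      obtain n where n: "n \<in> AB" "act v \<one> = \<one> \<otimes> n" using orbit[OF v(1) one_closed] by blast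
      have "n [^] s = \<one>" using pow[OF v(1) one_closed n, of s] v(2) ABc[OF n(1)] by simp
      then show "y \<in> ?H" using Hpow[OF n(1)] v(3) n ABc[OF n(1)] by simp
    qed
    show "?H \<subseteq> (\<lambda>v. act v \<one>) ` ?V"
    proof
      fix y assume y: "y \<in> ?H"
      then have yAB: "y \<in> AB" by (auto simp: part_defs split: if_splits)
      have "\<rho> y [^]\<^bsub>G\<^esub> s = \<rho> (y [^] s)" using \<rho>_pow ABc yAB by simp
      then have "\<rho> y \<in> ?V" using \<rho>Z[OF yAB] Hpow[OF yAB] y by simp
      moreover have "y = act (\<rho> y) \<one>" using ABc yAB by simp
      ultimately show "y \<in> (\<lambda>v. act v \<one>) ` ?V" by blast
    qed
  qed
  have cH: "card ?H = s" using s card_parts by auto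
  have Vcomm: "\<forall>v\<in>?V. \<forall>w\<in>?V. v \<otimes>\<^bsub>G\<^esub> w = w \<otimes>\<^bsub>G\<^esub> v" using Zcomm by blast
  interpret cb: cayley_block R G \<rho> act S ?V s
    by (rule cayley_blockI[OF V Vcomm s_prime]) (simp only: H cH)
  have cbH: "cb.H = ?H" using H by (simp add: cb.H_def)
  have "u \<in> cb.K \<one>" using u Z(2) by (auto simp: cb.K_def stab_def)
  then have "cb.W \<noteq> carrier R" using u(2) by (intro cb.W_ne_carrier) blast
  \<comment> \<open>\<rho> maps \<open>AB\<close> into the abelian group Z, so it commutes with V.
    As \<open>AB\<close> has index 2 and u shows that \<open>W\<close> is not R, equality
    follows.\<close>
  moreover have ABW: "AB \<subseteq> cb.W"
    using cb.W_if_commutes ABc \<rho>Z Zcomm by blast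
  ultimately have W: "cb.W = AB"
    using prime_index_subgroup[OF fin_R parts_subgroup(4) cb.W_sub subgroup_self ABW subgroup.subset[OF cb.W_sub] _ two_is_prime_nat]
      card_parts(4,5) by auto
  show ?thesis
  proof (cases "s = q")
    case False
    obtain h where h: "h \<in> B" "h \<noteq> \<one>" using B_nontrivial by blast
    have "\<exists>x\<in>carrier R. h \<otimes> x \<noteq> x \<otimes> h" by (rule noncentral_D) (use h in \<open>auto simp: part_defs\<close>)
    moreover have "h \<in> cb.H" using cbH False h by simp
    ultimately show ?thesis
      using cb.nontrivial_aut_if_W_centralizes_H[of h] W AB_comm cb.H_W by blast
  next
    case True
    then have HA: "cb.H = A" using cbH by simp
    obtain t where t: "t \<in> D" "\<tau> t" "\<And>x. x \<in> carrier R \<Longrightarrow> refl_S ((2 * \<beta> t - \<beta> x) mod int r) \<longleftrightarrow> refl_S (\<beta> x)"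
      using reflection_for_S by blast
    have tc: "t \<in> carrier R" using t(1) parts_carrier by blast
    let ?f = "\<lambda>x. \<iota> (conjg R t x)"
    have f: "?f x \<in> carrier R" "\<alpha> (?f x) = (- \<alpha> x) mod int q" "\<tau> (?f x) = \<tau> x"
      "\<beta> (?f x) = (- \<beta> x + (if \<tau> x then 2 * \<beta> t else 0)) mod int r" if "x \<in> carrier R" for x
      using that tc t(2) by (simp_all add: \<iota> coords_conjg)
    have "(\<iota> \<circ> conjg R t) \<in> iso R R" by (rule iso_set_trans[OF conjg_iso[OF tc] \<iota>_iso])
    then have iso: "?f \<in> iso R R" by (simp add: comp_def)
    \<comment> \<open>Outside \<open>W\<close> = \<open>AB\<close>, S is a union of cosets of
      \<open>A\<close>, and each such coset contains one reflection of \<open>D\<close>.\<close>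
    have outside: "x \<in> S \<longleftrightarrow> refl_S (\<beta> x)" if x: "x \<in> carrier R" "\<tau> x" for x
    proof -
      obtain d where d: "d \<in> D" "\<beta> d = \<beta> x" "\<tau> d" using reflection_ex[of "\<beta> x"] \<beta>_range[OF x(1)] by blast
      have dc: "d \<in> carrier R" using d parts_carrier by blast
      have "d \<otimes> inv x \<in> cb.H" unfolding HA by (rule A_coset_iff) (use d dc x in auto)
      moreover have "x \<notin> cb.W" using x W by (simp add: AB_def)
      ultimately have "d \<otimes> inv x \<otimes> x \<in> S \<longleftrightarrow> x \<in> S" using cb.S_left_invariant x(1) by blast
      then show ?thesis using refl_S_iff[OF d(1,3)] d(2) dc x(1) by (simp add: m_assoc)
    qed
    have "?f x \<in> S \<longleftrightarrow> x \<in> S" if x: "x \<in> carrier R" for x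
    proof (cases "\<tau> x")
      case False
      have "?f x = inv x" by (rule coords_eq) (use f[OF x] x False in \<open>auto simp: coords_inv\<close>)
      then show ?thesis using S_inv[OF x] by simp
    next
      case True
      have "?f x \<in> S \<longleftrightarrow> refl_S ((2 * \<beta> t - \<beta> x) mod int r)"
        using outside[OF f(1)[OF x]] f[OF x] True by (simp add: add.commute)
      then show ?thesis using t(3)[OF x] outside[OF x True] by simp
    qed
    moreover obtain b where b: "b \<in> B" "b \<noteq> \<one>" using B_nontrivial by blast
    moreover have "?f b \<noteq> b"
    proof
      assume e: "?f b = b"
      have bc: "b \<in> carrier R" "\<alpha> b = 0" "\<not> \<tau> b" using b by (auto simp: B_def)
      then have "\<beta> b = 0" using f(4)[OF bc(1)] e neg_eq_self[OF bc(1)] by simp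
      then show False using coords_eq[OF bc(1) one_closed] bc b by simp
    qed
    ultimately show ?thesis using nontrivial_aut_fixingI[OF iso S_sub] parts_carrier(2) by blast
  qed
qed

lemma stab_not_le_Rh: "stab \<one> \<subseteq> Z \<Longrightarrow> \<not> Z \<subseteq> Rh"
  using Rh_stab stab_nontrivial by blast

text \<open>\<open>B\<close> is not self-centralising, so Z is intersected with the centraliser of
  \<rho> \<open>B\<close>; the intersection turns out to be Z, which is therefore abelian with
  \<open>H\<close> = \<open>B\<close>. As \<open>A\<close> is not in \<open>W\<close>,
  \<open>W\<close> lies in \<open>D\<close>. Conjugation by the chosen reflection moves every point
  by an element of \<open>B\<close>; inside \<open>D\<close> it inverts rotations and acts on
  reflections as a symmetry of \<open>refl_S\<close>.\<close>

lemma core_B_case: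
  assumes N: "N = B"
  shows "nontrivial_aut_fixing R S"
proof -
  have comm: "\<forall>x\<in>carrier R. \<forall>y\<in>carrier R. conjg R x y \<otimes> inv y \<in> N" using commutator_B N by blast
  from frobenius_kernel[OF comm]
  obtain Z where Z: "Z \<lhd> G" "stab \<one> \<subseteq> Z" "\<rho> ` N \<subseteq> Z" "Z \<inter> Rh = \<rho> ` N" "(\<lambda>v. act v \<one>) ` Z = N"
    and Z6: "\<forall>D. D \<lhd> G \<longrightarrow> D \<inter> Rh = \<rho> ` N \<longrightarrow> \<not> D \<subseteq> Rh \<longrightarrow> D = Z"
    by (elim exE conjE)
  have Zs: "subgroup Z G" using Z(1) by (rule normal_imp_subgroup)
  have Zc: "z \<in> carrier G" if "z \<in> Z" for z using Zs that by (rule subgroup.mem_carrier)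
  let ?C = "set_centralizer G (\<rho> ` N)"
  have C: "?C \<lhd> G" by (rule M.set_centralizer_normal[OF N_normal])
  have ZC: "Z \<inter> ?C \<lhd> G" using Z(1) C M.subgroups_Inter_pair by (auto simp: M.normal_iff_conjg)
  have NC: "\<rho> ` N \<subseteq> ?C" using \<rho>_centralizer[OF N_carrier] B_comm N N_carrier by blast
  have ZCR: "(Z \<inter> ?C) \<inter> Rh = \<rho> ` N" using Z(3,4) NC by blast
  have "\<not> Z \<inter> ?C \<subseteq> Rh"
  proof
    assume "Z \<inter> ?C \<subseteq> Rh"
    then have sub: "Z \<inter> ?C \<subseteq> \<rho> ` N" using ZCR by blast
    have ABs: "subgroup (\<rho> ` AB) G" by (rule \<rho>_subgroup[OF parts_subgroup(4)])
    \<comment> \<open>The commutator of z and \<rho> x lies in Z and in the centraliser of \<rho>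
      \<open>B\<close>, both normal in G, hence in \<rho> \<open>B\<close>. So Z would normalise
      \<rho> \<open>AB\<close>, whose normaliser is the regular subgroup.\<close>
    have "z \<in> set_normalizer G (\<rho> ` AB)" if z: "z \<in> Z" for z
    proof (rule M.set_normalizerI)
      show "\<rho> ` AB \<subseteq> carrier G" using ABs by (rule subgroup.subset)
      then show "finite (\<rho> ` AB)" using M.fin finite_subset by blast
      show "z \<in> carrier G" using Zc z by blast
      fix b assume "b \<in> \<rho> ` AB"
      then obtain x where x: "x \<in> AB" "b = \<rho> x" by blast
      have xc: "x \<in> carrier R" using x parts_carrier by blast
      have bc: "b \<in> carrier G" "z \<in> carrier G" using x xc Zc z by auto
      have bC: "b \<in> ?C"
        unfolding x(2) using \<rho>_centralizer[OF N_carrier xc] AB_comm x(1) N by (auto simp: part_defs)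
      let ?k = "conjg G z b \<otimes>\<^bsub>G\<^esub> inv\<^bsub>G\<^esub> b"
      have "?k \<in> ?C"
        using C bC bc normal_imp_subgroup[OF C] by (simp add: M.normal_iff_conjg subgroup.m_closed subgroup.m_inv_closed)
      moreover have "?k = z \<otimes>\<^bsub>G\<^esub> conjg G b (inv\<^bsub>G\<^esub> z)" using bc by (simp add: conjg_def M.m_assoc)
      moreover have "z \<otimes>\<^bsub>G\<^esub> conjg G b (inv\<^bsub>G\<^esub> z) \<in> Z"
        using Z(1) z bc Zs by (simp add: M.normal_iff_conjg subgroup.m_closed subgroup.m_inv_closed)
      ultimately have "?k \<in> \<rho> ` B" using sub N by auto
      then have "?k \<in> \<rho> ` AB" by (auto simp: part_defs)
      then have "?k \<otimes>\<^bsub>G\<^esub> b \<in> \<rho> ` AB" using x subgroup.m_closed[OF ABs] by blast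
      then show "conjg G z b \<in> \<rho> ` AB" using bc by (simp add: M.m_assoc)
    qed
    moreover have "\<not> AB \<subseteq> N" using A_not_le_D N by (auto simp: part_defs)
    ultimately have "Z \<subseteq> Rh" using normalizer_\<rho>[OF parts_normal(4)] by blast
    then show False using stab_not_le_Rh[OF Z(2)] by blast
  qed
  then have "Z \<inter> ?C = Z" using Z6 ZC ZCR by blast
  then have cent: "v \<otimes>\<^bsub>G\<^esub> \<rho> a = \<rho> a \<otimes>\<^bsub>G\<^esub> v" if "v \<in> Z" "a \<in> B" for v a
    using that N by (auto simp: set_centralizer_def)
  have Zcomm: "\<forall>v\<in>Z. \<forall>w\<in>Z. v \<otimes>\<^bsub>G\<^esub> w = w \<otimes>\<^bsub>G\<^esub> v"
    using commute_if_centralizes[OF Z(1) _ parts_normal(2) B_comm cent] Z(5) N by blast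
  interpret cb: cayley_block R G \<rho> act S Z r
    by (rule cayley_blockI[OF Z(1) Zcomm r_prime]) (simp add: Z(5) N card_parts)
  have HB: "cb.H = B" using Z(5) N by (simp add: cb.H_def)
  have "\<not> A \<subseteq> cb.W"
  proof
    assume "A \<subseteq> cb.W"
    then have "\<rho> ` A \<lhd> G"
      using cb.prime_normal_if_in_W[OF parts_normal(1) _ card_parts(1) q_prime q_ndvd stab_not_le_Rh[OF Z(2)]] by blast
    then have "A \<subseteq> B" using normal_le_N[OF subgroup.subset[OF parts_subgroup(1)]] N by blast
    then show False using A_not_le_D by (auto simp: part_defs)
  qed
  then have WD: "cb.W \<subseteq> D" using pow_2r_D[OF _ cb.W_sub] cb.W_carrier by blast
  obtain t where t: "t \<in> D" "\<tau> t" "\<And>x. x \<in> carrier R \<Longrightarrow> refl_S ((2 * \<beta> t - \<beta> x) mod int r) \<longleftrightarrow> refl_S (\<beta> x)"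
    using reflection_for_S by blast
  have tc: "t \<in> carrier R" using t(1) parts_carrier by blast
  have tD: "conjg R t x \<in> D" if "x \<in> D" for x using that parts_normal(3) tc by (simp add: normal_iff_conjg)
  have "t \<noteq> \<one>" using t by auto
  then obtain y where y: "y \<in> carrier R" "t \<otimes> y \<noteq> y \<otimes> t" using noncentral_D[OF t(1)] by blast
  show ?thesis
  proof (rule nontrivial_aut_if_conjg[OF tc _ y])
    fix x assume x: "x \<in> carrier R"
    show "conjg R t x \<in> S \<longleftrightarrow> x \<in> S"
    proof (cases "x \<in> cb.W")
      case False
      have "conjg R t x \<otimes> inv x \<in> cb.H" using commutator_B[OF tc x] HB by simp
      then have "conjg R t x \<otimes> inv x \<otimes> x \<in> S \<longleftrightarrow> x \<in> S" using cb.S_left_invariant[OF x False] by blast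
      then show ?thesis using tc x by (simp add: m_assoc)
    next
      case True
      then have xD: "x \<in> D" using WD by blast
      show ?thesis
      proof (cases "\<tau> x")
        case True
        have "conjg R t x \<in> S \<longleftrightarrow> refl_S ((2 * \<beta> t - \<beta> x) mod int r)"
          using refl_S_iff[OF tD[OF xD]] coords_conjg[OF tc x] True t(2) by (simp add: add.commute)
        then show ?thesis using t(3)[OF x] refl_S_iff[OF xD True] by simp
      next
        case False
        have "conjg R t x = inv x"
          by (rule coords_eq) (use coords_conjg[OF tc x] coords_inv[OF x] tc x xD False t(2) in \<open>auto simp: D_def\<close>)
        then show ?thesis using S_inv[OF x] by simp
      qed
    qed
  qed
qed

text \<open>\<open>A\<close> is kept out of \<open>W\<close>, so \<open>W\<close> lies in
  \<open>D\<close>. As \<open>D\<close> is nonabelian, \<open>W\<close> may fail to centralise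
  \<open>H\<close>, but \<rho> \<open>W\<close> centralises V. A nontrivial h in \<open>H\<close>
  gives a nontrivial conjugation because \<open>D\<close> has trivial centre.\<close>

lemma core_D_block_case:
  assumes N: "N = D" and V: "V \<lhd> G" "V \<noteq> {\<one>\<^bsub>G\<^esub>}" "V \<inter> Rh = {\<one>\<^bsub>G\<^esub>}"
    and comm: "\<forall>v\<in>V. \<forall>w\<in>V. v \<otimes>\<^bsub>G\<^esub> w = w \<otimes>\<^bsub>G\<^esub> v"
    and cent: "\<And>v a. v \<in> V \<Longrightarrow> a \<in> D \<Longrightarrow> v \<otimes>\<^bsub>G\<^esub> \<rho> a = \<rho> a \<otimes>\<^bsub>G\<^esub> v"
    and orb: "(\<lambda>v. act v \<one>) ` V \<subseteq> D" "card ((\<lambda>v. act v \<one>) ` V) = p"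
    and p: "Factorial_Ring.prime p" "\<not> q dvd p - 1"
  shows "nontrivial_aut_fixing R S"
proof -
  interpret cb: cayley_block R G \<rho> act S V p by (rule cayley_blockI[OF V(1) comm p(1) orb(2)])
  have VR: "\<not> V \<subseteq> Rh" using V subgroup.one_closed[OF normal_imp_subgroup[OF V(1)]] by blast
  have "\<not> A \<subseteq> cb.W"
  proof
    assume "A \<subseteq> cb.W"
    then have "\<rho> ` A \<lhd> G"
      using cb.prime_normal_if_in_W[OF parts_normal(1) _ card_parts(1) q_prime p(2) VR] by blast
    then have "A \<subseteq> D" using normal_le_N[OF subgroup.subset[OF parts_subgroup(1)]] N by blast
    then show False using A_not_le_D by blast
  qed
  then have WD: "cb.W \<subseteq> D" using pow_2r_D[OF _ cb.W_sub] cb.W_carrier by blast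
  have "cb.H \<noteq> {\<one>}" using orbit_nontrivial[OF V(1,2)] by (simp add: cb.H_def)
  then obtain h where h: "h \<in> cb.H" "h \<noteq> \<one>" using subgroup.one_closed[OF cb.H_sub] by blast
  moreover have "h \<in> D" using h(1) orb(1) by (auto simp: cb.H_def)
  ultimately obtain y where y: "y \<in> carrier R" "h \<otimes> y \<noteq> y \<otimes> h" using noncentral_D by blast
  show ?thesis by (rule cb.nontrivial_aut_if_W_centralizes_V[OF _ h(1) y]) (use WD cent in blast)
qed

text \<open>A reflection has order two, and r is odd.\<close>

lemma D_pow_r: "d \<in> D \<Longrightarrow> d [^] r = \<one> \<longleftrightarrow> d \<in> B"
proof -
  assume d: "d \<in> D"
  have dc: "d \<in> carrier R" "\<alpha> d = 0" using d by (auto simp: D_def)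
  have "d [^] r = \<one>" if "d \<in> B"
    using pow_card_subgroup[OF parts_subgroup(2) that] finite_subset[OF subgroup.subset[OF parts_subgroup(2)] fin_R] card_parts(2) by simp
  moreover have "\<not> \<tau> d" if e: "d [^] r = \<one>"
  proof
    assume t: "\<tau> d"
    have "d \<otimes> d = \<one>" by (rule coords_eq) (use dc reflection_square[OF dc(1) t] in \<open>auto simp: \<alpha>_mult\<close>)
    then have "d [^] (2::nat) = \<one>" using dc(1) by (simp add: numeral_2_eq_2)
    then have "d = \<one>" using pow_coprime_eq_one[OF dc(1) e] coprime_qr(3) by blast
    then show False using t by simp
  qed
  ultimately show ?thesis using dc by (auto simp: B_def)
qed

text \<open>The centraliser of \<rho> \<open>D\<close> meets the regular subgroup in \<rho>
  \<open>A\<close>. It is not contained there, because \<open>A\<close> is not in the core; so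
  together with \<rho> \<open>D\<close> it generates G. Its intersection Y with the kernel is then
  nontrivial and meets the regular subgroup trivially. A normal subgroup of G inside Y with orbits
  of length r or 2 goes into \<open>core_D_block_case\<close>.\<close>

lemma core_D_case:
  assumes N: "N = D"
  shows "nontrivial_aut_fixing R S"
proof -
  have BD: "B \<subseteq> D" by (auto simp: part_defs)
  have comm: "\<forall>x\<in>carrier R. \<forall>y\<in>carrier R. conjg R x y \<otimes> inv y \<in> N" using commutator_B N BD by blast
  from frobenius_kernel[OF comm]
  obtain Z where Z: "Z \<lhd> G" "stab \<one> \<subseteq> Z" "\<rho> ` N \<subseteq> Z" "Z \<inter> Rh = \<rho> ` N" "(\<lambda>v. act v \<one>) ` Z = N"
    by (elim exE conjE)
  have Zs: "subgroup Z G" using Z(1) by (rule normal_imp_subgroup)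
  let ?C = "set_centralizer G (\<rho> ` N)"
  have C: "?C \<lhd> G" by (rule M.set_centralizer_normal[OF N_normal])
  have Cs: "subgroup ?C G" using C by (rule normal_imp_subgroup)
  have Ns: "subgroup (\<rho> ` N) G" using N_normal by (rule normal_imp_subgroup)
  have AC: "\<rho> a \<in> ?C" if "a \<in> A" for a
    using \<rho>_centralizer[OF N_carrier] A_central[OF that] N_carrier parts_carrier(1)[OF that] by blast
  have CA: "?C \<inter> Rh \<subseteq> \<rho> ` A" using \<rho>_centralizer[OF N_carrier] centralizer_D N by blast
  have CN: "subgroup (?C <#>\<^bsub>G\<^esub> \<rho> ` N) G"
    by (rule M.set_mult_subgroup[OF Ns Cs]) (use C subgroup.mem_carrier[OF Ns] in \<open>auto simp: M.normal_iff_conjg\<close>)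
  have "Rh \<subseteq> ?C <#>\<^bsub>G\<^esub> \<rho> ` N"
  proof
    fix y assume "y \<in> Rh"
    then obtain x where x: "x \<in> carrier R" "y = \<rho> x" by blast
    obtain a d where ad: "a \<in> A" "d \<in> D" "x = d \<otimes> a" using part_products[OF x(1)] by blast
    have "y = \<rho> a \<otimes>\<^bsub>G\<^esub> \<rho> d" using ad x(2) parts_carrier by (simp add: \<rho>_mult)
    then show "y \<in> ?C <#>\<^bsub>G\<^esub> \<rho> ` N" using AC[OF ad(1)] ad(2) N unfolding set_mult_def by blast
  qed
  moreover have "?C <#>\<^bsub>G\<^esub> \<rho> ` N \<noteq> Rh"
  proof
    assume e: "?C <#>\<^bsub>G\<^esub> \<rho> ` N = Rh"
    have "?C \<subseteq> Rh"
    proof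
      fix k assume k: "k \<in> ?C"
      have "k = k \<otimes>\<^bsub>G\<^esub> \<one>\<^bsub>G\<^esub>" using subgroup.mem_carrier[OF Cs k] by simp
      then have "k \<in> ?C <#>\<^bsub>G\<^esub> \<rho> ` N" using k subgroup.one_closed[OF Ns] unfolding set_mult_def by blast
      then show "k \<in> Rh" using e by simp
    qed
    then have "?C = \<rho> ` A" using CA AC by blast
    then have "A \<subseteq> D" using normal_le_N[OF subgroup.subset[OF parts_subgroup(1)]] C N by simp
    then show False using A_not_le_D by blast
  qed
  ultimately have CNG: "?C <#>\<^bsub>G\<^esub> \<rho> ` N = carrier G" using M.over_R[OF CN] by blast
  let ?Y = "Z \<inter> ?C"
  have Y: "?Y \<lhd> G" using Z(1) C M.subgroups_Inter_pair by (auto simp: M.normal_iff_conjg)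
  have Ys: "subgroup ?Y G" using Y by (rule normal_imp_subgroup)
  have Yc: "v \<in> carrier G" if "v \<in> ?Y" for v using Ys that by (rule subgroup.mem_carrier)
  have YR: "?Y \<inter> Rh = {\<one>\<^bsub>G\<^esub>}"
  proof
    show "?Y \<inter> Rh \<subseteq> {\<one>\<^bsub>G\<^esub>}"
    proof
      fix y assume y: "y \<in> ?Y \<inter> Rh"
      obtain a where a: "a \<in> A" "y = \<rho> a" using y CA by blast
      obtain d where d: "d \<in> D" "y = \<rho> d" using y Z(4) N by blast
      have "a = d" using a d parts_carrier by simp
      then have "d = \<one>" using parts_disjoint a(1) d(1) by blast
      then show "y \<in> {\<one>\<^bsub>G\<^esub>}" using d(2) by simp
    qed
    show "{\<one>\<^bsub>G\<^esub>} \<subseteq> ?Y \<inter> Rh" using subgroup.one_closed[OF Ys] subgroup.one_closed[OF M.R_sub] by blast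
  qed
  have Yne: "?Y \<noteq> {\<one>\<^bsub>G\<^esub>}"
  proof
    assume Y1: "?Y = {\<one>\<^bsub>G\<^esub>}"
    obtain g where g: "g \<in> stab \<one>" "g \<noteq> \<one>\<^bsub>G\<^esub>"
      using stab_nontrivial subgroup.one_closed[OF stab_subgroup[OF one_closed]] by blast
    have gZ: "g \<in> Z" using g Z(2) by blast
    then have "g \<in> ?C <#>\<^bsub>G\<^esub> \<rho> ` N" using CNG subgroup.mem_carrier[OF Zs] by simp
    then obtain k n where kn: "k \<in> ?C" "n \<in> \<rho> ` N" "g = k \<otimes>\<^bsub>G\<^esub> n" by (auto simp: set_mult_def)
    have c: "k \<in> carrier G" "n \<in> carrier G" using kn subgroup.mem_carrier[OF Cs] subgroup.mem_carrier[OF Ns] by auto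
    have "k = g \<otimes>\<^bsub>G\<^esub> inv\<^bsub>G\<^esub> n" using c by (simp add: kn(3) M.m_assoc)
    then have "k \<in> Z" using gZ kn(2) Z(3) Zs by (auto simp: subgroup.m_closed subgroup.m_inv_closed)
    then have "k = \<one>\<^bsub>G\<^esub>" using kn(1) Y1 by blast
    then have "g \<in> Rh" using kn c \<rho>N_Rh by auto
    then show False using g Rh_stab by blast
  qed
  have cent: "v \<otimes>\<^bsub>G\<^esub> \<rho> a = \<rho> a \<otimes>\<^bsub>G\<^esub> v" if "v \<in> ?Y" "a \<in> D" for v a
    using that N by (auto simp: set_centralizer_def)
  have orbY: "(\<lambda>v. act v \<one>) ` ?Y \<subseteq> D" using Z(5) N by blast
  have orbit: "\<exists>n\<in>D. act v x = x \<otimes> n" if "v \<in> ?Y" "x \<in> carrier R" for v x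
    using orbit_in_coset[OF Y orbY parts_normal(3) that] .
  have pow: "act (v [^]\<^bsub>G\<^esub> k) x = x \<otimes> n [^] k" if "v \<in> ?Y" "x \<in> carrier R" "n \<in> D" "act v x = x \<otimes> n" for v x n and k :: nat
    using that Yc parts_carrier(3) cent by (intro act_pow) auto
  \<comment> \<open>By \<open>V_iff\<close> these are the elements of Y moving every point by a
    rotation; in that form closure under products is visible before Y is known to be
    abelian.\<close>
  define V where "V = {v \<in> ?Y. v [^]\<^bsub>G\<^esub> r = \<one>\<^bsub>G\<^esub>}"
  have V_iff: "v [^]\<^bsub>G\<^esub> r = \<one>\<^bsub>G\<^esub> \<longleftrightarrow> (\<forall>x\<in>carrier R. \<exists>n\<in>B. act v x = x \<otimes> n)" if v: "v \<in> ?Y" for v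
  proof
    assume e: "v [^]\<^bsub>G\<^esub> r = \<one>\<^bsub>G\<^esub>"
    show "\<forall>x\<in>carrier R. \<exists>n\<in>B. act v x = x \<otimes> n"
    proof
      fix x assume x: "x \<in> carrier R"
      obtain n where n: "n \<in> D" "act v x = x \<otimes> n" using orbit[OF v x] by blast
      have "x \<otimes> n [^] r = x" using pow[OF v x n, of r] e x by simp
      then have "n [^] r = \<one>" using x n(1) parts_carrier(3) by simp
      then show "\<exists>n\<in>B. act v x = x \<otimes> n" using D_pow_r[OF n(1)] n(2) by blast
    qed
  next
    assume a: "\<forall>x\<in>carrier R. \<exists>n\<in>B. act v x = x \<otimes> n"
    show "v [^]\<^bsub>G\<^esub> r = \<one>\<^bsub>G\<^esub>"
    proof (rule faithful)
      fix x assume x: "x \<in> carrier R"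
      obtain n where n: "n \<in> B" "act v x = x \<otimes> n" using a x by blast
      have nD: "n \<in> D" using n BD by blast
      then have "n [^] r = \<one>" using D_pow_r n(1) by blast
      then show "act (v [^]\<^bsub>G\<^esub> r) x = act \<one>\<^bsub>G\<^esub> x" using pow[OF v x nD n(2), of r] x by simp
    qed (use Yc v in auto)
  qed
  have V: "V \<lhd> G"
    unfolding M.normal_iff_conjg
  proof (intro conjI ballI)
    show "subgroup V G"
    proof (rule M.subgroupI)
      have "\<one>\<^bsub>G\<^esub> \<in> V" using subgroup.one_closed[OF Ys] by (simp add: V_def)
      then show "V \<noteq> {}" by blast
      show "V \<subseteq> carrier G" using Yc by (auto simp: V_def)
      show "inv\<^bsub>G\<^esub> a \<in> V" if "a \<in> V" for a
        using that Yc subgroup.m_inv_closed[OF Ys, of a] by (simp add: V_def M.nat_pow_inv)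
      show "a \<otimes>\<^bsub>G\<^esub> b \<in> V" if ab: "a \<in> V" "b \<in> V" for a b
      proof -
        have abY: "a \<in> ?Y" "b \<in> ?Y" "a \<otimes>\<^bsub>G\<^esub> b \<in> ?Y" using ab subgroup.m_closed[OF Ys] by (auto simp: V_def)
        have "\<exists>n\<in>B. act (a \<otimes>\<^bsub>G\<^esub> b) x = x \<otimes> n" if x: "x \<in> carrier R" for x
        proof -
          obtain n where n: "n \<in> B" "act b x = x \<otimes> n" using V_iff[OF abY(2)] ab(2) x by (auto simp: V_def)
          obtain m where m: "m \<in> B" "act a x = x \<otimes> m" using V_iff[OF abY(1)] ab(1) x by (auto simp: V_def)
          have nm: "n \<in> carrier R" "m \<in> carrier R" "n \<in> D" using n m BD parts_carrier by auto
          have "act (a \<otimes>\<^bsub>G\<^esub> b) x = act a (x \<otimes> n)" using n abY Yc x by (simp add: act_mult)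
          also have "\<dots> = act a x \<otimes> n" by (rule act_shift) (use abY Yc nm x cent in auto)
          also have "\<dots> = x \<otimes> (m \<otimes> n)" using m nm x by (simp add: m_assoc)
          finally show ?thesis using subgroup.m_closed[OF parts_subgroup(2) m(1) n(1)] by blast
        qed
        then show ?thesis using V_iff[OF abY(3)] abY(3) by (simp add: V_def)
      qed
    qed
    show "conjg G g v \<in> V" if "g \<in> carrier G" "v \<in> V" for g v
      using that Y Yc by (auto simp: V_def M.normal_iff_conjg M.conjg_of_pow[symmetric])
  qed
  have Vs: "subgroup V G" using V by (rule normal_imp_subgroup)
  have VY: "V \<subseteq> ?Y" by (auto simp: V_def)
  show ?thesis
  proof (cases "V = {\<one>\<^bsub>G\<^esub>}")
    case False
    have orbV: "(\<lambda>v. act v \<one>) ` V \<subseteq> B"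
    proof
      fix y assume "y \<in> (\<lambda>v. act v \<one>) ` V"
      then obtain v where v: "v \<in> V" "y = act v \<one>" by blast
      then obtain n where "n \<in> B" "act v \<one> = \<one> \<otimes> n" using V_iff[of v] one_closed by (auto simp: V_def)
      then show "y \<in> B" using v(2) parts_carrier by simp
    qed
    have centV: "v \<otimes>\<^bsub>G\<^esub> \<rho> a = \<rho> a \<otimes>\<^bsub>G\<^esub> v" if "v \<in> V" "a \<in> D" for v a
      using cent that VY by blast
    then have Vcomm: "\<forall>v\<in>V. \<forall>w\<in>V. v \<otimes>\<^bsub>G\<^esub> w = w \<otimes>\<^bsub>G\<^esub> v"
      using commute_if_centralizes[OF V orbV parts_normal(2) B_comm] BD by blast
    have orbB: "(\<lambda>v. act v \<one>) ` V = B"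
    proof
      obtain h where h: "h \<in> (\<lambda>v. act v \<one>) ` V" "h \<noteq> \<one>"
        using orbit_nontrivial[OF V False] subgroup.one_closed[OF orbit_subgroup[OF V]] by blast
      show "B \<subseteq> (\<lambda>v. act v \<one>) ` V"
        using prime_subgroup_eq[OF fin_R parts_subgroup(2) _ orbit_subgroup[OF V] _ h] orbV h(1) card_parts(2) r_prime by auto
    qed (rule orbV)
    have VR: "V \<inter> Rh = {\<one>\<^bsub>G\<^esub>}" using VY YR subgroup.one_closed[OF Vs] by blast
    have orbs: "(\<lambda>v. act v \<one>) ` V \<subseteq> D" "card ((\<lambda>v. act v \<one>) ` V) = r"
      unfolding orbB using BD card_parts(2) by auto
    show ?thesis by (rule core_D_block_case[OF N V False VR Vcomm _ orbs r_prime q_ndvd]) (rule centV)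
  next
    case True
    \<comment> \<open>The square of an element of \<open>D\<close> is a rotation, so v v lies in V,
      which is trivial here. Hence Y has exponent two and is abelian.\<close>
    have sq: "v \<otimes>\<^bsub>G\<^esub> v = \<one>\<^bsub>G\<^esub>" if v: "v \<in> ?Y" for v
    proof -
      have vv: "v \<otimes>\<^bsub>G\<^esub> v \<in> ?Y" using v subgroup.m_closed[OF Ys] by blast
      have "\<exists>n\<in>B. act (v \<otimes>\<^bsub>G\<^esub> v) x = x \<otimes> n" if x: "x \<in> carrier R" for x
      proof -
        obtain n where n: "n \<in> D" "act v x = x \<otimes> n" using orbit[OF v x] by blast
        have nc: "n \<in> carrier R" "\<alpha> n = 0" using n by (auto simp: D_def)
        have "act (v \<otimes>\<^bsub>G\<^esub> v) x = act v (x \<otimes> n)" using n v Yc x by (simp add: act_mult)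
        also have "\<dots> = act v x \<otimes> n" by (rule act_shift) (use v Yc nc n x cent in auto)
        also have "\<dots> = x \<otimes> (n \<otimes> n)" using n nc x by (simp add: m_assoc)
        finally have e: "act (v \<otimes>\<^bsub>G\<^esub> v) x = x \<otimes> (n \<otimes> n)" .
        have "n \<otimes> n \<in> B" using nc by (simp add: B_def \<alpha>_mult \<tau>_mult)
        then show ?thesis using e by blast
      qed
      then have "v \<otimes>\<^bsub>G\<^esub> v \<in> V" using V_iff[OF vv] vv by (simp add: V_def)
      then show ?thesis using True by blast
    qed
    have commY: "\<forall>v\<in>?Y. \<forall>w\<in>?Y. v \<otimes>\<^bsub>G\<^esub> w = w \<otimes>\<^bsub>G\<^esub> v"
    proof (intro ballI)
      fix v w assume vw: "v \<in> ?Y" "w \<in> ?Y"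
      have c: "v \<in> carrier G" "w \<in> carrier G" using vw Yc by auto
      have i: "inv\<^bsub>G\<^esub> v = v" "inv\<^bsub>G\<^esub> w = w" "inv\<^bsub>G\<^esub> (v \<otimes>\<^bsub>G\<^esub> w) = v \<otimes>\<^bsub>G\<^esub> w"
        using sq[OF vw(1)] sq[OF vw(2)] sq[OF subgroup.m_closed[OF Ys vw]] c by (auto intro: M.inv_equality)
      then show "v \<otimes>\<^bsub>G\<^esub> w = w \<otimes>\<^bsub>G\<^esub> v" using M.inv_mult_group[OF c] by simp
    qed
    define K where "K = (\<lambda>v. act v \<one>) ` ?Y"
    have H: "subgroup K R" unfolding K_def by (rule orbit_subgroup[OF Y])
    have Hsq: "h \<otimes> h = \<one>" if hH: "h \<in> K" for h
    proof -
      obtain v where v: "v \<in> ?Y" "h = act v \<one>" using hH unfolding K_def by blast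
      have hc: "h \<in> D" "h \<in> carrier R" using v orbY parts_carrier by blast+
      have "act v (\<one> \<otimes> h) = act v \<one> \<otimes> h" by (rule act_shift) (use v hc Yc cent in auto)
      then have "act (v \<otimes>\<^bsub>G\<^esub> v) \<one> = h \<otimes> h" using v hc Yc by (simp add: act_mult)
      then show ?thesis using sq[OF v(1)] by simp
    qed
    \<comment> \<open>Elements of the orbit square to \<open>\<one>\<close>, so the nontrivial ones
      are reflections. A product of two reflections is not a reflection, and therefore the orbit has
      only two elements.\<close>
    have Hrefl: "\<tau> h" if h: "h \<in> K" "h \<noteq> \<one>" for h
    proof (rule ccontr)
      assume t: "\<not> \<tau> h"
      have hc: "h \<in> carrier R" "\<alpha> h = 0" using subsetD[OF orbY, folded K_def, OF h(1)] by (simp_all add: D_def)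
      have "\<beta> (h \<otimes> h) = 0" unfolding Hsq[OF h(1)] by (rule coords_one)
      then have "(2 * \<beta> h) mod int r = 0" unfolding \<beta>_mult[OF hc(1,1)] if_not_P[OF t] mult_2 .
      then have "\<beta> h = 0" by (rule dvd_double) (use \<beta>_range[OF hc(1)] in blast)+
      then show False using coords_eq[OF hc(1) one_closed] hc t h(2) by simp
    qed
    obtain h where h: "h \<in> K" "h \<noteq> \<one>"
      using orbit_nontrivial[OF Y Yne, folded K_def] subgroup.one_closed[OF H] by blast
    have "K = {\<one>, h}"
    proof
      show "{\<one>, h} \<subseteq> K" using h subgroup.one_closed[OF H] by blast
      show "K \<subseteq> {\<one>, h}"
      proof
        fix k assume k: "k \<in> K"
        show "k \<in> {\<one>, h}"
        proof (cases "k = \<one>")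
          case False
          have c: "k \<in> carrier R" "h \<in> carrier R" using k h subgroup.mem_carrier[OF H] by auto
          have "\<not> \<tau> (k \<otimes> h)" using \<tau>_mult[OF c] Hrefl[OF k False] Hrefl[OF h] by simp
          then have "k \<otimes> h = \<one>" using Hrefl subgroup.m_closed[OF H k h(1)] by blast
          then have "k = inv h" using inv_equality c by simp
          moreover have "inv h = h" using inv_equality[OF Hsq[OF h(1)] c(2,2)] .
          ultimately show ?thesis by simp
        qed simp
      qed
    qed
    then have H2: "card K = 2" using h(2) by simp
    have "\<not> q dvd 2 - 1" using prime_gt_1_nat[OF q_prime] by simp
    then show ?thesis
      by (intro core_D_block_case[OF N Y Yne YR commY _ orbY H2[unfolded K_def] two_is_prime_nat]) (rule cent)
  qed
qed

text \<open>\<open>A\<close> is central in R, so its centraliser in G is a normal subgroup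
  containing the regular subgroup, which is maximal but not normal.\<close>

lemma core_A_central:
  assumes N: "N = A" and g: "g \<in> carrier G" and a: "a \<in> A"
  shows "g \<otimes>\<^bsub>G\<^esub> \<rho> a = \<rho> a \<otimes>\<^bsub>G\<^esub> g"
proof -
  let ?C = "set_centralizer G (\<rho> ` N)"
  have C: "?C \<lhd> G" by (rule M.set_centralizer_normal[OF N_normal])
  have "Rh \<subseteq> ?C" using \<rho>_centralizer[OF N_carrier] A_central N by (metis image_subsetI)
  then have "?C = carrier G" using M.over_R[OF normal_imp_subgroup[OF C]] C not_normal by metis
  then have "g \<in> ?C" using g by simp
  then show ?thesis using a N by (auto simp: set_centralizer_def)
qed

text \<open>The q-group M has orbit \<open>A\<close>, as q^2 does not divide |R|, and it is abelian
  because \<rho> \<open>A\<close> is central in G. Once \<open>B\<close> is excluded from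
  \<open>W\<close>, \<iota> inverts the elements of \<open>W\<close> and moves all other points
  within cosets of \<open>A\<close>.\<close>

lemma core_A_q_case:
  assumes N: "N = A" and V: "M \<lhd> G" "\<rho> ` N \<subseteq> M" "M \<inter> Rh = \<rho> ` N" "card M = q ^ Suc n" "n > 0"
  shows "nontrivial_aut_fixing R S"
proof -
  have Ms: "subgroup M G" using V(1) by (rule normal_imp_subgroup)
  let ?H = "(\<lambda>v. act v \<one>) ` M"
  have H: "subgroup ?H R" by (rule orbit_subgroup[OF V(1)])
  have fH: "finite ?H" using fin_R subgroup.subset[OF H] finite_subset by blast
  have AH: "A \<subseteq> ?H"
  proof
    fix a assume a: "a \<in> A"
    then have "a = act (\<rho> a) \<one>" "\<rho> a \<in> M" using parts_carrier V(2) N by auto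
    then show "a \<in> ?H" by blast
  qed
  have "card ?H dvd q ^ Suc n" using orbit_stabilizer_card[OF Ms one_closed] V(4) by (metis dvd_triv_left)
  then obtain i where i: "card ?H = q ^ i" using divides_primepow_nat[OF q_prime] by blast
  have HR: "card ?H dvd card (carrier R)" by (rule card_subgroup_dvd[OF H subgroup_self subgroup.subset[OF H]])
  have "i \<le> 1"
  proof (rule ccontr)
    assume "\<not> i \<le> 1"
    then have "q ^ 2 dvd card ?H" unfolding i by (intro le_imp_power_dvd) simp
    then show False using sq_ndvd(1) HR dvd_trans by (metis power2_eq_square)
  qed
  then have "card ?H \<le> q" using i prime_gt_0_nat[OF q_prime] by (cases i) auto
  then have HA: "?H = A" using card_seteq[OF fH AH] card_parts(1) by simp
  have comm: "\<forall>v\<in>M. \<forall>w\<in>M. v \<otimes>\<^bsub>G\<^esub> w = w \<otimes>\<^bsub>G\<^esub> v"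
    using commute_if_centralizes[OF V(1) _ parts_normal(1)] HA A_central parts_carrier(1) core_A_central[OF N] subgroup.mem_carrier[OF Ms]
    by (metis order_refl)
  interpret cb: cayley_block R G \<rho> act S M q
    by (rule cayley_blockI[OF V(1) comm q_prime]) (simp add: HA card_parts)
  have cbH: "cb.H = A" using HA by (simp add: cb.H_def)
  have MR: "\<not> M \<subseteq> Rh"
  proof
    assume "M \<subseteq> Rh"
    then have "M = \<rho> ` A" using V(3) N by (metis Int_absorb2)
    then have "card M = q" using card_image[OF \<rho>_inj[OF subgroup.subset[OF parts_subgroup(1)]]] card_parts(1) by simp
    then have "q ^ n = 1" using V(4) prime_gt_0_nat[OF q_prime] by simp
    then show False using V(5) prime_gt_1_nat[OF q_prime] by simp
  qed
  have BW: "\<not> B \<subseteq> cb.W"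
  proof
    assume BW: "B \<subseteq> cb.W"
    have "conjg G (\<rho> b) v \<otimes>\<^bsub>G\<^esub> inv\<^bsub>G\<^esub> v \<in> cb.K \<one>" if b: "b \<in> B" and v: "v \<in> M" for b v
    proof -
      obtain a where a: "a \<in> A" "act v \<one> = a" using HA v by blast
      have c: "a \<in> carrier R" "b \<in> carrier R" "v \<in> carrier G" using a b v parts_carrier cb.V_carrier by auto
      let ?k = "\<rho> (inv a) \<otimes>\<^bsub>G\<^esub> v"
      have "inv a \<in> A" using a subgroup.m_inv_closed[OF parts_subgroup(1)] by blast
      then have kM: "?k \<in> M" using V(2) N v subgroup.m_closed[OF Ms] by blast
      have kK: "?k \<in> cb.K \<one>" using kM a c by (simp add: cb.K_def act_mult)
      have kc: "?k \<in> carrier G" using c by simp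
      have ve: "v = \<rho> a \<otimes>\<^bsub>G\<^esub> ?k" using c by (simp add: \<rho>_inv)
      have ca: "conjg G (\<rho> b) (\<rho> a) = \<rho> a" using core_A_central[OF N _ a(1), of "\<rho> b"] c by (subst M.conjg_eq_iff) auto
      have "conjg G (\<rho> b) v = \<rho> a \<otimes>\<^bsub>G\<^esub> conjg G (\<rho> b) ?k"
        using c kc ca by (subst ve) (simp add: M.conjg_of_mult del: M.m_assoc)
      then have "conjg G (\<rho> b) v \<otimes>\<^bsub>G\<^esub> inv\<^bsub>G\<^esub> v = conjg G (\<rho> a) (conjg G (\<rho> b) ?k \<otimes>\<^bsub>G\<^esub> inv\<^bsub>G\<^esub> ?k)"
        using c kc by (subst (2) ve) (simp add: conjg_def[of G "\<rho> a"] M.inv_mult_group M.m_assoc)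
      also have "\<dots> = conjg G (\<rho> b) ?k \<otimes>\<^bsub>G\<^esub> inv\<^bsub>G\<^esub> ?k"
        using c kc core_A_central[OF N _ a(1)] by (subst M.conjg_eq_iff) auto
      finally show ?thesis
        using cb.W_conj_K[of b, OF _ kK] b BW kK subgroup.m_closed[OF cb.K_sub[OF one_closed]]
          subgroup.m_inv_closed[OF cb.K_sub[OF one_closed]] by auto
    qed
    then have "\<rho> ` B \<lhd> G"
      by (intro \<rho>_normal_if_commutes[OF parts_normal(2) V(1) MR] cb.centralizes_V[OF parts_normal(2) BW])
    then have "B \<subseteq> A" using normal_le_N[OF subgroup.subset[OF parts_subgroup(2)]] N by blast
    then show False using B_not_le_A by blast
  qed
  have "\<iota> x \<in> S \<longleftrightarrow> x \<in> S" if x: "x \<in> carrier R" for x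
  proof (cases "x \<in> cb.W")
    case True
    \<comment> \<open>An element of \<open>W\<close> is in \<open>A\<close> or a reflection, and in
      both cases inversion changes only the C_q coordinate.\<close>
    have "\<iota> x = inv x"
      by (rule coords_eq) (use x rotation_if_coprime[OF cb.W_sub BW True] in \<open>auto simp: \<iota> coords_inv\<close>)
    then show ?thesis using S_inv[OF x] by simp
  next
    case False
    have ic: "\<iota> x \<in> carrier R" using \<iota> x by simp
    have "\<iota> x \<otimes> inv x \<in> cb.H" unfolding cbH by (rule A_coset_iff) (use x \<iota> in auto)
    then have "\<iota> x \<otimes> inv x \<otimes> x \<in> S \<longleftrightarrow> x \<in> S" using cb.S_left_invariant[OF x False] by blast
    then show ?thesis using x ic by (simp add: m_assoc)
  qed
  moreover obtain a where a: "a \<in> carrier R" "\<alpha> a = 1"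
    using coords_ex[of 1 0 False] two_lt_q r_pos by auto
  moreover have "\<iota> a \<noteq> a"
  proof
    assume "\<iota> a = a"
    then have "(- 1) mod int q = 1" using \<iota>(2)[OF a(1)] a(2) by simp
    then have "(- 1) mod int q = 1 mod int q" using two_lt_q by simp
    then have "int q dvd - 1 - 1" by (simp only: mod_eq_dvd_iff)
    then have "int q dvd 2" by simp
    then show False using two_lt_q by (auto dest: zdvd_imp_le)
  qed
  ultimately show ?thesis using nontrivial_aut_fixingI[OF \<iota>_iso S_sub] by blast
qed

text \<open>M is abelian, and its torsion part U of exponent dividing p^n meets the regular subgroup
  trivially. The orbit of U has order prime to q and r and dividing 2 q r, so it has length
  2.\<close>

lemma core_A_coprime_case:
  assumes N: "N = A" and V: "M \<lhd> G" "\<rho> ` N \<subseteq> M" "M \<inter> Rh = \<rho> ` N" "card M = q * p ^ n" "n > 0"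
    and p: "Factorial_Ring.prime p" "\<not> q dvd p ^ n" "\<not> r dvd p ^ n"
    and M: "\<forall>v\<in>M. \<forall>w\<in>M. conjg G v w \<otimes>\<^bsub>G\<^esub> inv\<^bsub>G\<^esub> w \<in> \<rho> ` N" "\<forall>v\<in>M. v [^]\<^bsub>G\<^esub> (p ^ n) \<in> \<rho> ` N"
  shows "nontrivial_aut_fixing R S"
proof -
  define m where "m = p ^ n"
  have Ms: "subgroup M G" using V(1) by (rule normal_imp_subgroup)
  have Mc: "v \<in> carrier G" if "v \<in> M" for v using Ms that by (rule subgroup.mem_carrier)
  have cop: "coprime m q" using prime_imp_coprime_nat[OF q_prime p(2)] unfolding m_def by (rule coprime_commute[THEN iffD1])
  have As: "subgroup (\<rho> ` A) G" by (rule \<rho>_subgroup[OF parts_subgroup(1)])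
  have cA: "card (\<rho> ` A) = q" using card_image[OF \<rho>_inj[OF subgroup.subset[OF parts_subgroup(1)]]] card_parts(1) by simp
  have Apow: "x [^]\<^bsub>G\<^esub> q = \<one>\<^bsub>G\<^esub>" if "x \<in> \<rho> ` A" for x
    using M.pow_card_subgroup[OF As that] cA M.fin finite_subset[OF subgroup.subset[OF As]] by simp
  have central: "g \<otimes>\<^bsub>G\<^esub> x = x \<otimes>\<^bsub>G\<^esub> g" if "g \<in> carrier G" "x \<in> \<rho> ` A" for g x
    using core_A_central[OF N that(1)] that(2) by blast
  have comm: "\<forall>v\<in>M. \<forall>w\<in>M. v \<otimes>\<^bsub>G\<^esub> w = w \<otimes>\<^bsub>G\<^esub> v"
  proof (intro ballI)
    fix v w assume vw: "v \<in> M" "w \<in> M"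
    have c: "v \<in> carrier G" "w \<in> carrier G" using vw Mc by auto
    let ?c = "conjg G v w \<otimes>\<^bsub>G\<^esub> inv\<^bsub>G\<^esub> w"
    have cA: "?c \<in> \<rho> ` A" using M(1) vw N by blast
    have cc: "?c \<in> carrier G" using c by simp
    \<comment> \<open>The commutator c of v and w is central, so v^k w v^-k = c^k w. For k = m the
      power v^m is central, which gives c^m = 1; with c^q = 1 and m prime to q this yields c =
      1.\<close>
    have pw: "conjg G (v [^]\<^bsub>G\<^esub> k) w = ?c [^]\<^bsub>G\<^esub> k \<otimes>\<^bsub>G\<^esub> w" for k :: nat
    proof (induction k)
      case (Suc k)
      have fixed: "conjg G v (?c [^]\<^bsub>G\<^esub> k) = ?c [^]\<^bsub>G\<^esub> k"
        using central[OF c(1) cA] M.group_commutes_pow[of ?c v k] c cc by (subst M.conjg_eq_iff) auto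
      have "conjg G (v [^]\<^bsub>G\<^esub> Suc k) w = conjg G v (conjg G (v [^]\<^bsub>G\<^esub> k) w)"
        using c M.nat_pow_Suc2[OF c(1)] by (simp add: M.conjg_mult)
      also have "\<dots> = ?c [^]\<^bsub>G\<^esub> k \<otimes>\<^bsub>G\<^esub> conjg G v w" unfolding Suc using c cc by (simp add: M.conjg_of_mult fixed)
      also have "conjg G v w = ?c \<otimes>\<^bsub>G\<^esub> w" using c by (simp add: M.m_assoc)
      finally show ?case using c cc by (simp add: M.m_assoc)
    qed (use c in simp)
    have "v [^]\<^bsub>G\<^esub> m \<in> \<rho> ` A" using M(2) vw N by (simp add: m_def)
    then have "conjg G (v [^]\<^bsub>G\<^esub> m) w = w" using central[of w "v [^]\<^bsub>G\<^esub> m"] c by (subst M.conjg_eq_iff) auto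
    then have "?c [^]\<^bsub>G\<^esub> m = \<one>\<^bsub>G\<^esub>" using pw[of m] c cc M.r_cancel_one'[of w "?c [^]\<^bsub>G\<^esub> m"] by simp
    then have "?c = \<one>\<^bsub>G\<^esub>" using M.pow_coprime_eq_one[OF cc _ Apow[OF cA] cop] by blast
    then have "conjg G v w = w" using pw[of 1] c by simp
    then show "v \<otimes>\<^bsub>G\<^esub> w = w \<otimes>\<^bsub>G\<^esub> v" using M.conjg_eq_iff c by blast
  qed
  define U where "U = {v \<in> M. v [^]\<^bsub>G\<^esub> m = \<one>\<^bsub>G\<^esub>}"
  have Vn: "U \<lhd> G" unfolding U_def by (rule M.torsion_normal[OF V(1)]) (use comm in blast)
  have U: "u \<in> U \<longleftrightarrow> u \<in> M \<and> u [^]\<^bsub>G\<^esub> m = \<one>\<^bsub>G\<^esub>" for u by (simp add: U_def)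
  have Vs: "subgroup U G" using Vn by (rule normal_imp_subgroup)
  have Vne: "U \<noteq> {\<one>\<^bsub>G\<^esub>}"
  proof -
    have "p dvd card M" using V(4,5) by (simp add: dvd_power dvd_mult)
    then obtain P where P: "subgroup P G" "P \<subseteq> M" "card P = p" using M.prime_subgroup_exists[OF M.fin Ms p(1)] by blast
    have "P \<noteq> {\<one>\<^bsub>G\<^esub>}" using P(3) p(1) by auto
    then obtain v where v: "v \<in> P" "v \<noteq> \<one>\<^bsub>G\<^esub>" using subgroup.one_closed[OF P(1)] by blast
    have vc: "v \<in> carrier G" using P v Mc by blast
    have "v [^]\<^bsub>G\<^esub> p = \<one>\<^bsub>G\<^esub>"
      using M.pow_card_subgroup[OF P(1) v(1)] P(3) M.fin finite_subset[OF subgroup.subset[OF P(1)]] by simp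
    moreover have "m = p * p ^ (n - 1)" using V(5) by (cases n) (auto simp: m_def)
    ultimately have "v [^]\<^bsub>G\<^esub> m = \<one>\<^bsub>G\<^esub>" using vc by (simp add: M.nat_pow_pow[symmetric])
    then have "v \<in> U" using v P(2) U by blast
    then show ?thesis using v(2) by blast
  qed
  have VR: "U \<inter> Rh = {\<one>\<^bsub>G\<^esub>}"
  proof
    show "U \<inter> Rh \<subseteq> {\<one>\<^bsub>G\<^esub>}"
    proof
      fix x assume x: "x \<in> U \<inter> Rh"
      have c: "x \<in> M" "x [^]\<^bsub>G\<^esub> m = \<one>\<^bsub>G\<^esub>" using IntD1[OF x] U by simp_all
      have "x \<in> M \<inter> Rh" using c(1) IntD2[OF x] by (rule IntI)
      then have "x \<in> \<rho> ` A" unfolding V(3) N .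
      then show "x \<in> {\<one>\<^bsub>G\<^esub>}" using M.pow_coprime_eq_one[OF Mc[OF c(1)] c(2) Apow cop] by simp
    qed
    show "{\<one>\<^bsub>G\<^esub>} \<subseteq> U \<inter> Rh" using IntI[OF subgroup.one_closed[OF Vs] subgroup.one_closed[OF M.R_sub]] by (simp only: insert_subset empty_subsetI simp_thms)
  qed
  define K where "K = (\<lambda>v. act v \<one>) ` U"
  have H: "subgroup K R" unfolding K_def by (rule orbit_subgroup[OF Vn])
  have HV: "card K dvd card U" unfolding K_def by (rule dvdI[OF orbit_stabilizer_card[OF Vs one_closed]])
  have "\<not> q dvd card K"
  proof
    assume "q dvd card K"
    then have "q dvd card U" using HV dvd_trans by blast
    then obtain P where P: "subgroup P G" "P \<subseteq> U" "card P = q" using M.prime_subgroup_exists[OF M.fin Vs q_prime] by blast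
    have "v = \<one>\<^bsub>G\<^esub>" if v: "v \<in> P" for v
    proof -
      have "v [^]\<^bsub>G\<^esub> q = \<one>\<^bsub>G\<^esub>"
        using M.pow_card_subgroup[OF P(1) v] P(3) M.fin finite_subset[OF subgroup.subset[OF P(1)]] by simp
      then show ?thesis using M.pow_coprime_eq_one[OF _ _ _ cop, of v] subsetD[OF P(2) v] U Mc by auto
    qed
    then have "card P \<le> 1" using card_mono[of "{\<one>\<^bsub>G\<^esub>}" P] by auto
    then show False using P(3) two_lt_q by simp
  qed
  moreover have "\<not> r dvd card K"
  proof
    assume "r dvd card K"
    then have "r dvd q * p ^ n"
      using dvd_trans[OF dvd_trans[OF _ HV] M.card_subgroup_dvd[OF Vs Ms]] V(4) U by auto
    then show False using p(3) r_prime primes_dvd_imp_eq[OF r_prime q_prime] q_ne_r by (auto simp: prime_dvd_mult_iff)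
  qed
  moreover have "card K dvd 2 * q * r"
    using card_subgroup_dvd[OF H subgroup_self subgroup.subset[OF H]] card_parts(5) by simp
  ultimately have "card K dvd 2"
    using prime_imp_coprime_nat[OF q_prime] prime_imp_coprime_nat[OF r_prime]
    by (metis coprime_commute coprime_dvd_mult_left_iff)
  moreover have "card K \<noteq> 1"
  proof
    assume "card K = 1"
    then obtain x where x: "K = {x}" by (rule card_1_singletonE)
    moreover have "\<one> = x" using subgroup.one_closed[OF H] unfolding x by (rule singletonD)
    ultimately show False using orbit_nontrivial[OF Vn Vne, folded K_def] by simp
  qed
  ultimately have H2: "card K = 2" using two_is_prime_nat by (metis prime_nat_iff)
  interpret cb: cayley_block R G \<rho> act S U 2
    by (rule cayley_blockI[OF Vn _ two_is_prime_nat H2[unfolded K_def]]) (use comm U in blast)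
  have cbH: "card cb.H = 2" using H2 by (simp add: cb.H_def K_def)
  have VnR: "\<not> U \<subseteq> Rh" using Vne VR by (metis Int_absorb2)
  have BW: "\<not> B \<subseteq> cb.W"
  proof
    assume "B \<subseteq> cb.W"
    moreover have "\<not> r dvd 2 - 1" using prime_gt_1_nat[OF r_prime] by simp
    ultimately have "\<rho> ` B \<lhd> G"
      using cb.prime_normal_if_in_W[OF parts_normal(2) _ card_parts(2) r_prime _ VnR] by blast
    then have "B \<subseteq> A" using normal_le_N[OF subgroup.subset[OF parts_subgroup(2)]] N by blast
    then show False using B_not_le_A by blast
  qed
  have "cb.H \<noteq> {\<one>}" using cbH by auto
  then obtain h where h: "h \<in> cb.H" "h \<noteq> \<one>" using subgroup.one_closed[OF cb.H_sub] by blast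
  have HD: "k \<in> D" if "k \<in> cb.H" for k by (rule order_two_D[OF cb.H_sub cbH that])
  have refl: "\<tau> k" if k: "k \<in> cb.H" "k \<noteq> \<one>" for k
  proof (rule ccontr)
    assume t: "\<not> \<tau> k"
    then have "\<beta> k = 0" using rotation_if_coprime[OF cb.W_sub BW] k(1) cb.H_W by blast
    then have "k = \<one>" using HD[OF k(1)] t by (intro coords_eq) (auto simp: D_def)
    then show False using k(2) by blast
  qed
  \<comment> \<open>A non-reflection in \<open>W\<close> lies in the central subgroup
    \<open>A\<close>. For a reflection w in \<open>W\<close>, the product w k is a non-reflection in
    \<open>W\<close> and so has rotation 0; hence w and k have the same \<beta> and commute.\<close>
  have comm_W: "k \<otimes> w = w \<otimes> k" if w: "w \<in> cb.W" and k: "k \<in> cb.H" for w k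
  proof (cases "k = \<one>")
    case False
    have c: "w \<in> carrier R" "k \<in> carrier R" using cb.W_carrier w cb.H_carrier k by auto
    have tk: "\<tau> k" by (rule refl[OF k False])
    show ?thesis
    proof (cases "\<tau> w")
      case False
      then have "w \<in> A" using rotation_if_coprime[OF cb.W_sub BW w] c by (simp add: A_def)
      then show ?thesis using A_central c by simp
    next
      case True
      have "w \<otimes> k \<in> cb.W" using w k cb.H_W subgroup.m_closed[OF cb.W_sub] by blast
      then have "\<beta> (w \<otimes> k) = 0" using rotation_if_coprime[OF cb.W_sub BW] \<tau>_mult[OF c] True tk by blast
      then have z: "(\<beta> w - \<beta> k) mod int r = 0" using \<beta>_mult[OF c] True by simp
      then have "\<beta> w mod int r = \<beta> k mod int r" by (simp only: mod_eq_dvd_iff mod_0_imp_dvd)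
      then have "\<beta> w = \<beta> k" using c by simp
      then show ?thesis using c True tk by (intro coords_eq) (simp_all add: \<alpha>_mult \<beta>_mult \<tau>_mult add.commute)
    qed
  qed (use cb.W_carrier w in auto)
  obtain y where y: "y \<in> carrier R" "h \<otimes> y \<noteq> y \<otimes> h" using noncentral_D[OF HD[OF h(1)] h(2)] by blast
  show ?thesis by (rule cb.nontrivial_aut_if_W_centralizes_H[OF comm_W h(1) y])
qed

text \<open>R/A is dihedral, and \<open>AB\<close>/\<open>A\<close>, of order r, lies in each of its
  nontrivial normal subgroups. So the dichotomy for G/A applies with s = r; its abelian alternative
  splits by whether p = q.\<close>

lemma core_A_case:
  assumes N: "N = A"
  shows "almost_simple (G Mod \<rho> ` A) \<or> nontrivial_aut_fixing R S"
proof -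
  have cards: "card (\<rho> ` A) = q" "card (\<rho> ` AB) = q * r" "card Rh = card (carrier R)"
    using card_image[OF \<rho>_inj] subgroup.subset[OF parts_subgroup(1)] subgroup.subset[OF parts_subgroup(4)] card_parts by auto
  have AAB: "A \<subseteq> AB" by (auto simp: part_defs)
  have "almost_simple (G Mod \<rho> ` A) \<or> (\<exists>M p n. M \<lhd> G \<and> \<rho> ` A \<subseteq> M \<and> M \<inter> Rh = \<rho> ` A \<and> Factorial_Ring.prime p \<and> n > 0 \<and>
    card M = card (\<rho> ` A) * p ^ n \<and> \<not> r dvd p ^ n \<and> (\<forall>v\<in>M. \<forall>w\<in>M. conjg G v w \<otimes>\<^bsub>G\<^esub> inv\<^bsub>G\<^esub> w \<in> \<rho> ` A) \<and>
    (\<forall>v\<in>M. v [^]\<^bsub>G\<^esub> (p ^ n) \<in> \<rho> ` A))"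
  proof (rule M.almost_simple_quotient_or_abelian)
    show "\<rho> ` A \<lhd> G" using N_normal N by simp
    show "\<rho> ` A \<subseteq> Rh" "\<rho> ` AB \<subseteq> Rh" using parts_carrier by auto
    show "K \<subseteq> \<rho> ` A" if "K \<lhd> G" "K \<subseteq> Rh" for K using N_max[OF that] N by simp
    show "subgroup (\<rho> ` AB) G" by (rule \<rho>_subgroup[OF parts_subgroup(4)])
    show "\<rho> ` A \<subseteq> \<rho> ` AB" using AAB by blast
    show "card (\<rho> ` AB) = card (\<rho> ` A) * r" using cards by simp
    show "\<not> card (\<rho> ` A) * (r * r) dvd card Rh" using cards sq_ndvd(2) by (metis dvd_mult_right)
    show "\<rho> ` AB \<subseteq> K"
      if K: "subgroup K G" "\<rho> ` A \<subseteq> K" "K \<subseteq> Rh" "\<And>x k. x \<in> Rh \<Longrightarrow> k \<in> K \<Longrightarrow> conjg G x k \<in> K" "K \<noteq> \<rho> ` A" for K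
    proof -
      let ?K = "{x \<in> carrier R. \<rho> x \<in> K}"
      have Ks: "subgroup ?K R" by (rule \<rho>_vimage_subgroup[OF K(1)])
      have "?K \<lhd> R"
        unfolding normal_iff_conjg
      proof (intro conjI ballI Ks)
        fix g h assume g: "g \<in> carrier R" and h: "h \<in> ?K"
        have "conjg G (\<rho> (inv g)) (\<rho> h) \<in> K" using K(4) g h by blast
        then show "conjg R g h \<in> ?K" using g h by (simp add: conjg_\<rho>)
      qed
      moreover have "\<not> ?K \<subseteq> A" using K(2,3,5) by blast
      ultimately have "B \<subseteq> ?K" using normal_without_B by blast
      moreover have "A \<subseteq> ?K" using K(2) parts_carrier by blast
      ultimately have "AB \<subseteq> ?K" by (intro AB_generated[OF Ks])
      then show ?thesis by blast
    qed
  qed (use \<rho>_conj_closed[OF parts_normal(4)] r_prime in auto)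
  then show ?thesis
  proof (elim disjE exE conjE)
    fix M p n
    assume M: "M \<lhd> G" "\<rho> ` A \<subseteq> M" "M \<inter> Rh = \<rho> ` A" "Factorial_Ring.prime p" "n > 0"
      "card M = card (\<rho> ` A) * p ^ n" "\<not> r dvd p ^ n" "\<forall>v\<in>M. \<forall>w\<in>M. conjg G v w \<otimes>\<^bsub>G\<^esub> inv\<^bsub>G\<^esub> w \<in> \<rho> ` A"
      "\<forall>v\<in>M. v [^]\<^bsub>G\<^esub> (p ^ n) \<in> \<rho> ` A"
    show ?thesis
    proof (cases "q dvd p ^ n")
      case True
      then have "q dvd p" using q_prime prime_dvd_power by blast
      then have "p = q" using primes_dvd_imp_eq[OF q_prime M(4)] by simp
      then show ?thesis using core_A_q_case[OF N M(1), of n] M(2,3,5,6) cards N by simp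
    next
      case False
      then show ?thesis
        using core_A_coprime_case[OF N M(1) _ _ _ M(5,4) False M(7)] M(2,3,6,8,9) cards N by simp
    qed
  qed simp
qed

lemma conclusion:
  "nontrivial_aut_fixing R S \<or> (N = {\<one>} \<and> almost_simple G) \<or> (N = A \<and> almost_simple (G Mod \<rho> ` A))"
proof -
  have "N \<noteq> carrier R" using N_normal not_normal by blast
  then show ?thesis
    using normal_cases[OF N_R] core_one_case core_A_case core_B_case core_D_case core_AB_case by blast
qed

end

subsection \<open>Concrete Cayley digraphs\<close>

lemma (in cayley_action) core_cayley_core:
  assumes "\<not> Rh \<lhd> G"
  obtains N where "core Rh G = \<rho> ` N" "cayley_core R G \<rho> act S N"
proof
  let ?N = "{x \<in> carrier R. \<rho> x \<in> core Rh G}"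
  show eq: "core Rh G = \<rho> ` ?N" using M.core_subset[OF M.R_sub] by blast
  show "cayley_core R G \<rho> act S ?N"
  proof (intro cayley_core.intro cayley_action_axioms cayley_core_axioms.intro)
    show "\<rho> ` ?N \<lhd> G" unfolding eq[symmetric] by (rule M.core_normal[OF M.R_sub])
    show "K \<subseteq> \<rho> ` ?N" if "K \<lhd> G" "K \<subseteq> Rh" for K
      unfolding eq[symmetric] by (rule M.core_greatest[OF M.R_sub that])
  qed (use assms in auto)
qed

lemma finite_Bij: "finite C \<Longrightarrow> finite (Bij C)"
  by (rule finite_subset[OF _ finite_PiE[of C "\<lambda>_. C"]]) (auto simp: Bij_def bij_betw_def PiE_def)

text \<open>Multiplication in \<open>BijGroup\<close> is composition. Its elements are extensional,
  so agreeing on R means being equal, which gives faithfulness; preservation of arcs becomes a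
  condition on the quotients y x^-1.\<close>

lemma cayley_action_right_reg:
  assumes R: "group R" "finite (carrier R)" and S: "S \<subseteq> carrier R"
    and G: "subgroup G (BijGroup (carrier R))" "G \<subseteq> cay_aut R S" "right_reg_image R \<subseteq> G"
    and maximal: "maximal_subgroup (right_reg_image R) (BijGroup (carrier R)\<lparr>carrier := G\<rparr>)"
  shows "cayley_action R (BijGroup (carrier R)\<lparr>carrier := G\<rparr>) (right_reg R) (\<lambda>g. g) S"
proof -
  interpret R: group R by fact
  have B: "g \<in> Bij (carrier R)" if "g \<in> G" for g
    using subgroup.mem_carrier[OF G(1) that] by (simp add: BijGroup_def)
  have closed: "g x \<in> carrier R" if "g \<in> G" "x \<in> carrier R" for g x
    using Bij_imp_funcset[OF B[OF that(1)]] that(2) by blast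
  have pres: "g y \<otimes>\<^bsub>R\<^esub> inv\<^bsub>R\<^esub> (g x) \<in> S \<longleftrightarrow> y \<otimes>\<^bsub>R\<^esub> inv\<^bsub>R\<^esub> x \<in> S"
    if g: "g \<in> G" and xy: "x \<in> carrier R" "y \<in> carrier R" for g x y
  proof -
    have "cay_arc R S x y \<longleftrightarrow> cay_arc R S (g x) (g y)" using G(2) g xy by (auto simp: cay_aut_def)
    then show ?thesis using closed[OF g] xy by (simp add: cay_arc_def)
  qed
  have "finite G" using B finite_Bij[OF R(2)] by (meson finite_subset subsetI)
  show ?thesis
  proof (intro cayley_action.intro R(1) maximal_subgroup_of.intro maximal_subgroup_of_axioms.intro cayley_action_axioms.intro)
    show "group (BijGroup (carrier R)\<lparr>carrier := G\<rparr>)"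
      by (rule group.subgroup_imp_group[OF group_BijGroup G(1)])
    show "maximal_subgroup (right_reg R ` carrier R) (BijGroup (carrier R)\<lparr>carrier := G\<rparr>)"
      using maximal by (simp add: right_reg_image_def)
    show "g = h" if "g \<in> carrier (BijGroup (carrier R)\<lparr>carrier := G\<rparr>)" "h \<in> carrier (BijGroup (carrier R)\<lparr>carrier := G\<rparr>)"
      "\<And>x. x \<in> carrier R \<Longrightarrow> g x = h x" for g h
      by (rule extensionalityI[of _ "carrier R"]) (use that B Bij_imp_extensional in auto)
    show "right_reg R x \<in> carrier (BijGroup (carrier R)\<lparr>carrier := G\<rparr>)" if "x \<in> carrier R" for x
      using G(3) that by (auto simp: right_reg_image_def)
  qed (use \<open>finite G\<close> R(2) S closed pres B in \<open>auto simp: BijGroup_def right_reg_def compose_def\<close>)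
qed

lemma dihedral_coords_of_iso:
  assumes R: "group R" and \<phi>: "\<phi> \<in> iso R (cyclic_group q \<times>\<times> dihedral_group r)"
    and qr: "Factorial_Ring.prime q" "odd q" "r \<in> {3, 5}" "q \<noteq> r"
  shows "dihedral_coords R q r (\<lambda>x. fst (\<phi> x)) (\<lambda>x. fst (snd (\<phi> x))) (\<lambda>x. snd (snd (\<phi> x)))"
proof -
  have q: "q \<noteq> 0" using qr(1) by auto
  have im: "\<phi> ` carrier R = {0..<int q} \<times> {0..<int r} \<times> UNIV" and inj: "inj_on \<phi> (carrier R)"
    using \<phi> q by (auto simp: iso_def bij_betw_def carrier_integer_mod_group dihedral_group_def)
  have mult: "\<phi> (x \<otimes>\<^bsub>R\<^esub> y) = \<phi> x \<otimes>\<^bsub>cyclic_group q \<times>\<times> dihedral_group r\<^esub> \<phi> y"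
    if "x \<in> carrier R" "y \<in> carrier R" for x y
    using \<phi> that by (simp add: iso_def hom_mult)
  have range: "\<phi> x \<in> {0..<int q} \<times> {0..<int r} \<times> UNIV" if "x \<in> carrier R" for x using im that by blast
  show ?thesis
  proof (intro dihedral_coords.intro R dihedral_coords_axioms.intro qr)
    show "x = y" if "x \<in> carrier R" "y \<in> carrier R" "fst (\<phi> x) = fst (\<phi> y)" "fst (snd (\<phi> x)) = fst (snd (\<phi> y))"
      "snd (snd (\<phi> x)) = snd (snd (\<phi> y))" for x y
      using inj that by (auto intro: inj_onD simp: prod_eq_iff)
    show "\<exists>x\<in>carrier R. fst (\<phi> x) = i \<and> fst (snd (\<phi> x)) = j \<and> snd (snd (\<phi> x)) = k"
      if "0 \<le> i" "i < int q" "0 \<le> j" "j < int r" for i j k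
    proof -
      have "(i, j, k) \<in> \<phi> ` carrier R" unfolding im using that by simp
      then obtain x where "(i, j, k) = \<phi> x" "x \<in> carrier R" by (rule imageE)
      then show ?thesis by (intro bexI[of _ x]) (simp_all add: \<open>(i, j, k) = \<phi> x\<close>[symmetric])
    qed
    fix x assume x: "x \<in> carrier R"
    show "0 \<le> fst (\<phi> x) \<and> fst (\<phi> x) < int q" "0 \<le> fst (snd (\<phi> x)) \<and> fst (snd (\<phi> x)) < int r"
      using range[OF x] by (auto simp: mem_Times_iff)
  qed (simp_all add: mult DirProd_def dihedral_group_def split_beta)
qed

text \<open>The second component is a homomorphism to C_r whatever the twist k is, and its kernel is
  the required normal subgroup; commutators vanish in the abelian image.\<close>

lemma prime_semidirect_of_iso:
  assumes R: "group R" "\<not> comm_group R" and \<phi>: "\<phi> \<in> iso R (semidirect_cyclic q r k)"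
    and qr: "Factorial_Ring.prime q" "Factorial_Ring.prime r" "q \<noteq> r"
  shows "prime_semidirect R {x \<in> carrier R. snd (\<phi> x) = 0} q r"
proof -
  let ?\<gamma> = "\<lambda>x. snd (\<phi> x)" and ?A = "{x \<in> carrier R. snd (\<phi> x) = 0}"
  have r: "r \<noteq> 0" and rp: "int r > 0" using qr(2) prime_gt_0_nat by auto
  have im: "\<phi> ` carrier R = {0..<int q} \<times> {0..<int r}" and inj: "inj_on \<phi> (carrier R)"
    using \<phi> by (auto simp: iso_def bij_betw_def semidirect_cyclic_def)
  have mult: "\<phi> (x \<otimes>\<^bsub>R\<^esub> y) = \<phi> x \<otimes>\<^bsub>semidirect_cyclic q r k\<^esub> \<phi> y" if "x \<in> carrier R" "y \<in> carrier R" for x y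
    using \<phi> that by (simp add: iso_def hom_mult)
  interpret C: comm_group "cyclic_group r" by (rule abelian_integer_mod_group)
  have hom: "?\<gamma> \<in> hom R (cyclic_group r)"
  proof (rule homI)
    show "?\<gamma> x \<in> carrier (cyclic_group r)" if "x \<in> carrier R" for x
      using imageI[OF that, of \<phi>] r unfolding im by (auto simp: carrier_integer_mod_group)
  qed (simp add: mult semidirect_cyclic_def split: prod.splits)
  interpret h: group_hom R "cyclic_group r" ?\<gamma>
    by (intro group_hom.intro group_hom_axioms.intro R(1) C.is_group hom)
  have A: "?A = kernel R (cyclic_group r) ?\<gamma>" by (simp add: kernel_def)
  show ?thesis
  proof (intro prime_semidirect.intro R prime_semidirect_axioms.intro qr)
    show "?A \<lhd> R" unfolding A by (rule h.normal_kernel)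
    have "\<phi> ` ?A = {0..<int q} \<times> {0}"
    proof
      show "\<phi> ` ?A \<subseteq> {0..<int q} \<times> {0}"
      proof
        fix z assume "z \<in> \<phi> ` ?A"
        then obtain x where "x \<in> carrier R" "snd (\<phi> x) = 0" "z = \<phi> x" by blast
        then show "z \<in> {0..<int q} \<times> {0}" using imageI[of x "carrier R" \<phi>] unfolding im by (cases z) auto
      qed
      show "{0..<int q} \<times> {0} \<subseteq> \<phi> ` ?A"
      proof
        fix z :: "int \<times> int" assume z: "z \<in> {0..<int q} \<times> {0}"
        then have "z \<in> \<phi> ` carrier R" unfolding im using rp by auto
        then obtain x where x: "z = \<phi> x" "x \<in> carrier R" by (rule imageE)
        then have "x \<in> ?A" using z by auto
        then show "z \<in> \<phi> ` ?A" unfolding x(1) by (rule imageI)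
      qed
    qed
    then show "card ?A = q" using card_image[OF inj_on_subset[OF inj], of ?A] by (simp add: card_cartesian_product)
    show "card (carrier R) = q * r" using card_image[OF inj] unfolding im by (simp add: card_cartesian_product)
    fix x y assume xy: "x \<in> carrier R" "y \<in> carrier R"
    have "?\<gamma> (conjg R x y) = conjg (cyclic_group r) (?\<gamma> x) (?\<gamma> y)"
      unfolding conjg_def using xy by (simp only: h.hom_mult h.hom_inv h.G.m_closed h.G.inv_closed)
    also have "\<dots> = ?\<gamma> y"
      using C.conjg_eq_iff[OF h.hom_closed h.hom_closed] C.m_comm[OF h.hom_closed h.hom_closed] xy by blast
    finally have "?\<gamma> (conjg R x y \<otimes>\<^bsub>R\<^esub> inv\<^bsub>R\<^esub> y) = \<one>\<^bsub>cyclic_group r\<^esub>"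
      using xy by (simp only: h.hom_mult h.hom_inv h.G.conjg_closed h.G.inv_closed C.r_inv h.hom_closed)
    then show "conjg R x y \<otimes>\<^bsub>R\<^esub> inv\<^bsub>R\<^esub> y \<in> ?A" using xy by simp
  qed
qed

theorem theorem4p12:
  fixes R :: "('a, 'b) monoid_scheme" and S :: "'a set" and G :: "('a \<Rightarrow> 'a) set"
    and q r :: nat
  assumes grpR: "group R"
    and primes: "Factorial_Ring.prime q" "Factorial_Ring.prime r" "q \<noteq> r"
    and cases: "(r \<in> {3, 5} \<and> odd q \<and> R \<cong> cyclic_group q \<times>\<times> dihedral_group r
                   \<and> (\<lambda>s. inv\<^bsub>R\<^esub> s) ` S = S)
              \<or> (\<not> comm_group R \<and>
                   (\<exists>k. k ^ r mod int q = 1 mod int q \<and> R \<cong> semidirect_cyclic q r k))"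
    and S_sub: "S \<subseteq> carrier R"
    and G_sub: "subgroup G (BijGroup (carrier R))"
    and G_aut: "G \<subseteq> cay_aut R S"
    and R_lt_G: "right_reg_image R \<subset> G"
    and maximal: "maximal_subgroup (right_reg_image R) ((BijGroup (carrier R))\<lparr>carrier := G\<rparr>)"
  shows "nontrivial_aut_fixing R S
       \<or> (core (right_reg_image R) ((BijGroup (carrier R))\<lparr>carrier := G\<rparr>) = {\<lambda>x \<in> carrier R. x}
          \<and> almost_simple ((BijGroup (carrier R))\<lparr>carrier := G\<rparr>))
       \<or> (R \<cong> cyclic_group q \<times>\<times> dihedral_group r
          \<and> (\<exists>Q. subgroup Q R \<and> card Q = q
               \<and> core (right_reg_image R) ((BijGroup (carrier R))\<lparr>carrier := G\<rparr>)
                   = right_reg R ` Q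
               \<and> almost_simple (((BijGroup (carrier R))\<lparr>carrier := G\<rparr>) Mod (right_reg R ` Q))))"
proof (cases "right_reg_image R \<lhd> BijGroup (carrier R)\<lparr>carrier := G\<rparr>")
  let ?G = "BijGroup (carrier R)\<lparr>carrier := G\<rparr>"
  interpret R: group R by (rule grpR)
  have q0: "q \<noteq> 0" and r0: "r \<noteq> 0" using primes by auto
  have "finite (carrier R)"
    using cases
  proof (elim disjE conjE exE)
    assume "R \<cong> cyclic_group q \<times>\<times> dihedral_group r"
    then obtain \<phi> where "bij_betw \<phi> (carrier R) (carrier (cyclic_group q \<times>\<times> dihedral_group r))"
      by (auto simp: is_iso_def iso_def)
    moreover have "finite (carrier (cyclic_group q \<times>\<times> dihedral_group r))"
      using q0 by (simp add: carrier_integer_mod_group dihedral_group_def)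
    ultimately show ?thesis using bij_betw_finite by blast
  next
    fix k assume "R \<cong> semidirect_cyclic q r k"
    then obtain \<phi> where "bij_betw \<phi> (carrier R) (carrier (semidirect_cyclic q r k))"
      by (auto simp: is_iso_def iso_def)
    moreover have "finite (carrier (semidirect_cyclic q r k))" by (simp add: semidirect_cyclic_def)
    ultimately show ?thesis using bij_betw_finite by blast
  qed
  then interpret cayley_action R ?G "right_reg R" "\<lambda>g. g" S
    using R_lt_G by (intro cayley_action_right_reg grpR S_sub G_sub G_aut maximal) auto
  {
    case True
    then show ?thesis using nontrivial_aut_if_regular_normal by (simp add: right_reg_image_def)
  next
    case False
    then obtain N where coreN: "core (right_reg_image R) ?G = right_reg R ` N"
      and cc: "cayley_core R ?G (right_reg R) (\<lambda>g. g) S N"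
      unfolding right_reg_image_def by (rule core_cayley_core)
    interpret cayley_core R ?G "right_reg R" "\<lambda>g. g" S N by (rule cc)
    \<comment> \<open>The restricted identity is right translation by the identity of R.\<close>
    have core_one: "core (right_reg_image R) ?G = {\<lambda>x \<in> carrier R. x}" if "N = {\<one>\<^bsub>R\<^esub>}"
      unfolding coreN that by (auto simp: right_reg_def)
    from cases show ?thesis
    proof (elim disjE conjE exE)
      assume r: "r \<in> {3, 5}" and q: "odd q" and iso: "R \<cong> cyclic_group q \<times>\<times> dihedral_group r"
        and S_inv: "(\<lambda>s. inv\<^bsub>R\<^esub> s) ` S = S"
      obtain \<phi> where \<phi>: "\<phi> \<in> iso R (cyclic_group q \<times>\<times> dihedral_group r)" using iso by (auto simp: is_iso_def)
      have inv_mem: "inv\<^bsub>R\<^esub> x \<in> S" if "x \<in> S" for x using S_inv that by blast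
      interpret cayley_dihedral R ?G "right_reg R" "\<lambda>g. g" S N q r
        "\<lambda>x. fst (\<phi> x)" "\<lambda>x. fst (snd (\<phi> x))" "\<lambda>x. snd (snd (\<phi> x))"
      proof (intro cayley_dihedral.intro cc dihedral_coords_of_iso grpR \<phi> primes q r cayley_dihedral_axioms.intro)
        show "inv\<^bsub>R\<^esub> x \<in> S \<longleftrightarrow> x \<in> S" if "x \<in> carrier R" for x
          using inv_mem[of x] inv_mem[of "inv\<^bsub>R\<^esub> x"] that by auto
      qed
      from conclusion show ?thesis
      proof (elim disjE conjE)
        \<comment> \<open>The subgroup Q of order q is the factor C_q of R.\<close>
        assume N: "N = A" and "almost_simple (?G Mod right_reg R ` A)"
        then show ?thesis using iso parts_subgroup(1) card_parts(1) coreN by blast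
      qed (use core_one in blast)+
    next
      fix k assume nc: "\<not> comm_group R" and "R \<cong> semidirect_cyclic q r k"
      then obtain \<phi> where \<phi>: "\<phi> \<in> iso R (semidirect_cyclic q r k)" by (auto simp: is_iso_def)
      have "cayley_semidirect R ?G (right_reg R) (\<lambda>g. g) S N {x \<in> carrier R. snd (\<phi> x) = 0} q r"
        by (intro cayley_semidirect.intro cc prime_semidirect_of_iso[OF grpR nc \<phi> primes])
      from cayley_semidirect.conclusion[OF this] show ?thesis using core_one by blast
    qed
  }
qed

end
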